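(* A Hurwitz group which does not surject onto $\mathrm{PSL}_2(7)$ is also a maximal reducible group; in particular, $\mathrm{PSL}_2(7)$ is the only simple Hurwitz group which is not a maximal reducible group.
   Context: All finite group actions are faithful and by orientation-preserving diffeomorphisms. A Hurwitz group is a finite group admitting an action of maximal possible order $84(g-1)$ on a closed orientable surface of some genus $g>1$; equivalently, a nontrivial finite quotient of the triangle group $(2,3,7)=\langle x,y,z\mid x^2=y^3=z^7=xyz=1\rangle$. An action of a finite group $G$ on a closed surface $\Sigma$ of genus $>1$ is reducible if there is a nontrivial (not null-homotopic) simple closed curve on $\Sigma$ mapped either to itself or to a disjoint curve by every element of $G$. The maximal possible order of a reducible action on a surface of genus $g>1$ is $12(g-1)$. A maximal reducible group is a finite group admitting a reducible action of maximal possible order $12(g-1)$ on a closed orientable surface of some genus $g>1$; equivalently, a finite quotient, with torsionfree kernel, of the quadrangle group $(2,2,2,3)=\langle x_1,x_2,x_3,x_4\mid x_1^2=x_2^2=x_3^2=x_4^3=x_1x_2x_3x_4=1\rangle$. *)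

theory Defs
  imports "HOL-Analysis.Determinants" "HOL-Library.Numeral_Type" "HOL-Algebra.Algebra"
begin

section \<open>Groups given by generators and relators\<close>

text \<open>
  A word over the generators \<open>'g\<close> is a list of letters; the letter \<open>(g, True)\<close> stands for
  \<open>g\<close> and \<open>(g, False)\<close> for the inverse of \<open>g\<close>.  The type \<open>'g\<close> is the whole generating set.
\<close>

type_synonym 'g word = "('g \<times> bool) list"

abbreviation gen :: "'g \<Rightarrow> 'g word" where
  "gen g \<equiv> [(g, True)]"

inductive word_eq :: "'g word set \<Rightarrow> 'g word \<Rightarrow> 'g word \<Rightarrow> bool" for R where
  refl: "word_eq R u u"
| sym: "word_eq R u v \<Longrightarrow> word_eq R v u"
| trans: "word_eq R u v \<Longrightarrow> word_eq R v w \<Longrightarrow> word_eq R u w"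
| cancel: "word_eq R (u @ [(g, b), (g, \<not> b)] @ v) (u @ v)"
| relator: "r \<in> R \<Longrightarrow> word_eq R (u @ r @ v) (u @ v)"

definition word_rel :: "'g word set \<Rightarrow> ('g word \<times> 'g word) set" where
  "word_rel R = {(u, v). word_eq R u v}"

definition presented_group :: "'g word set \<Rightarrow> 'g word set monoid" where
  "presented_group R =
     \<lparr>carrier = UNIV // word_rel R,
      mult = (\<lambda>A B. \<Union>u\<in>A. \<Union>v\<in>B. word_rel R `` {u @ v}),
      one = word_rel R `` {[]}\<rparr>"

lemma equiv_word_rel: "equiv UNIV (word_rel R)"
proof (rule equivI)
  show "refl (word_rel R)"
    by (simp add: word_rel_def refl_on_def word_eq.refl)
  show "sym (word_rel R)"
    by (simp add: word_rel_def sym_def word_eq.sym)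
  show "trans (word_rel R)"
    unfolding trans_def word_rel_def using word_eq.trans by fast
qed simp

lemma word_eq_append_right: "word_eq R u v \<Longrightarrow> word_eq R (u @ w) (v @ w)"
proof (induction rule: word_eq.induct)
  case (refl u)
  show ?case by (rule word_eq.refl)
next
  case (sym u v)
  show ?case by (rule word_eq.sym[OF sym.IH])
next
  case (trans u v w)
  show ?case by (rule word_eq.trans[OF trans.IH])
next
  case (cancel u g b v)
  show ?case using word_eq.cancel[of R u g b "v @ w"] by simp
next
  case (relator r u v)
  then show ?case using word_eq.relator[of r R u "v @ w"] by simp
qed

lemma word_eq_append_left: "word_eq R u v \<Longrightarrow> word_eq R (w @ u) (w @ v)"
proof (induction rule: word_eq.induct)
  case (refl u)
  show ?case by (rule word_eq.refl)
next
  case (sym u v)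
  show ?case by (rule word_eq.sym[OF sym.IH])
next
  case (trans u v w)
  show ?case by (rule word_eq.trans[OF trans.IH])
next
  case (cancel u g b v)
  show ?case using word_eq.cancel[of R "w @ u" g b v] by simp
next
  case (relator r u v)
  then show ?case using word_eq.relator[of r R "w @ u" v] by simp
qed

lemma word_eq_append: "word_eq R u u' \<Longrightarrow> word_eq R v v' \<Longrightarrow> word_eq R (u @ v) (u' @ v')"
  by (rule word_eq.trans[OF word_eq_append_right word_eq_append_left])

lemma word_rel_class_eq_iff: "word_rel R `` {u} = word_rel R `` {v} \<longleftrightarrow> word_eq R u v"
  using eq_equiv_class_iff[OF equiv_word_rel, of u v R] by (simp add: word_rel_def)

lemma presented_group_mult:
  "(word_rel R `` {u}) \<otimes>\<^bsub>presented_group R\<^esub> (word_rel R `` {v}) = word_rel R `` {u @ v}"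
proof -
  have "word_rel R `` {u' @ v'} = word_rel R `` {u @ v}"
    if "u' \<in> word_rel R `` {u}" "v' \<in> word_rel R `` {v}" for u' v'
  proof -
    have "word_eq R u u'" "word_eq R v v'"
      using that by (simp_all add: word_rel_def)
    then show ?thesis
      unfolding word_rel_class_eq_iff by (rule word_eq.sym[OF word_eq_append])
  qed
  then have "(\<Union>u'\<in>word_rel R `` {u}. \<Union>v'\<in>word_rel R `` {v}. word_rel R `` {u' @ v'})
      = (\<Union>u'\<in>word_rel R `` {u}. \<Union>v'\<in>word_rel R `` {v}. word_rel R `` {u @ v})"
    by (intro SUP_cong) simp_all
  moreover have "u \<in> word_rel R `` {u}" "v \<in> word_rel R `` {v}"
    by (simp_all add: word_rel_def word_eq.refl)
  ultimately show ?thesis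
    unfolding presented_group_def by auto
qed

lemma inverse_word: "\<exists>v. word_eq R (v @ u) []"
proof (induction u)
  case Nil
  then show ?case using word_eq.refl[of R "[]"] by (intro exI[of _ "[]"]) simp
next
  case (Cons a u)
  obtain g b where a: "a = (g, b)" by force
  from Cons obtain v where v: "word_eq R (v @ u) []" by blast
  have "word_eq R (v @ [(g, \<not> b), (g, \<not> \<not> b)] @ u) (v @ u)"
    by (rule word_eq.cancel)
  with v have "word_eq R ((v @ [(g, \<not> b)]) @ a # u) []"
    using word_eq.trans by (simp add: a) fast
  then show ?case by blast
qed

lemma group_presented_group: "group (presented_group R)"
proof (rule groupI)
  have carrier: "carrier (presented_group R) = range (\<lambda>u. word_rel R `` {u})"
    by (auto simp: presented_group_def quotient_def)
  have one: "\<one>\<^bsub>presented_group R\<^esub> = word_rel R `` {[]}"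
    by (simp add: presented_group_def)
  show "\<one>\<^bsub>presented_group R\<^esub> \<in> carrier (presented_group R)"
    by (auto simp: carrier one)
  fix x assume "x \<in> carrier (presented_group R)"
  then obtain u where x: "x = word_rel R `` {u}" by (auto simp: carrier)
  show "\<one>\<^bsub>presented_group R\<^esub> \<otimes>\<^bsub>presented_group R\<^esub> x = x"
    by (simp add: x one presented_group_mult)
  obtain w where "word_eq R (w @ u) []" using inverse_word by blast
  then have "(word_rel R `` {w}) \<otimes>\<^bsub>presented_group R\<^esub> x = \<one>\<^bsub>presented_group R\<^esub>"
    by (simp add: x one presented_group_mult word_rel_class_eq_iff)
  then show "\<exists>y\<in>carrier (presented_group R). y \<otimes>\<^bsub>presented_group R\<^esub> x = \<one>\<^bsub>presented_group R\<^esub>"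
    by (auto simp: carrier)
  fix y assume "y \<in> carrier (presented_group R)"
  then obtain v where y: "y = word_rel R `` {v}" by (auto simp: carrier)
  show "x \<otimes>\<^bsub>presented_group R\<^esub> y \<in> carrier (presented_group R)"
    by (auto simp: x y carrier presented_group_mult)
  fix z assume "z \<in> carrier (presented_group R)"
  then obtain w where z: "z = word_rel R `` {w}" by (auto simp: carrier)
  show "x \<otimes>\<^bsub>presented_group R\<^esub> y \<otimes>\<^bsub>presented_group R\<^esub> z
      = x \<otimes>\<^bsub>presented_group R\<^esub> (y \<otimes>\<^bsub>presented_group R\<^esub> z)"
    by (simp add: x y z presented_group_mult)
qed

section \<open>The triangle group (2,3,7) and the quadrangle group (2,2,2,3)\<close>

datatype tri_gen = TX | TY | TZ

definition triangle_group_237 :: "tri_gen word set monoid" where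
  "triangle_group_237 = presented_group
     {gen TX @ gen TX,
      gen TY @ gen TY @ gen TY,
      gen TZ @ gen TZ @ gen TZ @ gen TZ @ gen TZ @ gen TZ @ gen TZ,
      gen TX @ gen TY @ gen TZ}"

datatype quad_gen = QX1 | QX2 | QX3 | QX4

definition quadrangle_group_2223 :: "quad_gen word set monoid" where
  "quadrangle_group_2223 = presented_group
     {gen QX1 @ gen QX1,
      gen QX2 @ gen QX2,
      gen QX3 @ gen QX3,
      gen QX4 @ gen QX4 @ gen QX4,
      gen QX1 @ gen QX2 @ gen QX3 @ gen QX4}"

section \<open>Hurwitz groups and maximal reducible groups\<close>

text \<open>
  A quotient of a group \<open>H\<close> is, up to isomorphism, a group \<open>G\<close> together with an epimorphism
  from \<open>H\<close> to \<open>G\<close>; the kernel of the quotient is the kernel of that epimorphism.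

  The groups acting on a closed orientable surface of some genus \<open>g > 1\<close> with the maximal
  possible order \<open>84(g-1)\<close> are the nontrivial finite quotients of the triangle group (2,3,7);
  the groups admitting a reducible action of the maximal possible order \<open>12(g-1)\<close> are the
  finite quotients, with torsionfree kernel, of the quadrangle group (2,2,2,3).  These
  algebraic descriptions are taken as the definitions.
\<close>

definition hurwitz_group :: "('a, 'b) monoid_scheme \<Rightarrow> bool" where
  "hurwitz_group G \<longleftrightarrow>
     group G \<and> finite (carrier G) \<and> \<not> trivial_group G \<and>
     (\<exists>h. h \<in> epi triangle_group_237 G)"

definition torsionfree_subset :: "('a, 'b) monoid_scheme \<Rightarrow> 'a set \<Rightarrow> bool" where
  "torsionfree_subset H K \<longleftrightarrow>
     (\<forall>x\<in>K. \<forall>n::nat. n > 0 \<longrightarrow> x [^]\<^bsub>H\<^esub> n = \<one>\<^bsub>H\<^esub> \<longrightarrow> x = \<one>\<^bsub>H\<^esub>)"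

definition maximal_reducible_group :: "('a, 'b) monoid_scheme \<Rightarrow> bool" where
  "maximal_reducible_group G \<longleftrightarrow>
     group G \<and> finite (carrier G) \<and>
     (\<exists>h. h \<in> epi quadrangle_group_2223 G \<and>
          torsionfree_subset quadrangle_group_2223 (kernel quadrangle_group_2223 G h))"

definition surjects_onto :: "('a, 'b) monoid_scheme \<Rightarrow> ('c, 'd) monoid_scheme \<Rightarrow> bool" where
  "surjects_onto G H \<longleftrightarrow> (\<exists>h. h \<in> epi G H)"

section \<open>The group PSL(2,7)\<close>

text \<open>
  The numeral type \<open>7\<close> is the ring of integers modulo 7, that is, the field with seven
  elements; \<open>7 ^ 2 ^ 2\<close> is the type of 2-by-2 matrices over it.
\<close>

definition SL2_7 :: "(7 ^ 2 ^ 2) monoid" where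
  "SL2_7 = \<lparr>carrier = {A. det A = 1}, mult = (\<lambda>A B. A ** B), one = mat 1\<rparr>"

definition PSL2_7 :: "(7 ^ 2 ^ 2) set monoid" where
  "PSL2_7 = SL2_7 Mod {mat 1, - mat 1}"

lemma group_SL2_7: "group SL2_7"
proof (rule groupI)
  fix A assume "A \<in> carrier SL2_7"
  then have A: "A $ 1 $ 1 * A $ 2 $ 2 - A $ 1 $ 2 * A $ 2 $ 1 = 1"
    by (simp add: SL2_7_def det_2)
  define B :: "7 ^ 2 ^ 2" where
    "B = (\<chi> i j. if i = j then A $ (3 - i) $ (3 - j) else - A $ i $ j)"
  have B: "B $ 1 $ 1 = A $ 2 $ 2" "B $ 1 $ 2 = - A $ 1 $ 2"
    "B $ 2 $ 1 = - A $ 2 $ 1" "B $ 2 $ 2 = A $ 1 $ 1"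
    by (simp_all add: B_def)
  have "det B = 1"
    using A by (simp add: det_2 B algebra_simps)
  moreover have "B ** A = mat 1"
    using A by (simp add: vec_eq_iff forall_2 matrix_matrix_mult_def sum_2 mat_def B algebra_simps)
  ultimately show "\<exists>B\<in>carrier SL2_7. B \<otimes>\<^bsub>SL2_7\<^esub> A = \<one>\<^bsub>SL2_7\<^esub>"
    by (auto simp: SL2_7_def)
qed (auto simp: SL2_7_def det_mul det_I matrix_mul_assoc)

lemma normal_center_SL2_7: "{mat 1, - mat 1} \<lhd> SL2_7"
proof -
  interpret group SL2_7 by (rule group_SL2_7)
  have neg: "(- A) ** B = - (A ** B)" "A ** (- B) = - (A ** B)" for A B :: "7 ^ 2 ^ 2"
    by (simp_all add: vec_eq_iff matrix_matrix_mult_def sum_negf)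
  have det_neg: "det (- mat 1 :: 7 ^ 2 ^ 2) = 1"
    by (simp add: det_2 mat_def)
  have "subgroup {mat 1, - mat 1} SL2_7"
  proof (rule subgroupI)
    fix A :: "7 ^ 2 ^ 2" assume A: "A \<in> {mat 1, - mat 1}"
    then have "A \<otimes>\<^bsub>SL2_7\<^esub> A = \<one>\<^bsub>SL2_7\<^esub>" "A \<in> carrier SL2_7"
      using det_neg by (auto simp: SL2_7_def neg det_I)
    then have "inv\<^bsub>SL2_7\<^esub> A = A"
      by (simp add: inv_equality)
    with A show "inv\<^bsub>SL2_7\<^esub> A \<in> {mat 1, - mat 1}" by simp
  qed (use det_neg in \<open>auto simp: SL2_7_def neg det_I\<close>)
  then show ?thesis
    by (rule normalI) (auto simp: SL2_7_def r_coset_def l_coset_def neg)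
qed

lemma group_PSL2_7: "group PSL2_7"
  unfolding PSL2_7_def by (rule normal.factorgroup_is_group[OF normal_center_SL2_7])

end

theory Submission
  imports Defs "HOL-Computational_Algebra.Polynomial"
begin

text \<open>
  Write \<open>\<Delta>\<close> for the triangle group (2,3,7). The group \<open>PSL\<^sub>2(7)\<close>, which is isomorphic to
  \<open>GL\<^sub>3(2)\<close>, is a quotient of \<open>\<Delta>\<close> and permutes the seven nonzero vectors of a vector space of
  dimension three over the field with two elements transitively. On these vectors the involution
  \<open>x\<close> has three fixed points, the element \<open>y\<close> of order three has one and \<open>z\<close> has none. Therefore
  the stabiliser of a vector pulls back to a subgroup of index seven in \<open>\<Delta>\<close> that is generated by
  three involutions and an element of order three whose product is one; that is, it is a quotient
  of the quadrangle group (2,2,2,3).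

  Let \<open>H\<close> be the image of this subgroup in a Hurwitz group \<open>G\<close>. The seven cosets \<open>z\<^sup>i H\<close> exhaust
  \<open>G\<close>. Since 7 is prime, either \<open>z \<in> H\<close> and \<open>H = G\<close>, or the cosets are distinct and \<open>G\<close> acts on
  them as \<open>PSL\<^sub>2(7)\<close> acts on the seven vectors, which makes \<open>G\<close> surject onto \<open>PSL\<^sub>2(7)\<close>
  (\<open>generates_or_surjects_PSL2_7\<close>). In the first case \<open>G\<close> is a quotient of the quadrangle group in
  which all generators survive.

  It remains to see that the kernel is torsionfree. The quadrangle group is an amalgam of an
  infinite dihedral group and of the free product of cyclic groups of orders two and three. It
  acts on a projective line over a field of rational functions, and a ping-pong argument for this
  action shows that every element of finite order is conjugate to a power of a generator
  (\<open>torsion_elliptic\<close>). Such an element lies in the kernel only if it is trivial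
  (\<open>quadrangle_kernel_torsionfree\<close>).

  Conversely, \<open>PSL\<^sub>2(7)\<close> is not even a quotient of the quadrangle group
  (\<open>no_epi_quadrangle_PSL2_7\<close>). Involutions in \<open>GL\<^sub>3(2)\<close> are transvections and elements of order
  three fix a nonzero vector. By the argument of Scott's inequality, three involutions whose
  product has order dividing three then preserve a nonzero vector or a proper nonzero subspace,
  whereas \<open>PSL\<^sub>2(7)\<close> acts transitively on the nonzero vectors and contains a seven-cycle. The
  homomorphism from \<open>SL\<^sub>2(7)\<close> to \<open>GL\<^sub>3(2)\<close> is the linear part of the action on the projective line
  over the field with seven elements, regarded as an affine space by means of quadratic residues.
  Finally, a simple Hurwitz group that surjects onto \<open>PSL\<^sub>2(7)\<close> is isomorphic to it.
\<close>

section \<open>Homomorphisms from presented groups\<close>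

text \<open>
  The homomorphism that von Dyck's theorem extends to a presented group, before it is known to
  respect the relators.
\<close>

fun word_eval :: "('a, 'b) monoid_scheme \<Rightarrow> ('g \<Rightarrow> 'a) \<Rightarrow> 'g word \<Rightarrow> 'a" where
  "word_eval G f [] = \<one>\<^bsub>G\<^esub>"
| "word_eval G f ((g, b) # w) = (if b then f g else inv\<^bsub>G\<^esub> f g) \<otimes>\<^bsub>G\<^esub> word_eval G f w"

context group
begin

lemma word_eval_closed:
  assumes "\<And>g. f g \<in> carrier G"
  shows "word_eval G f w \<in> carrier G"
  using assms by (induction w) auto

lemma word_eval_append:
  assumes "\<And>g. f g \<in> carrier G"
  shows "word_eval G f (u @ v) = word_eval G f u \<otimes> word_eval G f v"
  using assms word_eval_closed[of f]
  by (induction u) (auto simp: m_assoc)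

lemma word_eval_respects:
  assumes f: "\<And>g. f g \<in> carrier G" and R: "\<And>r. r \<in> R \<Longrightarrow> word_eval G f r = \<one>"
    and "word_eq R u v"
  shows "word_eval G f u = word_eval G f v"
  using assms(3)
proof (induction rule: word_eq.induct)
  case (cancel u g b v)
  have "word_eval G f [(g, b), (g, \<not> b)] = \<one>"
    using f by simp
  then show ?case
    using word_eval_closed[of
      f, OF f] by (simp add: word_eval_append[OF f] del: word_eval.simps append_Cons)
next
  case (relator r u v)
  then show ?case
    using word_eval_closed[of f, OF f] R by (simp add: word_eval_append[OF f])
qed auto

lemma word_eval_in_generate: "word_eval G f w \<in> generate G (range f)"
proof (induction w)
  case Nil
  show ?case by (simp add: generate.one)
next
  case (Cons l w)
  obtain g b where "l = (g, b)" by force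
  then show ?case
    using Cons by (auto intro: generate.intros)
qed

end

lemma (in group_hom) hom_word_eval:
  assumes f: "\<And>g. f g \<in> carrier G"
  shows "h (word_eval G f w) = word_eval H (\<lambda>g. h (f g)) w"
proof (induction w)
  case (Cons l w)
  obtain g b where l: "l = (g, b)" by force
  have "word_eval G f w \<in> carrier G" by (rule G.word_eval_closed[OF f])
  with f Cons show ?case by (simp add: l)
qed simp

abbreviation word_class :: "'g word set \<Rightarrow> 'g word \<Rightarrow> 'g word set" where
  "word_class R w \<equiv> word_rel R `` {w}"

lemma carrier_presented_group: "carrier (presented_group R) = range (word_class R)"
  by (auto simp: presented_group_def quotient_def)

lemma word_class_closed: "word_class R w \<in> carrier (presented_group R)"
  by (simp add: carrier_presented_group)

lemma one_presented_group: "\<one>\<^bsub>presented_group R\<^esub> = word_class R []"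
  by (simp add: presented_group_def)

lemma inv_word_class_gen:
  "inv\<^bsub>presented_group R\<^esub> word_class R [(g, b)] = word_class R [(g, \<not> b)]"
proof -
  interpret group "presented_group R" by (rule group_presented_group)
  have "word_eq R [(g, \<not> b), (g, b)] []"
    using word_eq.cancel[of R "[]" g "\<not> b" "[]"] by simp
  then have "word_class R [(g, \<not> b)] \<otimes>\<^bsub>presented_group R\<^esub> word_class R [(g, b)] = \<one>\<^bsub>presented_group R\<^esub>"
    unfolding presented_group_mult one_presented_group word_rel_class_eq_iff by simp
  then show ?thesis
    by (rule inv_equality[OF _ word_class_closed word_class_closed])
qed

lemma word_class_eq_word_eval:
  "word_class R w = word_eval (presented_group R) (\<lambda>g. word_class R (gen g)) w"
proof (induction w)
  case Nil
  then show ?case by (simp add: one_presented_group)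
next
  case (Cons l w)
  obtain g b where l: "l = (g, b)" by force
  have "word_class R (l # w) = word_class R [(g, b)] \<otimes>\<^bsub>presented_group R\<^esub> word_class R w"
    by (simp add: presented_group_mult l)
  also have "\<dots> = word_eval (presented_group R) (\<lambda>g. word_class R (gen g)) (l # w)"
    using Cons inv_word_class_gen[of R g True] by (simp add: l)
  finally show ?case .
qed

text \<open>
  Von Dyck's theorem: every assignment of the generators that satisfies the relators extends.
\<close>

theorem presented_group_hom:
  assumes "group G" and f: "\<And>g. f g \<in> carrier G"
    and R: "\<And>r. r \<in> R \<Longrightarrow> word_eval G f r = \<one>\<^bsub>G\<^esub>"
  obtains h where "h \<in> hom (presented_group R) G" "\<And>w. h (word_class R w) = word_eval G f w"
proof -
  interpret group G by fact
  define h where "h A = word_eval G f (SOME w. w \<in> A)" for A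
  have h: "h (word_class R w) = word_eval G f w" for w
  proof -
    have "w \<in> word_class R w" by (simp add: word_rel_def word_eq.refl)
    then have "(SOME v. v \<in> word_class R w) \<in> word_class R w" by (rule someI)
    then have "word_eq R w (SOME v. v \<in> word_class R w)" by (simp add: word_rel_def)
    from word_eval_respects[OF f R this] show ?thesis by (simp add: h_def)
  qed
  have "h \<in> hom (presented_group R) G"
    by (rule homI)
      (auto simp:
        carrier_presented_group h presented_group_mult word_eval_append[OF f] word_eval_closed[OF f])
  with h that show ?thesis by blast
qed

lemma hom_word_class:
  assumes "group G" "h \<in> hom (presented_group R) G"
  shows "h (word_class R w) = word_eval G (\<lambda>g. h (word_class R (gen g))) w"
proof -
  interpret group_hom "presented_group R" G h
    using assms group_presented_group by (simp add: group_hom_def group_hom_axioms_def)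
  show ?thesis
    by (subst word_class_eq_word_eval) (rule hom_word_eval[OF word_class_closed])
qed

lemma hom_presented_group_relator:
  assumes "group G" "h \<in> hom (presented_group R) G" "r \<in> R"
  shows "word_eval G (\<lambda>g. h (word_class R (gen g))) r = \<one>\<^bsub>G\<^esub>"
proof -
  interpret P: group "presented_group R" by (rule group_presented_group)
  interpret group G by fact
  interpret group_hom "presented_group R" G h using assms(2) by unfold_locales
  have "word_eq R r []" using word_eq.relator[OF assms(3), of "[]" "[]"] by simp
  then have "word_class R r = \<one>\<^bsub>presented_group R\<^esub>"
    by (simp add: one_presented_group word_rel_class_eq_iff)
  then have "h (word_class R r) = \<one>\<^bsub>G\<^esub>" by simp
  then show ?thesis by (simp only: hom_word_class[OF assms(1,2), of r])
qed

text \<open>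
  This is how a quotient of a presented group is turned into a group with distinguished
  generators.
\<close>

lemma epi_presented_group_generate:
  assumes "group G" "h \<in> epi (presented_group R) G"
  shows "carrier G = generate G (range (\<lambda>g. h (word_class R (gen g))))"
proof -
  interpret group G by fact
  have h: "h \<in> hom (presented_group R) G" and s: "h ` carrier (presented_group R) = carrier G"
    using assms(2) by (auto simp: epi_def)
  have "range (\<lambda>g. h (word_class R (gen g))) \<subseteq> carrier G"
    using s by (auto simp: carrier_presented_group)
  then have "generate G (range (\<lambda>g. h (word_class R (gen g)))) \<subseteq> carrier G"
    by (rule generate_incl)
  moreover have "h (word_class R w) \<in> generate G (range (\<lambda>g. h (word_class R (gen g))))" for w
    by (subst hom_word_class[OF assms(1) h]) (rule word_eval_in_generate)
  then have "carrier G \<subseteq> generate G (range (\<lambda>g. h (word_class R (gen g))))"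
    unfolding s[symmetric] carrier_presented_group by blast
  ultimately show ?thesis by blast
qed

text \<open>
  With generating images the extension is onto, because every element of a generated subgroup is
  the value of a word.
\<close>

lemma presented_group_epi:
  assumes "group G" and f: "\<And>g. f g \<in> carrier G"
    and R: "\<And>r. r \<in> R \<Longrightarrow> word_eval G f r = \<one>\<^bsub>G\<^esub>"
    and gen: "carrier G \<subseteq> generate G (range f)"
  shows "\<exists>h\<in>epi (presented_group R) G. \<forall>w. h (word_class R w) = word_eval G f w"
proof -
  interpret group G by fact
  obtain h where h: "h \<in> hom (presented_group R) G" "\<And>w. h (word_class R w) = word_eval G f w"
    using presented_group_hom[of G f R] assms by blast
  have "a \<in> range (word_eval G f)" if "a \<in> generate G (range f)" for a
    using that
  proof (induction rule: generate.induct)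
    case one
    then show ?case by (metis rangeI word_eval.simps(1))
  next
    case (incl a)
    then obtain g where "a = f g" by blast
    then have "a = word_eval G f (gen g)" using f by simp
    then show ?case by blast
  next
    case (inv a)
    then obtain g where "a = f g" by blast
    then have "inv\<^bsub>G\<^esub> a = word_eval G f [(g, False)]" using f by simp
    then show ?case by blast
  next
    case (eng a b)
    then obtain u v where "a = word_eval G f u" "b = word_eval G f v" by blast
    then have "a \<otimes>\<^bsub>G\<^esub> b = word_eval G f (u @ v)" using word_eval_append[of f u v, OF f] by simp
    then show ?case by blast
  qed
  then have "carrier G \<subseteq> range (word_eval G f)"
    using gen by blast
  also have "\<dots> = h ` carrier (presented_group R)"
    unfolding carrier_presented_group image_image h(2) ..
  finally have "carrier G \<subseteq> h ` carrier (presented_group R)" .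
  moreover have "h ` carrier (presented_group R) \<subseteq> carrier G"
    using h(1) by (auto simp: hom_def)
  ultimately have "h \<in> epi (presented_group R) G"
    using h(1) by (auto simp: epi_def)
  with h(2) show ?thesis by blast
qed

section \<open>Conjugacy and products of lists in a group\<close>

context group
begin

lemma inv_mult_cancel_left [simp]:
  "x \<in> carrier G \<Longrightarrow> y \<in> carrier G \<Longrightarrow> inv x \<otimes> (x \<otimes> y) = y"
  "x \<in> carrier G \<Longrightarrow> y \<in> carrier G \<Longrightarrow> x \<otimes> (inv x \<otimes> y) = y"
  by (simp_all add: m_assoc[symmetric])

text \<open>
  Normal forms below are shown to exhaust a subgroup by checking that multiplication by one
  generator or its inverse, always on the right, preserves the set of normal forms.
\<close>

lemma generate_subset_rightI:
  assumes "A \<subseteq> carrier G" "S \<subseteq> carrier G" "\<one> \<in> S"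
    and "\<And>x h. x \<in> S \<Longrightarrow> h \<in> A \<Longrightarrow> x \<otimes> h \<in> S"
    and "\<And>x h. x \<in> S \<Longrightarrow> h \<in> A \<Longrightarrow> x \<otimes> inv h \<in> S"
  shows "generate G A \<subseteq> S"
proof
  fix g assume g: "g \<in> generate G A"
  have "\<forall>x\<in>S. x \<otimes> g \<in> S"
    using g
  proof (induction rule: generate.induct)
    case one
    then show ?case using assms(2) by auto
  next
    case (eng h1 h2)
    have "h1 \<in> carrier G" "h2 \<in> carrier G"
      using eng.hyps generate_incl[OF assms(1)] by auto
    then show ?case using eng.IH assms(2) by (metis m_assoc subsetD)
  qed (use assms(4,5) in auto)
  then have "\<one> \<otimes> g \<in> S" using assms(3) by blast
  then show "g \<in> S"
    using g generate_incl[OF assms(1)] by auto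
qed

definition conjugate :: "'a \<Rightarrow> 'a \<Rightarrow> bool" where
  "conjugate x y \<longleftrightarrow> (\<exists>k\<in>carrier G. y = k \<otimes> x \<otimes> inv k)"

lemma conjugate_refl: "x \<in> carrier G \<Longrightarrow> conjugate x x"
  unfolding conjugate_def by (rule bexI[of _ \<one>]) auto

lemma conjugate_trans:
  assumes "conjugate x y" "conjugate y z" "x \<in> carrier G"
  shows "conjugate x z"
proof -
  obtain k l where "k \<in> carrier G" "l \<in> carrier G" "y = k \<otimes> x \<otimes> inv k" "z = l \<otimes> y \<otimes> inv l"
    using assms unfolding conjugate_def by blast
  then have "z = (l \<otimes> k) \<otimes> x \<otimes> inv (l \<otimes> k)"
    using assms(3) by (simp add: m_assoc inv_mult_group)
  then show ?thesis
    unfolding conjugate_def using \<open>k \<in> carrier G\<close> \<open>l \<in> carrier G\<close> by blast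
qed

lemma conjugate_sym:
  assumes "conjugate x y" "x \<in> carrier G"
  shows "conjugate y x"
proof -
  obtain k where k: "k \<in> carrier G" "y = k \<otimes> x \<otimes> inv k"
    using assms unfolding conjugate_def by blast
  then have "x = inv k \<otimes> y \<otimes> inv (inv k)"
    using assms(2) by (simp add: m_assoc)
  then show ?thesis unfolding conjugate_def using k by blast
qed

lemma conjugate_rotate:
  assumes "x \<in> carrier G" "y \<in> carrier G"
  shows "conjugate (x \<otimes> y) (y \<otimes> x)"
  unfolding conjugate_def using assms
  by (intro bexI[of _ y]) (auto simp: m_assoc)

lemma conjugate_pow_eq_one:
  assumes "conjugate x y" "x \<in> carrier G" "x [^] (n::nat) = \<one>"
  shows "y [^] n = \<one>"
proof -
  obtain k where k: "k \<in> carrier G" "y = k \<otimes> x \<otimes> inv k"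
    using assms unfolding conjugate_def by blast
  have "(k \<otimes> x \<otimes> inv k) [^] m = k \<otimes> x [^] m \<otimes> inv k" for m :: nat
  proof (induction m)
    case (Suc m)
    have "(k \<otimes> x \<otimes> inv k) [^] Suc m = (k \<otimes> x [^] m \<otimes> inv k) \<otimes> (k \<otimes> x \<otimes> inv k)"
      using Suc k assms(2) by simp
    also have "\<dots> = k \<otimes> x [^] m \<otimes> (inv k \<otimes> k) \<otimes> x \<otimes> inv k"
      using k(1) assms(2) by (simp add: m_assoc del: l_inv)
    also have "\<dots> = k \<otimes> x [^] Suc m \<otimes> inv k"
      using k(1) assms(2) by (simp add: m_assoc)
    finally show ?case .
  qed (use k in simp)
  then show ?thesis using assms(3) k by simp
qed

definition list_prod :: "'a list \<Rightarrow> 'a" where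
  "list_prod xs = foldr (\<otimes>) xs \<one>"

lemma list_prod_simps [simp]:
  "list_prod [] = \<one>" "list_prod (x # xs) = x \<otimes> list_prod xs"
  by (simp_all add: list_prod_def)

lemma list_prod_closed [simp, intro]: "set xs \<subseteq> carrier G \<Longrightarrow> list_prod xs \<in> carrier G"
  by (induction xs) auto

lemma list_prod_append:
  "set xs \<subseteq> carrier G \<Longrightarrow> set ys \<subseteq> carrier G \<Longrightarrow> list_prod (xs @ ys) = list_prod xs \<otimes> list_prod ys"
  by (induction xs) (auto simp: m_assoc)

lemma list_prod_rotate:
  "set xs \<subseteq> carrier G \<Longrightarrow> set ys \<subseteq> carrier G \<Longrightarrow> conjugate (list_prod (xs @ ys)) (list_prod (ys @ xs))"
  by (simp add: list_prod_append conjugate_rotate)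

lemma list_prod_pow:
  "set xs \<subseteq> carrier G \<Longrightarrow> list_prod xs [^] (n::nat) = list_prod (concat (replicate n xs))"
proof (induction n)
  case (Suc n)
  have "set (concat (replicate n xs)) \<subseteq> carrier G" using Suc.prems by (induction n) auto
  then have "list_prod (concat (replicate (Suc n) xs)) = list_prod xs \<otimes> list_prod xs [^] n"
    using Suc by (simp add: list_prod_append)
  then show ?case
    using Suc.prems nat_pow_Suc2[of "list_prod xs" n] by simp
qed simp

end

section \<open>Transformations up to sign\<close>

text \<open>
  The generators of order two and three, of which the action below is made, satisfy their
  relations only up to sign, so transformations are compared up to a sign common to all vectors.
\<close>

type_synonym vec2 = "int poly \<times> int poly"

definition proj_eq :: "(vec2 \<Rightarrow> vec2) \<Rightarrow> (vec2 \<Rightarrow> vec2) \<Rightarrow> bool" where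
  "proj_eq f g \<longleftrightarrow> (\<forall>v. f v = g v) \<or> (\<forall>v. f v = - g v)"

definition mat2 :: "int poly \<Rightarrow> int poly \<Rightarrow> int poly \<Rightarrow> int poly \<Rightarrow> vec2 \<Rightarrow> vec2" where
  "mat2 p q r s = (\<lambda>(x, y). (p * x + q * y, r * x + s * y))"

lemma mat2_apply: "mat2 p q r s (x, y) = (p * x + q * y, r * x + s * y)"
  by (simp add: mat2_def)

lemma mat2_comp: "mat2 p q r s \<circ> mat2 p' q' r' s'
    = mat2 (p * p' + q * r') (p * q' + q * s') (r * p' + s * r') (r * q' + s * s')"
  by (auto simp: mat2_def fun_eq_iff algebra_simps)

lemma mat2_one: "mat2 1 0 0 1 = id"
  by (auto simp: mat2_def fun_eq_iff)

lemma mat2_odd: "mat2 p q r s (- v) = - mat2 p q r s v"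
  by (cases v) (simp add: mat2_def)

lemma proj_eq_refl: "proj_eq f f" by (simp add: proj_eq_def)

lemma proj_eq_sym: "proj_eq f g \<Longrightarrow> proj_eq g f" unfolding proj_eq_def by (metis minus_minus)

lemma proj_eq_trans [trans]: "proj_eq f g \<Longrightarrow> proj_eq g h \<Longrightarrow> proj_eq f h"
  unfolding proj_eq_def by (metis minus_minus)

lemma proj_eq_comp:
  assumes "proj_eq f f'" "proj_eq g g'" "\<And>v. f (- v) = - f v"
  shows "proj_eq (f \<circ> g) (f' \<circ> g')"
proof -
  have "f' (- v) = - f' v" for v using assms(1,3) unfolding proj_eq_def by (metis minus_minus)
  with assms(1,2) show ?thesis unfolding proj_eq_def comp_def by (metis minus_minus)
qed

lemma proj_eq_cases:
  assumes "proj_eq f g"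
  obtains "f v = g v" | "f v = - g v"
  using assms unfolding proj_eq_def by metis

section \<open>Conjugacy classes of the modular group\<close>

text \<open>
  In the quadrangle group put \<open>u = x\<^sub>3 x\<^sub>4 = (x\<^sub>1 x\<^sub>2)\<^sup>-\<^sup>1\<close>. It is the amalgam of the infinite
  dihedral group \<open>\<langle>x\<^sub>1, x\<^sub>2\<rangle>\<close> and of \<open>B = \<langle>x\<^sub>3, x\<^sub>4\<rangle>\<close>, the free product of cyclic groups of orders
  two and three, along the infinite cyclic group \<open>\<langle>u\<rangle>\<close>. Since \<open>x\<^sub>2 = x\<^sub>1 u\<^sup>-\<^sup>1\<close>, the generators
  \<open>a = x\<^sub>1\<close>, \<open>c = x\<^sub>3\<close>, \<open>d = x\<^sub>4\<close> suffice, and the relation \<open>x\<^sub>2\<^sup>2 = 1\<close> says that \<open>a\<close> inverts \<open>u\<close>.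

  The projective action makes \<open>B\<close> the modular group, with \<open>u\<close> the translation by one, and \<open>a\<close> the
  map that sends \<open>z\<close> to \<open>X - z\<close>, which fixes the same point at infinity as \<open>u\<close>. The indeterminate
  \<open>X\<close> plays the role of an infinitely large number; this is what makes the factors play ping-pong.
\<close>

locale quadrangle_action = group Q for Q (structure) +
  fixes a c d :: 'a and act :: "'a \<Rightarrow> vec2 \<Rightarrow> vec2"
  assumes a_closed [simp]: "a \<in> carrier Q" and c_closed [simp]: "c \<in> carrier Q"
    and d_closed [simp]: "d \<in> carrier Q"
    and a_sq: "a \<otimes> a = \<one>" and c_sq: "c \<otimes> c = \<one>" and d_cube: "d \<otimes> (d \<otimes> d) = \<one>"
    and a_inverts: "a \<otimes> (c \<otimes> d) \<otimes> a = inv (c \<otimes> d)"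
    and gen: "carrier Q = generate Q {a, c, d}"
    and act_one: "proj_eq (act \<one>) id"
    and act_mult: "\<And>x y. x \<in> carrier Q \<Longrightarrow> y \<in> carrier Q \<Longrightarrow> proj_eq (act (x \<otimes> y)) (act x \<circ> act y)"
    and act_odd: "\<And>x v. act x (- v) = - act x v"
    and act_a: "proj_eq (act a) (mat2 (-1) [:0, 1:] 0 1)"
    and act_c: "proj_eq (act c) (mat2 0 (-1) 1 0)"
    and act_d: "proj_eq (act d) (mat2 0 1 (-1) (-1))"
begin

lemma act_mult_mat2:
  assumes "x \<in> carrier Q" "y \<in> carrier Q"
    and "proj_eq (act x) (mat2 p q r s)" "proj_eq (act y) (mat2 p' q' r' s')"
  shows "proj_eq (act (x \<otimes> y))
    (mat2 (p * p' + q * r') (p * q' + q * s') (r * p' + s * r') (r * q' + s * s'))"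
  unfolding mat2_comp[symmetric]
  by (rule proj_eq_trans[OF act_mult[OF assms(1,2)] proj_eq_comp[OF assms(3,4) act_odd]])

lemma a_cancel [simp]: "x \<in> carrier Q \<Longrightarrow> a \<otimes> (a \<otimes> x) = x"
  by (simp add: m_assoc[symmetric] a_sq)

lemma c_cancel [simp]: "x \<in> carrier Q \<Longrightarrow> c \<otimes> (c \<otimes> x) = x"
  by (simp add: m_assoc[symmetric] c_sq)

lemma inv_a: "inv a = a" by (rule inv_equality) (simp_all add: a_sq)

lemma inv_c: "inv c = c" by (rule inv_equality) (simp_all add: c_sq)

lemma d_d: "d \<otimes> d = inv d"
  by (rule inv_equality[symmetric]) (simp_all add: d_cube m_assoc)

lemma inv_d_inv_d: "inv d \<otimes> inv d = d"
  using inv_mult_group[of d d] by (simp add: d_d)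

lemma act_inv_d: "proj_eq (act (inv d)) (mat2 (-1) (-1) 1 0)"
  using act_mult_mat2[OF d_closed d_closed act_d act_d] by (simp add: d_d)

abbreviation B :: "'a set" where "B \<equiv> generate Q {c, d}"

lemma B_subgroup: "subgroup B Q"
  by (rule generate_is_subgroup) simp

lemma B_closed: "x \<in> B \<Longrightarrow> x \<in> carrier Q"
  using subgroup.subset[OF B_subgroup] by blast

lemma c_in_B: "c \<in> B" and d_in_B: "d \<in> B"
  by (auto intro: generate.incl)

text \<open>
  The two elements \<open>step e\<close> act up to sign as the upper and the lower elementary matrix, which
  have nonnegative entries; this is why they, and not \<open>c\<close> and \<open>d\<close>, are the letters of the normal
  form.
\<close>

definition step :: "bool \<Rightarrow> 'a" where
  "step e = c \<otimes> (if e then d else inv d)"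

lemma step_closed [simp]: "step e \<in> carrier Q"
  by (simp add: step_def)

abbreviation steps :: "bool list \<Rightarrow> 'a" where
  "steps es \<equiv> list_prod (map step es)"

lemma map_step_closed [simp]: "set (map step es) \<subseteq> carrier Q"
  by auto

lemma steps_append: "steps (es @ fs) = steps es \<otimes> steps fs"
  using list_prod_append[OF map_step_closed map_step_closed, of es fs] by simp

text \<open>
  A word in \<open>c\<close>, \<open>d\<close> and \<open>inv d\<close> without adjacent letters of the same factor alternates between
  \<open>c\<close> and a power of \<open>d\<close>; cutting it in front of every \<open>c\<close> leaves at most a power of \<open>d\<close> at the
  beginning and one \<open>c\<close> at the end.
\<close>

lemma B_normal_form:
  assumes "g \<in> B"
  obtains x es y where "x \<in> {\<one>, d, inv d}" "y \<in> {\<one>, c}" "g = x \<otimes> steps es \<otimes> y"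
proof -
  define S where "S = {x \<otimes> steps es \<otimes> y | x es y. x \<in> {\<one>, d, inv d} \<and> y \<in> {\<one>, c}}"
  have S_I: "x \<otimes> steps es \<otimes> y \<in> S" if "x \<in> {\<one>, d, inv d}" "y \<in> {\<one>, c}" for x es y
    using that unfolding S_def by blast
  have mult_c: "g \<otimes> c \<in> S" if "g \<in> S" for g
  proof -
    obtain x es y where g: "g = x \<otimes> steps es \<otimes> y" and xy: "x \<in> {\<one>, d, inv d}" "y \<in> {\<one>, c}"
      using \<open>g \<in> S\<close> unfolding S_def by blast
    have "y \<otimes> c \<in> {\<one>, c}" using xy by (auto simp: c_sq)
    moreover have "g \<otimes> c = x \<otimes> steps es \<otimes> (y \<otimes> c)"
      using xy by (auto simp: g m_assoc list_prod_closed[OF map_step_closed])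
    ultimately show ?thesis using S_I xy by metis
  qed
  have mult_d: "g \<otimes> (if e then d else inv d) \<in> S" if "g \<in> S" for g e
  proof -
    (* Since d has order three, multiplying a final step by u flips its sign or removes its
       power of d altogether. *)
    define u where "u = (if e then d else inv d)"
    have u: "u \<in> carrier Q" "u \<otimes> u = (if e then inv d else d)" "step e = c \<otimes> u"
      by (auto simp: u_def d_d inv_d_inv_d step_def)
    obtain x es y where g: "g = x \<otimes> steps es \<otimes> y" and xy: "x \<in> {\<one>, d, inv d}" "y \<in> {\<one>, c}"
      using \<open>g \<in> S\<close> unfolding S_def by blast
    have x: "x \<in> carrier Q" using xy by auto
    note [simp] = list_prod_closed[OF map_step_closed]
    consider "y = c" | "y = \<one>" "es = []" | fs f where "y = \<one>" "es = fs @ [f]"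
      using xy by (cases es rule: rev_cases) auto
    then have "g \<otimes> u \<in> S"
    proof cases
      case 1
      then have "g \<otimes> u = x \<otimes> steps (es @ [e]) \<otimes> \<one>"
        using x u by (simp add: g steps_append m_assoc del: map_append)
      then show ?thesis using S_I[of x \<one> "es @ [e]"] xy by simp
    next
      case 2
      have "x \<otimes> u \<in> {\<one>, d, inv d}"
        using xy by (auto simp: u_def d_d inv_d_inv_d)
      moreover have "g \<otimes> u = (x \<otimes> u) \<otimes> steps [] \<otimes> \<one>"
        using 2 x u by (simp add: g)
      ultimately show ?thesis using S_I[of "x \<otimes> u" \<one> "[]"] by simp
    next
      case 3
      show ?thesis
      proof (cases "f = e")
        case True
        have "g \<otimes> u = x \<otimes> steps fs \<otimes> (c \<otimes> (u \<otimes> u))"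
          using 3 True x u by (simp add: g steps_append m_assoc del: map_append)
        also have "c \<otimes> (u \<otimes> u) = step (\<not> e)"
          by (simp add: u step_def)
        also have "x \<otimes> steps fs \<otimes> step (\<not> e) = x \<otimes> steps (fs @ [\<not> e]) \<otimes> \<one>"
          using x by (simp add: steps_append m_assoc del: map_append)
        finally show ?thesis using S_I[of x \<one> "fs @ [\<not> e]"] xy by simp
      next
        case False
        have "g \<otimes> u = x \<otimes> steps fs \<otimes> (step f \<otimes> u)"
          using 3 x u(1) by (simp add: g steps_append m_assoc del: map_append)
        also have "step f \<otimes> u = c"
          using False by (auto simp: u_def step_def m_assoc)
        finally show ?thesis using S_I[of x c fs] xy by simp
      qed
    qed
    then show ?thesis by (simp add: u_def)
  qed
  have "B \<subseteq> S"
  proof (rule generate_subset_rightI)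
    show "S \<subseteq> carrier Q"
      unfolding S_def by (auto intro!: m_closed list_prod_closed)
    show "\<one> \<in> S" using S_I[of \<one> \<one> "[]"] by simp
  qed (use mult_c mult_d[of _ True] mult_d[of _ False] in \<open>auto simp: inv_c\<close>)
  with assms that show ?thesis unfolding S_def by blast
qed

text \<open>
  Up to conjugation an element of \<open>B\<close> is visibly torsion or a nonempty product of steps, which
  will turn out to have infinite order.
\<close>

definition reduced :: "'a \<Rightarrow> bool" where
  "reduced g \<longleftrightarrow> (\<exists>m. conjugate g m \<and> (m \<in> {\<one>, c, d, inv d} \<or> (\<exists>es. es \<noteq> [] \<and> m = steps es)))"

lemma reduced_conjugate: "reduced h \<Longrightarrow> conjugate g h \<Longrightarrow> g \<in> carrier Q \<Longrightarrow> reduced g"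
  unfolding reduced_def using conjugate_trans by blast

text \<open>
  Conjugation by \<open>c\<close> cancels the final \<open>c\<close> against the first letter and exposes a power of \<open>d\<close>,
  which rotates to the end; a final power of \<open>d\<close> merges with the last step or cancels in it, which
  exposes a final \<open>c\<close>. Each kind of word leads to a shorter word of the other kind, so both are
  treated in one induction.
\<close>

lemma reduced_steps_end:
  "reduced (steps es \<otimes> c) \<and> (\<forall>e. reduced (steps es \<otimes> (if e then d else inv d)))"
proof (induction "length es" arbitrary: es)
  case 0
  then show ?case
    unfolding reduced_def using
      conjugate_refl[OF c_closed] conjugate_refl[OF d_closed] conjugate_refl[of "inv d"] by auto
next
  case (Suc n)
  note [simp] = list_prod_closed[OF map_step_closed]
  have "reduced (steps es \<otimes> c)"
  proof -
    obtain e fs where es: "es = e # fs" "length fs = n"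
      using Suc.hyps(2) by (cases es) auto
    define u where "u = (if e then d else inv d)"
    have u: "u \<in> carrier Q" by (simp add: u_def)
    have eq: "steps es \<otimes> c = c \<otimes> (u \<otimes> (steps fs \<otimes> c))" "steps es \<otimes> c \<in> carrier Q"
      using u by (simp_all add: es step_def u_def m_assoc)
    have "conjugate (c \<otimes> (u \<otimes> (steps fs \<otimes> c))) (u \<otimes> (steps fs \<otimes> c) \<otimes> c)"
      using u by (intro conjugate_rotate) auto
    also have "u \<otimes> (steps fs \<otimes> c) \<otimes> c = u \<otimes> steps fs"
      using u by (simp add: m_assoc c_sq)
    finally have "conjugate (steps es \<otimes> c) (u \<otimes> steps fs)" by (simp add: eq)
    moreover have "conjugate (u \<otimes> steps fs) (steps fs \<otimes> u)"
      using u by (intro conjugate_rotate) auto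
    ultimately have "conjugate (steps es \<otimes> c) (steps fs \<otimes> u)"
      using conjugate_trans eq(2) by blast
    then show ?thesis
      using reduced_conjugate Suc.hyps(1)[of fs] es eq(2) unfolding u_def by blast
  qed
  moreover have "reduced (steps es \<otimes> (if e then d else inv d))" for e
  proof -
    obtain f fs where es: "es = fs @ [f]" "length fs = n"
      using Suc.hyps(2) by (cases es rule: rev_cases) auto
    define u where "u = (if e then d else inv d)"
    have u: "u \<in> carrier Q" "u \<otimes> u = (if e then inv d else d)" "step e = c \<otimes> u"
      by (auto simp: u_def d_d inv_d_inv_d step_def)
    have eq: "steps es \<otimes> u = steps fs \<otimes> (step f \<otimes> u)"
      using u by (simp add: es steps_append m_assoc del: map_append)
    show ?thesis
    proof (cases "f = e")
      case True
      then have "steps es \<otimes> u = steps (fs @ [\<not> e])"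
        using u by (simp add: eq steps_append m_assoc step_def del: map_append)
      then show ?thesis
        unfolding u_def reduced_def using conjugate_refl[of "steps (fs @ [\<not> e])"]
        by (metis list_prod_closed map_step_closed snoc_eq_iff_butlast)
    next
      case False
      then have "step f \<otimes> u = c"
        by (auto simp: u_def step_def m_assoc)
      then show ?thesis
        using eq Suc.hyps(1)[of fs] es unfolding u_def by simp
    qed
  qed
  ultimately show ?case by blast
qed

lemma B_reduced:
  assumes "g \<in> B"
  shows "reduced g"
proof -
  note [simp] = list_prod_closed[OF map_step_closed]
  obtain x es y where xy: "x \<in> {\<one>, d, inv d}" "y \<in> {\<one>, c}" and g: "g = x \<otimes> steps es \<otimes> y"
    by (rule B_normal_form[OF assms])
  have cl: "x \<in> carrier Q" "y \<in> carrier Q" using xy by auto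
  have "conjugate g (steps es \<otimes> y \<otimes> x)"
    unfolding g using cl conjugate_rotate[of x "steps es \<otimes> y"] by (simp add: m_assoc)
  moreover have "reduced (steps es \<otimes> y \<otimes> x)"
  proof (cases "x = \<one>")
    case True
    have "reduced (steps es)"
      unfolding reduced_def using conjugate_refl[of "steps es"] by (cases "es = []") auto
    then show ?thesis using True xy reduced_steps_end[of es] by auto
  next
    case False
    then obtain e where x: "x = (if e then d else inv d)"
      using xy by (metis empty_iff insert_iff)
    show ?thesis
    proof (cases "y = c")
      case True
      then have "steps es \<otimes> y \<otimes> x = steps (es @ [e])"
        by (simp add: x steps_append m_assoc step_def del: map_append)
      then show ?thesis
        unfolding reduced_def using conjugate_refl[of "steps (es @ [e])"]
        by (metis list_prod_closed map_step_closed snoc_eq_iff_butlast)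
    next
      case False
      then have "y = \<one>" using xy by auto
      then show ?thesis using reduced_steps_end[of es] unfolding x by simp
    qed
  qed
  ultimately show ?thesis
    using reduced_conjugate B_closed[OF assms] by blast
qed

end

text \<open>
  Nonempty products of the two elementary matrices increase the sum of the coordinates of a
  positive integral vector. The integers are embedded as constant polynomials.
\<close>

definition expanding :: "(vec2 \<Rightarrow> vec2) \<Rightarrow> bool" where
  "expanding f \<longleftrightarrow> (\<forall>x y :: int. 0 < x \<longrightarrow> 0 < y \<longrightarrow> (\<exists>x' y'. 0 < x' \<and> 0 < y' \<and> x + y < x' + y' \<and>
     (f ([:x:], [:y:]) = ([:x':], [:y':]) \<or> f ([:x:], [:y:]) = - ([:x':], [:y':]))))"

lemma expanding_proj_eq:
  assumes "expanding f" "proj_eq g f"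
  shows "expanding g"
  unfolding expanding_def
proof (intro allI impI)
  fix x y :: int assume "0 < x" "0 < y"
  then obtain x' y' where "0 < x'" "0 < y'" "x + y < x' + y'"
    "f ([:x:], [:y:]) = ([:x':], [:y':]) \<or> f ([:x:], [:y:]) = - ([:x':], [:y':])"
    using assms(1) unfolding expanding_def by blast
  moreover have "g ([:x:], [:y:]) = f ([:x:], [:y:]) \<or> g ([:x:], [:y:]) = - f ([:x:], [:y:])"
    using assms(2) unfolding proj_eq_def by metis
  ultimately show "\<exists>x' y'. 0 < x' \<and> 0 < y' \<and> x + y < x' + y' \<and>
     (g ([:x:], [:y:]) = ([:x':], [:y':]) \<or> g ([:x:], [:y:]) = - ([:x':], [:y':]))"
    by (metis minus_minus)
qed

lemma expanding_comp:
  assumes f: "expanding f" and g: "expanding g" and odd: "\<And>v. f (- v) = - f v"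
  shows "expanding (f \<circ> g)"
  unfolding expanding_def
proof (intro allI impI)
  fix x y :: int assume "0 < x" "0 < y"
  then obtain x' y' where 1: "0 < x'" "0 < y'" "x + y < x' + y'"
    "g ([:x:], [:y:]) = ([:x':], [:y':]) \<or> g ([:x:], [:y:]) = - ([:x':], [:y':])"
    using g unfolding expanding_def by blast
  then obtain x'' y'' where 2: "0 < x''" "0 < y''" "x' + y' < x'' + y''"
    "f ([:x':], [:y':]) = ([:x'':], [:y'':]) \<or> f ([:x':], [:y':]) = - ([:x'':], [:y'':])"
    using f unfolding expanding_def by blast
  have "(f \<circ> g) ([:x:], [:y:]) = ([:x'':], [:y'':]) \<or> (f \<circ> g) ([:x:], [:y:]) = - ([:x'':], [:y'':])"
    using 1(4) 2(4) odd unfolding comp_def by (metis minus_minus)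
  moreover have "x + y < x'' + y''" using 1 2 by linarith
  ultimately show "\<exists>x' y'. 0 < x' \<and> 0 < y' \<and> x + y < x' + y' \<and>
     ((f \<circ> g) ([:x:], [:y:]) = ([:x':], [:y':]) \<or> (f \<circ> g) ([:x:], [:y:]) = - ([:x':], [:y':]))"
    using 2 by blast
qed

lemma expanding_not_id:
  assumes "expanding f"
  shows "\<not> proj_eq f id"
proof
  assume "proj_eq f id"
  then have "expanding id"
    using assms expanding_proj_eq proj_eq_sym by blast
  then have "\<exists>x' y' :: int. 0 < x' \<and> 0 < y' \<and> 1 + 1 < x' + y' \<and>
     (([:1:], [:1:]) = ([:x':], [:y':]) \<or> ([:1:], [:1:]) = - ([:x':], [:y':]))"
    unfolding expanding_def id_apply using zero_less_one by blast
  then show False by auto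
qed

context quadrangle_action
begin

lemma act_comp: "proj_eq (act x) f \<Longrightarrow> proj_eq g g' \<Longrightarrow> proj_eq (act x \<circ> g) (f \<circ> g')"
  by (rule proj_eq_comp) (simp_all add: act_odd)

lemma act_step: "proj_eq (act (step e)) (if e then mat2 1 1 0 1 else mat2 (-1) 0 (-1) (-1))"
  using act_mult_mat2[OF c_closed d_closed act_c act_d] act_mult_mat2[OF c_closed _ act_c act_inv_d]
  by (simp add: step_def)

lemma expanding_step: "expanding (act (step e))"
proof (rule expanding_proj_eq[OF _ act_step])
  show "expanding (if e then mat2 1 1 0 1 else mat2 (- 1) 0 (- 1) (- 1))"
    unfolding expanding_def
  proof (intro allI impI)
    fix x y :: int assume xy: "0 < x" "0 < y"
    let ?f = "if e then mat2 1 1 0 1 else mat2 (- 1) 0 (- 1) (- 1)"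
    show "\<exists>x' y'. 0 < x' \<and> 0 < y' \<and> x + y < x' + y' \<and>
      (?f ([:x:], [:y:]) = ([:x':], [:y':]) \<or> ?f ([:x:], [:y:]) = - ([:x':], [:y':]))"
      by (rule exI[of _ "if e then x + y else x"], rule exI[of _ "if e then y else x + y"])
        (use xy in \<open>simp add: mat2_apply\<close>)
  qed
qed

lemma expanding_steps: "es \<noteq> [] \<Longrightarrow> expanding (act (steps es))"
proof (induction es rule: list_nonempty_induct)
  case (single e)
  then show ?case using expanding_step by simp
next
  case (cons e es)
  have "proj_eq (act (steps (e # es))) (act (step e) \<circ> act (steps es))"
    using act_mult[of "step e" "steps es"] list_prod_closed[OF map_step_closed] by simp
  then show ?case
    by (rule expanding_proj_eq[OF expanding_comp[OF expanding_step cons.IH act_odd]])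
qed

lemma steps_pow_neq_one:
  assumes "es \<noteq> []" "n > 0"
  shows "steps es [^] (n :: nat) \<noteq> \<one>"
proof
  assume "steps es [^] n = \<one>"
  moreover have "steps es [^] n = steps (concat (replicate n es))"
    by (simp add: list_prod_pow[OF map_step_closed] map_concat)
  ultimately have "proj_eq (act (steps (concat (replicate n es)))) id"
    using act_one by simp
  moreover have "concat (replicate n es) \<noteq> []"
    using assms by (cases n) auto
  ultimately show False
    using expanding_not_id expanding_steps by blast
qed

lemma act_conjugate_id:
  assumes "conjugate x y" "x \<in> carrier Q" "proj_eq (act x) id"
  shows "proj_eq (act y) id"
proof -
  obtain k where k: "k \<in> carrier Q" "y = k \<otimes> x \<otimes> inv k"
    using assms unfolding conjugate_def by blast
  have "proj_eq (act y) (act (k \<otimes> x) \<circ> act (inv k))"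
    using k assms(2) by (simp add: act_mult)
  also have "proj_eq (act (k \<otimes> x)) (act k \<circ> id)"
    using proj_eq_trans[OF act_mult[OF k(1) assms(2)] act_comp[OF proj_eq_refl assms(3)]] .
  then have "proj_eq (act (k \<otimes> x) \<circ> act (inv k)) (act k \<circ> act (inv k))"
    using act_comp[OF _ proj_eq_refl] by simp
  also have "proj_eq (act k \<circ> act (inv k)) (act (k \<otimes> inv k))"
    using k by (intro proj_eq_sym[OF act_mult]) auto
  also have "proj_eq (act (k \<otimes> inv k)) id"
    using k act_one by simp
  finally show ?thesis .
qed

text \<open>
  It suffices to test the representatives of the conjugacy classes: products of steps expand, and
  \<open>c\<close> and \<open>d\<close> move the point at infinity.
\<close>

lemma B_faithful:
  assumes "g \<in> B" "proj_eq (act g) id"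
  shows "g = \<one>"
proof -
  have g: "g \<in> carrier Q" using assms B_closed by blast
  obtain m where m: "conjugate g m" "m \<in> {\<one>, c, d, inv d} \<or> (\<exists>es. es \<noteq> [] \<and> m = steps es)"
    using B_reduced[OF assms(1)] unfolding reduced_def by blast
  have id: "proj_eq (act m) id"
    using act_conjugate_id m(1) g assms(2) by blast
  have no: False if "proj_eq (act m) (mat2 p q r s)" "r \<noteq> 0" for p q r s
  proof -
    have "proj_eq id (mat2 p q r s)" using that(1) id proj_eq_sym proj_eq_trans by blast
    then show False
      using that(2) by (rule_tac v = "(1, 0)" in proj_eq_cases) (auto simp: mat2_apply)
  qed
  have "m = \<one>"
    using m(2) no[OF _ one_neq_zero] no[of 0 1 "-1"
      "-1"] act_c act_d act_inv_d expanding_not_id[OF expanding_steps] id by auto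
  then have "conjugate \<one> g" using conjugate_sym[OF m(1) g] by simp
  then show ?thesis unfolding conjugate_def by auto
qed

end

section \<open>Matrices of the modular group and its parabolic subgroup\<close>

context quadrangle_action
begin

abbreviation u :: 'a where "u \<equiv> c \<otimes> d"

lemma act_u: "proj_eq (act u) (mat2 1 1 0 1)"
  using act_mult_mat2[OF c_closed d_closed act_c act_d] by simp

lemma act_inv_u: "proj_eq (act (inv u)) (mat2 1 (-1) 0 1)"
proof -
  have "mat2 (-1) 1 0 (-1) v = - mat2 1 (-1) 0 1 v" for v
    by (cases v) (simp add: mat2_apply)
  then have "proj_eq (mat2 (-1) 1 0 (-1)) (mat2 1 (-1) 0 1)"
    by (simp add: proj_eq_def)
  moreover have "proj_eq (act (inv u)) (mat2 (-1) 1 0 (-1))"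
    using act_mult_mat2[OF _ c_closed act_inv_d act_c] by (simp add: inv_mult_group inv_c)
  ultimately show ?thesis using proj_eq_trans by blast
qed

text \<open>
  Applied to \<open>u\<close> with \<open>k = 1\<close> and to \<open>inv u\<close> with \<open>k = - 1\<close>, this covers all integral exponents.
\<close>

lemma act_shear_pow:
  assumes "x \<in> carrier Q" "proj_eq (act x) (mat2 1 [:k:] 0 1)"
  shows "proj_eq (act (x [^] (n::nat))) (mat2 1 [:int n * k:] 0 1)"
proof (induction n)
  case 0
  then show ?case using act_one by (simp add: mat2_one id_def)
next
  case (Suc n)
  have "proj_eq (act (x [^] n \<otimes> x)) (mat2 1 ([:k:] + [:int n * k:]) 0 1)"
    using act_mult_mat2[OF _ assms(1) Suc assms(2)] assms(1) by simp
  moreover have "[:k:] + [:int n * k:] = [:int (Suc n) * k:]"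
    by (simp add: algebra_simps)
  ultimately show ?case by simp
qed

lemma act_u_pow: "proj_eq (act (u [^] (k::int))) (mat2 1 [:k:] 0 1)"
proof (cases k rule: int_cases2)
  case (nonneg n)
  have "proj_eq (act u) (mat2 1 [:1:] 0 1)"
    using act_u by (simp only: one_pCons[symmetric])
  from act_shear_pow[OF _ this, of n] show ?thesis
    by (simp add: nonneg int_pow_int)
next
  case (nonpos n)
  have "proj_eq (act (inv u)) (mat2 1 [:- 1:] 0 1)"
    using act_inv_u by (simp only: minus_pCons one_pCons minus_zero)
  from act_shear_pow[OF _ this, of n] show ?thesis
    by (simp add: nonpos int_pow_neg_int nat_pow_inv)
qed


definition int_matrix :: "'a \<Rightarrow> int \<Rightarrow> int \<Rightarrow> int \<Rightarrow> int \<Rightarrow> bool" where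
  "int_matrix g p q r s \<longleftrightarrow> p * s - q * r = 1 \<and> proj_eq (act g) (mat2 [:p:] [:q:] [:r:] [:s:])"

lemma int_matrix_mult:
  assumes "x \<in> carrier Q" "y \<in> carrier Q" "int_matrix x p q r s" "int_matrix y p' q' r' s'"
  shows "int_matrix (x \<otimes> y) (p * p' + q * r') (p * q' + q * s') (r * p' + s * r') (r * q' + s * s')"
proof -
  have "(p * p' + q * r') * (r * q' + s * s') - (p * q' + q * s') * (r * p' + s * r')
      = (p * s - q * r) * (p' * s' - q' * r')"
    by (simp add: algebra_simps)
  also have "\<dots> = 1" using assms by (simp add: int_matrix_def)
  finally show ?thesis
    using act_mult_mat2[OF assms(1,2), of "[:p:]" "[:q:]"
      "[:r:]" "[:s:]" "[:p':]" "[:q':]" "[:r':]" "[:s':]"] assms(3,4)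
    by (simp add: int_matrix_def mult.commute)
qed

lemma B_matrix:
  assumes "g \<in> B"
  shows "\<exists>p q r s. int_matrix g p q r s"
proof -
  let ?S = "{g \<in> carrier Q. \<exists>p q r s. int_matrix g p q r s}"
  have m: "[:0:] = (0 :: int poly)" "[:1:] = (1 :: int poly)" "[:-1:] = (-1 :: int poly)"
    by (simp_all add: one_pCons)
  have one: "int_matrix \<one> 1 0 0 1" and c: "int_matrix c 0 (-1) 1 0"
    and d: "int_matrix d 0 1 (-1) (-1)" and d': "int_matrix (inv d) (-1) (-1) 1 0"
    unfolding int_matrix_def m using act_one act_c act_d act_inv_d by (simp_all add: mat2_one id_def)
  have mult: "x \<otimes> h \<in> ?S" if "x \<in> ?S" "h \<in> carrier Q" "int_matrix h p q r s" for x h p q r s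
    using that int_matrix_mult[OF _ that(2) _ that(3)] m_closed by blast
  have "B \<subseteq> ?S"
  proof (rule generate_subset_rightI)
    show "\<one> \<in> ?S" using one by auto
    show "x \<otimes> h \<in> ?S" if "x \<in> ?S" "h \<in> {c, d}" for x h
      using that mult[OF that(1) c_closed c] mult[OF that(1) d_closed d] by blast
    show "x \<otimes> inv h \<in> ?S" if "x \<in> ?S" "h \<in> {c, d}" for x h
    proof (cases "h = c")
      case True
      then show ?thesis using mult[OF that(1) c_closed c] by (simp only: inv_c)
    next
      case False
      then have "h = d" using that(2) by blast
      then show ?thesis using mult[OF that(1) inv_closed[OF d_closed] d'] by (simp only:)
    qed
  qed auto
  with assms show ?thesis by blast
qed

text \<open>
  The amalgamated subgroup is the stabiliser of the point at infinity in \<open>B\<close>: a unimodular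
  integral matrix with lower left entry zero is a translation up to sign, and \<open>B\<close> acts faithfully.
\<close>

lemma B_parabolic:
  assumes "g \<in> B" "int_matrix g p q 0 s"
  shows "\<exists>k :: int. g = u [^] k"
proof -
  have g: "g \<in> carrier Q" using assms B_closed by blast
  have ps: "p * s = 1" using assms by (simp add: int_matrix_def)
  then have "p = 1 \<and> s = 1 \<or> p = - 1 \<and> s = - 1"
    by (metis zmult_eq_1_iff)
  then obtain k where "proj_eq (mat2 [:p:] [:q:] [:0:] [:s:]) (mat2 1 [:k:] 0 1)"
  proof
    assume "p = 1 \<and> s = 1"
    then show ?thesis using that[of q] proj_eq_refl by (simp add: one_pCons[symmetric])
  next
    assume *: "p = - 1 \<and> s = - 1"
    have "mat2 [:p:] [:q:] [:0:] [:s:] v = - mat2 1 [:- q:] 0 1 v" for v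
      by (cases v) (simp add: * mat2_apply)
    then show ?thesis using that[of "- q"] by (simp add: proj_eq_def)
  qed
  then have gk: "proj_eq (act g) (mat2 1 [:k:] 0 1)"
    using assms(2) proj_eq_trans unfolding int_matrix_def by blast
  have "proj_eq (act (g \<otimes> u [^] (- k))) id"
    using act_mult_mat2[OF g _ gk act_u_pow[of "- k"]] by (simp add: mat2_one id_def)
  moreover have "u \<in> B"
    using c_in_B d_in_B subgroup.m_closed[OF B_subgroup] by blast
  then have "g \<otimes> u [^] (- k) \<in> B"
    using assms(1) subgroup.m_closed[OF B_subgroup] subgroup_int_pow_closed[OF B_subgroup] by blast
  ultimately have "g \<otimes> u [^] (- k) = \<one>" using B_faithful by blast
  then have "g = u [^] k"
    using g inv_equality[of g "u [^] (- k)"] by (simp add: int_pow_neg)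
  then show ?thesis by blast
qed

end

section \<open>Ping-pong for the quadrangle group\<close>

text \<open>
  As a point of the projective line over the rational functions, a vector is steep if its value is
  infinite or grows at infinity. Elements of \<open>B\<close> that are not translations map such points to
  bounded ones, and \<open>a\<close> maps bounded points back to steep points other than infinity.
\<close>

definition steep :: "vec2 \<Rightarrow> bool" where
  "steep v \<longleftrightarrow> fst v \<noteq> 0 \<and> (snd v = 0 \<or> Polynomial.degree (snd v) < Polynomial.degree (fst v))"

lemma steep_uminus: "steep (- v) \<longleftrightarrow> steep v"
  by (simp add: steep_def)

lemma steep_image_flat:
  fixes p q r s :: int
  assumes "steep v" "r \<noteq> 0" "mat2 [:p:] [:q:] [:r:] [:s:] v = (x, y)"
  shows "y \<noteq> 0 \<and> Polynomial.degree x \<le> Polynomial.degree y"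
proof -
  obtain f g where v: "v = (f, g)" by force
  have f: "f \<noteq> 0" and g: "g = 0 \<or> Polynomial.degree g < Polynomial.degree f"
    using assms(1) by (simp_all add: steep_def v)
  have x: "x = Polynomial.smult p f + Polynomial.smult q g"
    and y: "y = Polynomial.smult r f + Polynomial.smult s g"
    using assms(3) by (simp_all add: v mat2_apply)
  have "poly.coeff g (Polynomial.degree f) = 0"
    using g by (auto intro: coeff_eq_0)
  then have "poly.coeff y (Polynomial.degree f) \<noteq> 0"
    using f assms(2) by (simp add: y)
  then have "y \<noteq> 0" "Polynomial.degree f \<le> Polynomial.degree y"
    by (auto intro: le_degree)
  moreover have "Polynomial.degree x \<le> Polynomial.degree f"
    unfolding x using g by (intro degree_add_le order.trans[OF degree_smult_le]) auto
  ultimately show ?thesis by simp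
qed

lemma flat_image_steep:
  assumes "y \<noteq> 0" "Polynomial.degree x \<le> Polynomial.degree y"
  shows "steep (mat2 (-1) [:0, 1:] 0 1 (x, y))"
proof -
  let ?f = "- x + pCons 0 y"
  have "poly.coeff ?f (Suc (Polynomial.degree y)) \<noteq> 0"
    using assms by (simp add: coeff_eq_0)
  then have "?f \<noteq> 0" "Suc (Polynomial.degree y) \<le> Polynomial.degree ?f"
    by (metis coeff_0, intro le_degree)
  then show ?thesis
    by (simp add: steep_def mat2_apply)
qed

context quadrangle_action
begin

lemma ping_pong:
  assumes "b \<in> B" "b \<notin> range (\<lambda>k::int. u [^] k)" "steep v"
  shows "steep (act (a \<otimes> b) v) \<and> snd (act (a \<otimes> b) v) \<noteq> 0"
proof -
  obtain p q r s where m: "int_matrix b p q r s" using B_matrix[OF assms(1)] by blast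
  have r: "r \<noteq> 0" using B_parabolic[OF assms(1)] m assms(2) by blast
  obtain x y where xy: "mat2 [:p:] [:q:] [:r:] [:s:] v = (x, y)" by force
  have y: "y \<noteq> 0" "Polynomial.degree x \<le> Polynomial.degree y"
    using steep_image_flat[OF assms(3) r xy] by auto
  have "proj_eq (act (a \<otimes> b)) (act a \<circ> act b)"
    using B_closed[OF assms(1)] by (intro act_mult) auto
  also have "proj_eq (act a \<circ> act b) (mat2 (-1) [:0, 1:] 0 1 \<circ> mat2 [:p:] [:q:] [:r:] [:s:])"
    using m by (intro act_comp act_a) (simp add: int_matrix_def)
  finally have "act (a \<otimes> b) v = mat2 (-1) [:0, 1:] 0 1 (x, y) \<or> act (a \<otimes> b) v
      = - mat2 (-1) [:0, 1:] 0 1 (x, y)"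
    unfolding proj_eq_def using xy by (metis comp_apply)
  moreover have "snd (mat2 (-1) [:0, 1:] 0 1 (x, y)) = y"
    by (simp add: mat2_apply)
  ultimately show ?thesis
    using flat_image_steep[OF y] y(1) by (auto simp: steep_uminus)
qed

abbreviation alternating :: "'a list \<Rightarrow> 'a" where
  "alternating bs \<equiv> list_prod (map ((\<otimes>) a) bs)"

lemma alternating_factors_closed: "set bs \<subseteq> B \<Longrightarrow> set (map ((\<otimes>) a) bs) \<subseteq> carrier Q"
  using B_closed by auto

lemma alternating_closed: "set bs \<subseteq> B \<Longrightarrow> alternating bs \<in> carrier Q"
  by (rule list_prod_closed[OF alternating_factors_closed])

lemma alternating_append:
  "set bs \<subseteq> B \<Longrightarrow> set cs \<subseteq> B \<Longrightarrow> alternating (bs @ cs) = alternating bs \<otimes> alternating cs"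
  using list_prod_append[OF alternating_factors_closed alternating_factors_closed] by simp

text \<open>
  Ping-pong: such a product moves the point at infinity.
\<close>

lemma alternating_neq_one:
  assumes "bs \<noteq> []" "set bs \<subseteq> B - range (\<lambda>k::int. u [^] k)"
  shows "alternating bs \<noteq> \<one>"
proof
  assume "alternating bs = \<one>"
  have "\<forall>v. steep v \<longrightarrow> steep (act (alternating bs) v) \<and> snd (act (alternating bs) v) \<noteq> 0"
    using assms
  proof (induction bs rule: list_nonempty_induct)
    case (single b)
    then show ?case using ping_pong B_closed by simp
  next
    case (cons b bs)
    then have cl: "b \<in> B" "set bs \<subseteq> B" by auto
    have "proj_eq (act (alternating (b # bs))) (act (a \<otimes> b) \<circ> act (alternating bs))"
      using act_mult[of "a \<otimes> b" "alternating bs"] alternating_closed[OF cl(2)] B_closed[OF cl(1)] by simp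
    then have
      "act (alternating (b # bs)) v = act (a \<otimes> b) (act (alternating bs) v) \<or> act (alternating (b #
          bs)) v = - act (a \<otimes> b) (act (alternating bs) v)" for v
      unfolding proj_eq_def by (metis comp_apply)
    moreover have "steep (act (a \<otimes> b) (act (alternating bs) v))
        \<and> snd (act (a \<otimes> b) (act (alternating bs) v)) \<noteq> 0"
      if "steep v" for v
      using cons that by (intro ping_pong) (auto simp del: split_paired_All)
    moreover have "steep w \<and> snd w \<noteq> 0" if "w = w' \<or> w = - w'" "steep w' \<and> snd w' \<noteq> 0" for w w'
      using that by (auto simp: steep_uminus simp del: split_paired_All)
    ultimately show ?case by blast
  qed
  moreover have "steep (1, 0)" by (simp add: steep_def)
  ultimately have "snd (act \<one> (1, 0)) \<noteq> 0"
    using \<open>alternating bs = \<one>\<close> by metis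
  moreover have "act \<one> (1, 0) = (1, 0) \<or> act \<one> (1, 0) = - (1, 0)"
    using act_one unfolding proj_eq_def id_apply by blast
  ultimately show False by auto
qed

text \<open>
  Consecutive elements of \<open>B\<close> merge, and an element of \<open>B\<close> equal to one may separate two
  occurrences of \<open>a\<close>.
\<close>

lemma amalgam_form:
  assumes "g \<in> carrier Q"
  obtains b bs where "b \<in> B" "set bs \<subseteq> B" "g = b \<otimes> alternating bs"
proof -
  let ?S = "{b \<otimes> alternating bs | b bs. b \<in> B \<and> set bs \<subseteq> B}"
  have mult_a: "x \<otimes> a \<in> ?S" if xS: "x \<in> ?S" for x
  proof -
    obtain b bs where x: "x = b \<otimes> alternating bs" "b \<in> B" "set bs \<subseteq> B" using xS by blast
    have one: "\<one> \<in> B" by (rule generate.one)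
    have "alternating (bs @ [\<one>]) = alternating bs \<otimes> a"
      using alternating_append[OF x(3), of "[\<one>]"] one by simp
    then have "x \<otimes> a = b \<otimes> alternating (bs @ [\<one>])"
      using x alternating_closed[OF x(3)] B_closed by (simp add: m_assoc del: map_append)
    moreover have "set (bs @ [\<one>]) \<subseteq> B" using x one by auto
    ultimately show ?thesis using x by blast
  qed
  have mult_B: "x \<otimes> h \<in> ?S" if xS: "x \<in> ?S" and hB: "h \<in> B" for x h
  proof -
    obtain b bs where x: "x = b \<otimes> alternating bs" "b \<in> B" "set bs \<subseteq> B" using xS by blast
    show ?thesis
    proof (cases bs rule: rev_cases)
      case Nil
      then have "x \<otimes> h = (b \<otimes> h) \<otimes> alternating []"
        using x hB B_closed by simp
      moreover have "b \<otimes> h \<in> B" using x hB subgroup.m_closed[OF B_subgroup] by blast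
      moreover have "set [] \<subseteq> B" by simp
      ultimately show ?thesis by blast
    next
      case (snoc cs e)
      then have cl: "set cs \<subseteq> B" "e \<in> B" "e \<otimes> h \<in> B"
        using x hB subgroup.m_closed[OF B_subgroup] by auto
      have "x \<otimes> h = b \<otimes> alternating (cs @ [e \<otimes> h])"
        using x(1,2) hB cl alternating_closed[OF cl(1)]
          B_closed alternating_append[OF cl(1), of "[e]"] alternating_append[OF cl(1), of "[e \<otimes> h]"]
        by (simp add: snoc m_assoc del: map_append)
      moreover have "set (cs @ [e \<otimes> h]) \<subseteq> B" using cl by auto
      ultimately show ?thesis using x by blast
    qed
  qed
  have "generate Q {a, c, d} \<subseteq> ?S"
  proof (rule generate_subset_rightI)
    show "?S \<subseteq> carrier Q" using B_closed alternating_closed by auto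
    show "\<one> \<in> ?S" using generate.one[of Q "{c, d}"]
      by (auto intro!: exI[of _ \<one>] exI[of _ "[]"])
    fix x h assume x: "x \<in> ?S" and "h \<in> {a, c, d}"
    then consider "h = a" | "h \<in> B" using c_in_B d_in_B by blast
    note h = this
    from h show "x \<otimes> h \<in> ?S" using mult_a[OF x] mult_B[OF x] by cases simp_all
    from h show "x \<otimes> inv h \<in> ?S"
    proof cases
      case 1
      then show ?thesis using mult_a[OF x] inv_a by simp
    next
      case 2
      then show ?thesis using mult_B[OF x] subgroup.m_inv_closed[OF B_subgroup] by blast
    qed
  qed simp
  then have "g \<in> ?S" using assms gen by blast
  with that show ?thesis by blast
qed

end

section \<open>Torsion in the quadrangle group\<close>

context quadrangle_action
begin

lemma a_u_pow: "a \<otimes> (u [^] (k::int) \<otimes> a) = u [^] (- k)"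
proof -
  have conj: "a \<otimes> (x [^] (n::nat) \<otimes> a) = (a \<otimes> (x \<otimes> a)) [^] n" if "x \<in> carrier Q" for x n
    using that
  proof (induction n)
    case (Suc n)
    have "(a \<otimes> (x \<otimes> a)) [^] Suc n = a \<otimes> (x [^] n \<otimes> a) \<otimes> (a \<otimes> (x \<otimes> a))"
      using Suc by simp
    then show ?case using Suc.prems by (simp add: m_assoc)
  qed (simp add: a_sq)
  have u: "a \<otimes> (u \<otimes> a) = inv u"
    using a_inverts by (simp add: m_assoc)
  have "a \<otimes> (inv u \<otimes> a) = u"
  proof -
    have "inv (a \<otimes> (u \<otimes> a)) = u" by (simp add: u)
    then show ?thesis by (simp add: inv_mult_group inv_a m_assoc)
  qed
  then show ?thesis
  proof (cases k rule: int_cases2)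
    case (nonneg n)
    have "a \<otimes> (u [^] n \<otimes> a) = inv (u [^] n)"
      using conj[of u n] by (simp add: u nat_pow_inv)
    then show ?thesis by (simp add: nonneg int_pow_int int_pow_neg_int)
  next
    case (nonpos n)
    have "a \<otimes> (inv u [^] n \<otimes> a) = u [^] n"
      using conj[of "inv u" n] \<open>a \<otimes> (inv u \<otimes> a) = u\<close> by simp
    then show ?thesis by (simp add: nonpos int_pow_int int_pow_neg_int nat_pow_inv)
  qed
qed

text \<open>
  These are the conjugates of powers of the four generators, since \<open>a \<otimes> inv u\<close> is \<open>x\<^sub>2\<close>.
\<close>

definition elliptic :: "'a \<Rightarrow> bool" where
  "elliptic g \<longleftrightarrow> (\<exists>m\<in>{\<one>, a, a \<otimes> inv u, c, d, inv d}. conjugate g m)"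

lemma elliptic_conjugate: "elliptic h \<Longrightarrow> conjugate g h \<Longrightarrow> g \<in> carrier Q \<Longrightarrow> elliptic g"
  unfolding elliptic_def using conjugate_trans by blast

text \<open>
  The reflections \<open>a u\<^sup>k\<close> of the infinite dihedral group form two conjugacy classes, according to
  the parity of \<open>k\<close>, since conjugation by \<open>u\<^sup>j\<close> changes \<open>k\<close> by \<open>2 j\<close>.
\<close>

lemma reflection_elliptic: "elliptic (a \<otimes> u [^] (k::int))"
proof -
  have shift: "conjugate (a \<otimes> x \<otimes> u [^] (2 * j)) (a \<otimes> x)"
    if "x \<in> carrier Q" "x \<otimes> u [^] j = u [^] j \<otimes> x" for x and j :: int
  proof -
    have "conjugate (a \<otimes> x \<otimes> u [^] j \<otimes> u [^] j) (u [^] j \<otimes> (a \<otimes> x \<otimes> u [^] j))"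
      using that(1) by (intro conjugate_rotate) auto
    moreover have "a \<otimes> x \<otimes> u [^] j \<otimes> u [^] j = a \<otimes> x \<otimes> u [^] (2 * j)"
      using that(1) by (simp add: m_assoc int_pow_mult[symmetric])
    moreover have "u [^] j \<otimes> (a \<otimes> x \<otimes> u [^] j) = a \<otimes> x"
    proof -
      have *: "u [^] j = a \<otimes> (u [^] (- j) \<otimes> a)" by (simp add: a_u_pow)
      have "u [^] j \<otimes> (a \<otimes> x \<otimes> u [^] j) = u [^] j \<otimes> (a \<otimes> (u [^] j \<otimes> x))"
        using that by (simp add: m_assoc)
      also have "\<dots> = a \<otimes> (u [^] (- j) \<otimes> a) \<otimes> (a \<otimes> (u [^] j \<otimes> x))"
        by (subst (1) *) simp
      also have "\<dots> = a \<otimes> (u [^] (- j) \<otimes> (u [^] j \<otimes> x))"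
        using that(1) by (simp add: m_assoc)
      also have "\<dots> = a \<otimes> x"
        using that(1) by (simp add: int_pow_neg)
      finally show ?thesis .
    qed
    ultimately show ?thesis by simp
  qed
  show ?thesis
  proof (cases "even k")
    case True
    then obtain j where "k = 2 * j" by blast
    then have "conjugate (a \<otimes> u [^] k) a"
      using shift[of \<one> j] by simp
    then show ?thesis unfolding elliptic_def by blast
  next
    case False
    then obtain j where k: "k = - 1 + 2 * j"
      by (metis add.commute diff_add_cancel dvd_def even_add odd_one add_uminus_conv_diff)
    have "inv u = u [^] (- 1 :: int)" by (simp add: int_pow_neg)
    then have "inv u \<otimes> u [^] j = u [^] j \<otimes> inv u"
      by (simp add: int_pow_mult[symmetric] add.commute)
    moreover have "u [^] k = inv u \<otimes> u [^] (2 * j)"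
      unfolding k \<open>inv u = u [^] (- 1 :: int)\<close> by (rule int_pow_mult) simp
    ultimately have "conjugate (a \<otimes> u [^] k) (a \<otimes> inv u)"
      using shift[of "inv u" j] by (simp add: m_assoc)
    then show ?thesis unfolding elliptic_def by blast
  qed
qed

lemma B_torsion_elliptic:
  assumes "g \<in> B" "g [^] (n::nat) = \<one>" "n > 0"
  shows "elliptic g"
proof -
  have g: "g \<in> carrier Q" using assms B_closed by blast
  obtain m where m: "conjugate g m" "m \<in> {\<one>, c, d, inv d} \<or> (\<exists>es. es \<noteq> [] \<and> m = steps es)"
    using B_reduced[OF assms(1)] unfolding reduced_def by blast
  have "m [^] n = \<one>" using conjugate_pow_eq_one[OF m(1) g assms(2)] .
  then show ?thesis
    using m steps_pow_neq_one assms(3) unfolding elliptic_def by blast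
qed

text \<open>
  By ping-pong some factor of a torsion element is a power \<open>u\<^sup>k\<close>. After rotating it to the front,
  \<open>a u\<^sup>k a = u\<^sup>-\<^sup>k\<close> merges it with both neighbours and removes two factors. This ends in the
  dihedral group or in \<open>B\<close>.
\<close>

lemma alternating_torsion_elliptic:
  assumes "set bs \<subseteq> B" "bs \<noteq> []" "alternating bs [^] (n::nat) = \<one>" "n > 0"
  shows "elliptic (alternating bs)"
  using assms(1-3)
proof (induction "length bs" arbitrary: bs rule: less_induct)
  case less
  note bs = less.prems
  have "\<not> set bs \<subseteq> B - range (\<lambda>k::int. u [^] k)"
  proof
    assume *: "set bs \<subseteq> B - range (\<lambda>k::int. u [^] k)"
    have "alternating bs [^] n = alternating (concat (replicate n bs))"
      by (simp add: list_prod_pow[OF alternating_factors_closed[OF bs(1)]] map_concat)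
    moreover have "alternating (concat (replicate n bs)) \<noteq> \<one>"
      using * bs(2) assms(4) by (intro alternating_neq_one) (cases n, auto)
    ultimately show False using bs(3) by simp
  qed
  then obtain k :: int where "u [^] k \<in> set bs" using bs(1) by blast
  then obtain xs ys where xy: "bs = xs @ u [^] k # ys" by (meson split_list)
  define r where "r = ys @ xs"
  have r: "set r \<subseteq> B" "length r < length bs" "u [^] k \<in> B" "set xs \<subseteq> B" "set ys \<subseteq> B"
    using bs(1) by (auto simp: r_def xy)
  have g: "alternating bs \<in> carrier Q" using alternating_closed bs(1) .
  have uk: "u [^] k \<in> carrier Q" "u [^] (- k) \<in> carrier Q" "u [^] (- k) \<in> B"
    using r(3) B_subgroup by (auto simp: int_pow_neg subgroup.m_inv_closed)
  have conj: "conjugate (alternating bs) (a \<otimes> u [^] k \<otimes> alternating r)"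
  proof -
    have "conjugate (alternating bs) (alternating ((u [^] k # ys) @ xs))"
      using list_prod_rotate[OF alternating_factors_closed
        alternating_factors_closed, of xs "u [^] k # ys"] r by (simp add: xy)
    then show ?thesis by (simp add: r_def)
  qed
  consider "r = []" | e where "r = [e]" | e f fs where "r = e # fs @ [f]"
    by (metis append_Cons append_Nil list.exhaust rev_exhaust)
  then show ?case
  proof cases
    case 1
    then have "conjugate (alternating bs) (a \<otimes> u [^] k)" using conj uk by simp
    then show ?thesis using elliptic_conjugate reflection_elliptic g by blast
  next
    case 2
    have e: "e \<in> B" "e \<in> carrier Q" using r(1) 2 B_closed by auto
    have "a \<otimes> u [^] k \<otimes> alternating r = a \<otimes> (u [^] k \<otimes> a) \<otimes> e"
      using 2 e uk by (simp add: m_assoc)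
    then have *: "conjugate (alternating bs) (u [^] (- k) \<otimes> e)"
      using conj by (simp add: a_u_pow)
    have "u [^] (- k) \<otimes> e \<in> B" using uk e subgroup.m_closed[OF B_subgroup] by blast
    then have "elliptic (u [^] (- k) \<otimes> e)"
      using B_torsion_elliptic conjugate_pow_eq_one[OF * g bs(3)] assms(4) by blast
    then show ?thesis using elliptic_conjugate * g by blast
  next
    case 3
    have cl: "e \<in> B" "f \<in> B" "set fs \<subseteq> B" "e \<in> carrier Q" "f \<in> carrier Q" "alternating fs \<in> carrier Q"
      using r(1) 3 B_closed alternating_closed by auto
    have af: "alternating (fs @ [x]) = alternating fs \<otimes> (a \<otimes> x)" if "x \<in> B" for x
      using alternating_append[OF cl(3), of "[x]"] that B_closed by simp
    have "a \<otimes> u [^] k \<otimes> alternating r = a \<otimes> (u [^] k \<otimes> a) \<otimes> (e \<otimes> alternating (fs @ [f]))"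
      using 3 cl uk by (simp add: af m_assoc del: map_append)
    also have "\<dots> = (u [^] (- k) \<otimes> e) \<otimes> alternating (fs @ [f])"
      using cl uk by (simp add: a_u_pow m_assoc af del: map_append)
    finally have "conjugate (alternating bs) ((u [^] (- k) \<otimes> e) \<otimes> alternating (fs @ [f]))"
      using conj by simp
    moreover have
      "conjugate ((u [^] (- k) \<otimes> e) \<otimes> alternating (fs @ [f])) (alternating (fs @ [f]) \<otimes> (u [^] (- k) \<otimes> e))"
      using cl uk by (intro conjugate_rotate) (auto simp: af simp del: map_append)
    moreover define h where "h = f \<otimes> (u [^] (- k) \<otimes> e)"
    moreover have h: "h \<in> B" unfolding h_def using uk cl subgroup.m_closed[OF B_subgroup] by blast
    moreover have "alternating (fs @ [f]) \<otimes> (u [^] (- k) \<otimes> e) = alternating (fs @ [h])"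
      using cl uk h by (simp add: af m_assoc h_def del: map_append)
    ultimately have *: "conjugate (alternating bs) (alternating (fs @ [h]))"
      using conjugate_trans g by metis
    have "elliptic (alternating (fs @ [h]))"
    proof (rule less.hyps)
      show "length (fs @ [h]) < length bs" using r(2) 3 by simp
      show "set (fs @ [h]) \<subseteq> B" using cl h by simp
      show "alternating (fs @ [h]) [^] n = \<one>" by (rule conjugate_pow_eq_one[OF * g bs(3)])
    qed simp
    then show ?thesis using elliptic_conjugate * g by blast
  qed
qed

theorem torsion_elliptic:
  assumes "g \<in> carrier Q" "g [^] (n::nat) = \<one>" "n > 0"
  shows "elliptic g"
proof -
  obtain b bs where g: "b \<in> B" "set bs \<subseteq> B" "g = b \<otimes> alternating bs"
    using amalgam_form[OF assms(1)] .
  show ?thesis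
  proof (cases bs rule: rev_cases)
    case Nil
    then show ?thesis using g B_torsion_elliptic B_closed assms by simp
  next
    case (snoc cs e)
    have cl: "e \<in> B" "set cs \<subseteq> B" "e \<in> carrier Q" "b \<in> carrier Q" "e \<otimes> b \<in> B" "alternating cs \<in> carrier Q"
      using snoc g B_closed alternating_closed subgroup.m_closed[OF B_subgroup] by auto
    have "conjugate g (alternating bs \<otimes> b)"
      unfolding g using g(2) cl alternating_closed by (intro conjugate_rotate) auto
    moreover have "alternating bs \<otimes> b = alternating (cs @ [e \<otimes> b])"
      using alternating_append[OF cl(2), of "[e]"] alternating_append[OF cl(2), of "[e \<otimes> b]"] cl
      by (simp add: snoc m_assoc del: map_append)
    ultimately have *: "conjugate g (alternating (cs @ [e \<otimes> b]))" by simp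
    have "elliptic (alternating (cs @ [e \<otimes> b]))"
      using cl conjugate_pow_eq_one[OF * assms(1,2)] assms(3) by (intro alternating_torsion_elliptic) auto
    then show ?thesis using elliptic_conjugate * assms(1) by blast
  qed
qed

end

section \<open>Torsionfree kernels of the quadrangle group\<close>

text \<open>
  The matrix of \<open>x\<^sub>2\<close> is that of \<open>x\<^sub>1 u\<^sup>-\<^sup>1\<close>. Involutions equal their inverses up to sign, so only
  \<open>x\<^sub>4\<close> needs separate letters.
\<close>

fun letter_act :: "quad_gen \<times> bool \<Rightarrow> vec2 \<Rightarrow> vec2" where
  "letter_act (QX1, _) = mat2 (-1) [:0, 1:] 0 1"
| "letter_act (QX2, _) = mat2 (-1) [:1, 1:] 0 1"
| "letter_act (QX3, _) = mat2 0 (-1) 1 0"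
| "letter_act (QX4, True) = mat2 0 1 (-1) (-1)"
| "letter_act (QX4, False) = mat2 (-1) (-1) 1 0"

definition word_act :: "quad_gen word \<Rightarrow> vec2 \<Rightarrow> vec2" where
  "word_act w = foldr (\<lambda>l f. letter_act l \<circ> f) w id"

lemma word_act_simps: "word_act [] = id" "word_act (l # w) = letter_act l \<circ> word_act w"
  by (simp_all add: word_act_def)

lemma word_act_append: "word_act (u @ v) = word_act u \<circ> word_act v"
  by (induction u) (simp_all add: word_act_simps comp_assoc)

lemma letter_act_odd: "letter_act l (- v) = - letter_act l v"
  by (cases l rule: letter_act.cases) (simp_all only: letter_act.simps mat2_odd)

lemma word_act_odd: "word_act w (- v) = - word_act w v"
  by (induction w) (simp_all add: word_act_simps letter_act_odd del: split_paired_All)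

definition quad_relators :: "quad_gen word set" where
  "quad_relators = {gen QX1 @ gen QX1, gen QX2 @ gen QX2, gen QX3 @ gen QX3,
      gen QX4 @ gen QX4 @ gen QX4, gen QX1 @ gen QX2 @ gen QX3 @ gen QX4}"

lemma proj_eq_mat2_id: "proj_eq (mat2 1 0 0 1) id" "proj_eq (mat2 (-1) 0 0 (-1)) id"
  by (auto simp: proj_eq_def mat2_apply)

lemma word_act_respects:
  assumes "word_eq quad_relators u v"
  shows "proj_eq (word_act u) (word_act v)"
  using assms
proof (induction rule: word_eq.induct)
  case (refl u)
  show ?case by (rule proj_eq_refl)
next
  case (sym u v)
  then show ?case by (rule_tac proj_eq_sym)
next
  case (trans u v w)
  then show ?case by (rule_tac proj_eq_trans)
next
  case (cancel u g b v)
  have "proj_eq (letter_act (g, b) \<circ> letter_act (g, \<not> b)) id"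
    using proj_eq_mat2_id by (cases g; cases b) (simp_all add: mat2_comp)
  then have "proj_eq (word_act [(g, b), (g, \<not> b)]) id"
    by (simp add: word_act_simps)
  then have "proj_eq (word_act u \<circ> (word_act [(g, b), (g, \<not> b)] \<circ> word_act v)) (word_act u \<circ> (id
      \<circ> word_act v))"
    by (intro proj_eq_comp proj_eq_refl word_act_odd)
  then show ?case unfolding word_act_append id_comp .
next
  case (relator r u v)
  moreover have "1 - [:1, 1:] + [:0, 1:] = (0 :: int poly)"
    by (simp add: one_pCons)
  ultimately have "proj_eq (word_act r) id"
    using proj_eq_mat2_id by (auto simp: quad_relators_def word_act_simps mat2_comp)
  then have "proj_eq (word_act u \<circ> (word_act r \<circ> word_act v)) (word_act u \<circ> (id \<circ> word_act v))"
    by (intro proj_eq_comp proj_eq_refl word_act_odd)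
  then show ?case unfolding word_act_append id_comp .
qed

text \<open>
  Words with the same class act equally up to sign only, so a representative has to be chosen.
\<close>

definition class_act :: "quad_gen word set \<Rightarrow> vec2 \<Rightarrow> vec2" where
  "class_act A = word_act (SOME w. w \<in> A)"

lemma class_act: "proj_eq (class_act (word_class quad_relators w)) (word_act w)"
proof -
  have "w \<in> word_class quad_relators w" by (simp add: word_rel_def word_eq.refl)
  then have "(SOME v. v \<in> word_class quad_relators w) \<in> word_class quad_relators w" by (rule someI)
  then have "word_eq quad_relators w (SOME v. v \<in> word_class quad_relators w)" by (simp add: word_rel_def)
  from word_act_respects[OF this] show ?thesis
    unfolding class_act_def by (rule proj_eq_sym)
qed

abbreviation quad_class :: "quad_gen word \<Rightarrow> quad_gen word set" where
  "quad_class \<equiv> word_class quad_relators"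

interpretation quad: group "presented_group quad_relators"
  by (rule group_presented_group)

lemma quad_relator: "r \<in> quad_relators \<Longrightarrow> quad_class r = \<one>\<^bsub>presented_group quad_relators\<^esub>"
  using word_eq.relator[of r quad_relators "[]" "[]"]
  by (simp only: one_presented_group word_rel_class_eq_iff append_Nil append_Nil2)

lemma quad_relations:
  "quad_class (gen QX1 @ gen QX1) = \<one>\<^bsub>presented_group quad_relators\<^esub>"
  "quad_class (gen QX2 @ gen QX2) = \<one>\<^bsub>presented_group quad_relators\<^esub>"
  "quad_class (gen QX3 @ gen QX3) = \<one>\<^bsub>presented_group quad_relators\<^esub>"
  "quad_class (gen QX4 @ gen QX4 @ gen QX4) = \<one>\<^bsub>presented_group quad_relators\<^esub>"
  "quad_class (gen QX1 @ gen QX2 @ gen QX3 @ gen QX4) = \<one>\<^bsub>presented_group quad_relators\<^esub>"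
  by (rule quad_relator, simp add: quad_relators_def)+

lemma quad_b_eq:
  "quad_class (gen QX2) = quad_class (gen QX1) \<otimes>\<^bsub>presented_group quad_relators\<^esub>
     inv\<^bsub>presented_group
       quad_relators\<^esub> (quad_class (gen QX3) \<otimes>\<^bsub>presented_group quad_relators\<^esub> quad_class (gen QX4))"
proof -
  let ?Q = "presented_group quad_relators"
  let ?a = "quad_class (gen QX1)" and ?b = "quad_class (gen QX2)"
  let ?u = "quad_class (gen QX3) \<otimes>\<^bsub>?Q\<^esub> quad_class (gen QX4)"
  have cl: "quad_class w \<in> carrier ?Q" for w by (rule word_class_closed)
  have "(?a \<otimes>\<^bsub>?Q\<^esub> ?b) \<otimes>\<^bsub>?Q\<^esub> ?u = \<one>\<^bsub>?Q\<^esub>"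
    using quad_relations by (simp add: presented_group_mult)
  then have "inv\<^bsub>?Q\<^esub> ?u = ?a \<otimes>\<^bsub>?Q\<^esub> ?b"
    using cl by (intro quad.inv_equality) auto
  moreover have "?a \<otimes>\<^bsub>?Q\<^esub> ?a = \<one>\<^bsub>?Q\<^esub>"
    using quad_relations by (simp add: presented_group_mult)
  ultimately show ?thesis
    using cl by (simp add: quad.m_assoc[symmetric])
qed

lemma quadrangle_action_quad:
  "quadrangle_action (presented_group quad_relators) (quad_class (gen QX1)) (quad_class (gen QX3))
      (quad_class (gen QX4)) class_act"
proof
  let ?Q = "presented_group quad_relators"
  let ?a = "quad_class (gen QX1)" and ?b = "quad_class (gen QX2)"
  let ?c = "quad_class (gen QX3)" and ?d = "quad_class (gen QX4)"
  have cl: "quad_class w \<in> carrier ?Q" for w by (rule word_class_closed)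
  show "?a \<in> carrier ?Q" "?c \<in> carrier ?Q" "?d \<in> carrier ?Q" by (rule cl)+
  show aa: "?a \<otimes>\<^bsub>?Q\<^esub> ?a = \<one>\<^bsub>?Q\<^esub>" and cc: "?c \<otimes>\<^bsub>?Q\<^esub> ?c = \<one>\<^bsub>?Q\<^esub>" and ddd: "?d \<otimes>\<^bsub>?Q\<^esub> (?d \<otimes>\<^bsub>?Q\<^esub> ?d) = \<one>\<^bsub>?Q\<^esub>"
    using quad_relations by (simp_all add: presented_group_mult)
  let ?u = "?c \<otimes>\<^bsub>?Q\<^esub> ?d"
  have bb: "?b \<otimes>\<^bsub>?Q\<^esub> ?b = \<one>\<^bsub>?Q\<^esub>"
    using quad_relations by (simp add: presented_group_mult)
  have ia: "inv\<^bsub>?Q\<^esub> ?a = ?a" and ib: "inv\<^bsub>?Q\<^esub> ?b = ?b"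
    by (rule quad.inv_equality[OF aa cl cl], rule quad.inv_equality[OF bb cl cl])
  have "inv\<^bsub>?Q\<^esub> ?b = ?u \<otimes>\<^bsub>?Q\<^esub> ?a"
    using cl by (simp add: quad_b_eq quad.inv_mult_group ia)
  then have "?u \<otimes>\<^bsub>?Q\<^esub> ?a = ?a \<otimes>\<^bsub>?Q\<^esub> inv\<^bsub>?Q\<^esub> ?u"
    using ib quad_b_eq by simp
  then have "?a \<otimes>\<^bsub>?Q\<^esub> (?u \<otimes>\<^bsub>?Q\<^esub> ?a) = ?a \<otimes>\<^bsub>?Q\<^esub> (?a \<otimes>\<^bsub>?Q\<^esub> inv\<^bsub>?Q\<^esub> ?u)" by simp
  then show "?a \<otimes>\<^bsub>?Q\<^esub> ?u \<otimes>\<^bsub>?Q\<^esub> ?a = inv\<^bsub>?Q\<^esub> ?u"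
    using cl aa by (simp add: quad.m_assoc[symmetric])
  show "carrier ?Q = generate ?Q {?a, ?c, ?d}"
  proof
    have "id \<in> epi ?Q ?Q" by (simp add: epi_def hom_def)
    then have "carrier ?Q = generate ?Q (range (\<lambda>g. quad_class (gen g)))"
      using epi_presented_group_generate[OF group_presented_group, of id quad_relators] by simp
    also have "\<dots> \<subseteq> generate ?Q {?a, ?c, ?d}"
    proof (rule quad.generate_subgroup_incl)
      show s: "subgroup (generate ?Q {?a, ?c, ?d}) ?Q"
        using cl by (intro quad.generate_is_subgroup) auto
      have acd: "?a \<in> generate ?Q {?a, ?c, ?d}" "?c \<in> generate ?Q {?a, ?c, ?d}"
        "?d \<in> generate ?Q {?a, ?c, ?d}"
        by (auto intro: generate.incl)
      then have "?b \<in> generate ?Q {?a, ?c, ?d}"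
        unfolding quad_b_eq using s by (intro subgroup.m_closed subgroup.m_inv_closed)
      then have "quad_class (gen g) \<in> generate ?Q {?a, ?c, ?d}" for g
        using acd by (cases g) auto
      then show "range (\<lambda>g. quad_class (gen g)) \<subseteq> generate ?Q {?a, ?c, ?d}" by blast
    qed
    finally show "carrier ?Q \<subseteq> generate ?Q {?a, ?c, ?d}" .
    show "generate ?Q {?a, ?c, ?d} \<subseteq> carrier ?Q"
      using cl by (intro quad.generate_incl) auto
  qed
  show "proj_eq (class_act \<one>\<^bsub>?Q\<^esub>) id"
    using class_act[of "[]"] by (simp add: one_presented_group word_act_simps)
  show "proj_eq (class_act (x \<otimes>\<^bsub>?Q\<^esub> y)) (class_act x \<circ> class_act y)"
    if x: "x \<in> carrier ?Q" and y: "y \<in> carrier ?Q" for x y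
  proof -
    obtain v w where xy: "x = quad_class v" "y = quad_class w"
      using x y unfolding carrier_presented_group by blast
    have "proj_eq (class_act (x \<otimes>\<^bsub>?Q\<^esub> y)) (word_act v \<circ> word_act w)"
      using class_act[of "v @ w"] by (simp add: xy presented_group_mult word_act_append)
    also have "proj_eq \<dots> (class_act x \<circ> class_act y)"
      unfolding xy by (intro proj_eq_comp proj_eq_sym[OF class_act] word_act_odd)
    finally show ?thesis .
  qed
  show "class_act x (- v) = - class_act x v" for x v
    unfolding class_act_def by (rule word_act_odd)
  show "proj_eq (class_act ?a) (mat2 (-1) [:0, 1:] 0 1)" "proj_eq (class_act ?c) (mat2 0 (-1) 1 0)"
    "proj_eq (class_act ?d) (mat2 0 1 (-1) (-1))"
    using class_act[of "gen QX1"] class_act[of "gen QX3"] class_act[of "gen QX4"]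
      by (simp_all add: word_act_simps)
qed

text \<open>
  A torsion element of the quadrangle group is conjugate to a power of a generator, and a
  homomorphism that kills a nontrivial power of a generator of prime order kills the generator.
\<close>

theorem quadrangle_kernel_torsionfree:
  assumes "group G" and h: "h \<in> hom (presented_group quad_relators) G"
    and nontriv: "\<And>g. h (quad_class (gen g)) \<noteq> \<one>\<^bsub>G\<^esub>"
  shows "torsionfree_subset (presented_group quad_relators) (kernel (presented_group quad_relators) G h)"
  unfolding torsionfree_subset_def
proof (intro ballI allI impI)
  let ?Q = "presented_group quad_relators"
  interpret quadrangle_action ?Q "quad_class (gen QX1)"
    "quad_class (gen QX3)" "quad_class (gen QX4)" class_act
    by (rule quadrangle_action_quad)
  interpret G: group G by fact
  interpret h: group_hom ?Q G h using h by unfold_locales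
  fix x n assume x: "x \<in> kernel ?Q G h" and n: "(n::nat) > 0" "x [^]\<^bsub>?Q\<^esub> n = \<one>\<^bsub>?Q\<^esub>"
  have xc: "x \<in> carrier ?Q" and hx: "h x = \<one>\<^bsub>G\<^esub>" using x by (auto simp: kernel_def)
  have cl: "quad_class w \<in> carrier ?Q" for w by (rule word_class_closed)
  obtain m where m:
    "m \<in> {\<one>\<^bsub>?Q\<^esub>, quad_class (gen QX1), quad_class (gen QX2), quad_class (gen QX3), quad_class (gen
        QX4), inv\<^bsub>?Q\<^esub> quad_class (gen QX4)}"
    and conj: "quad.conjugate x m"
    using torsion_elliptic[OF xc n(2,1)] unfolding elliptic_def quad_b_eq by blast
  have "h m = \<one>\<^bsub>G\<^esub>"
    using conj xc hx unfolding quad.conjugate_def by auto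
  moreover have "h (inv\<^bsub>?Q\<^esub> quad_class (gen QX4)) \<noteq> \<one>\<^bsub>G\<^esub>"
    using nontriv[of QX4] h.hom_inv[OF cl[of "gen QX4"]] h.hom_closed[OF cl[of "gen QX4"]]
      by (metis G.inv_eq_1_iff)
  ultimately have "m = \<one>\<^bsub>?Q\<^esub>"
    using m nontriv by auto
  then have "quad.conjugate \<one>\<^bsub>?Q\<^esub> x"
    using quad.conjugate_sym[OF conj xc] by simp
  then show "x = \<one>\<^bsub>?Q\<^esub>"
    unfolding quad.conjugate_def by auto
qed

section \<open>Generators of the special linear group over the field with seven elements\<close>

lemma UNIV_7: "(UNIV :: 7 set) = {0, 1, 2, 3, 4, 5, 6}"
proof -
  have "x \<in> {0, 1, 2, 3, 4, 5, 6}" for x :: 7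
  proof (cases x rule: bit1_cases)
    case (of_int z)
    then have "z \<in> {0, 1, 2, 3, 4, 5, 6}" by auto
    with of_int show ?thesis by auto
  qed
  then show ?thesis by blast
qed

lemma forall_7: "(\<forall>x :: 7. P x) \<longleftrightarrow> P 0 \<and> P 1 \<and> P 2 \<and> P 3 \<and> P 4 \<and> P 5 \<and> P 6"
proof -
  have "(\<forall>x :: 7. P x) \<longleftrightarrow> (\<forall>x \<in> {0, 1, 2, 3, 4, 5, 6}. P x)"
    by (simp only: UNIV_7[symmetric])  auto
  then show ?thesis by simp
qed

lemma fermat_7: "(x :: 7) \<noteq> 0 \<Longrightarrow> x * x ^ 5 = 1"
proof -
  have "\<forall>x :: 7. x \<noteq> 0 \<longrightarrow> x * x ^ 5 = 1" by (simp add: forall_7)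
  then show "x \<noteq> 0 \<Longrightarrow> x * x ^ 5 = 1" by blast
qed

lemma of_nat_surj_7: "\<exists>n. (x :: 7) = of_nat n"
proof -
  have "\<forall>x :: 7. \<exists>n. x = of_nat n"
    unfolding forall_7 by (metis of_nat_0 of_nat_1 of_nat_numeral)
  then show ?thesis by blast
qed

abbreviation M22 :: "7 \<Rightarrow> 7 \<Rightarrow> 7 \<Rightarrow> 7 \<Rightarrow> 7 ^ 2 ^ 2" where
  "M22 p q r s \<equiv> vector [vector [p, q], vector [r, s]]"

lemma M22_exhaust: obtains p q r s where "A = M22 p q r s"
proof
  show "A = M22 (A $ 1 $ 1) (A $ 1 $ 2) (A $ 2 $ 1) (A $ 2 $ 2)"
    by (simp add: vec_eq_iff forall_2)
qed

lemma M22_mult: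
  "M22 p q r s ** M22 p' q' r' s' = M22 (p * p' + q * r') (p * q' + q * s') (r * p' + s * r') (r *
      q' + s * s')"
  by (simp add: vec_eq_iff forall_2 matrix_matrix_mult_def sum_2)

lemma M22_det: "det (M22 p q r s) = p * s - q * r"
  by (simp add: det_2)

lemma M22_uminus: "- M22 p q r s = M22 (- p) (- q) (- r) (- s)"
  by (simp add: vec_eq_iff forall_2)

lemma M22_one: "mat 1 = M22 1 0 0 1"
  by (simp add: vec_eq_iff forall_2 mat_def)

lemma M22_eq_iff: "M22 p q r s = M22 p' q' r' s' \<longleftrightarrow> p = p' \<and> q = q' \<and> r = r' \<and> s = s'"
  by (simp add: vec_eq_iff forall_2)

lemma M22_vec: "M22 p q r s *v vector [x, y] = vector [p * x + q * y, r * x + s * y]"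
  by (simp add: vec_eq_iff forall_2 matrix_vector_mult_def sum_2)

abbreviation T7 :: "7 ^ 2 ^ 2" where "T7 \<equiv> M22 1 1 0 1"
abbreviation W7 :: "7 ^ 2 ^ 2" where "W7 \<equiv> M22 0 (-1) 1 0"

lemma SL2_7_carrier: "M22 p q r s \<in> carrier SL2_7 \<longleftrightarrow> p * s - q * r = 1"
  by (simp add: SL2_7_def M22_det)

lemma SL2_7_mult: "A \<otimes>\<^bsub>SL2_7\<^esub> B = A ** B" and SL2_7_one: "\<one>\<^bsub>SL2_7\<^esub> = mat 1"
  by (simp_all add: SL2_7_def)

lemma T7_W7_in_SL2_7: "T7 \<in> carrier SL2_7" "W7 \<in> carrier SL2_7"
  by (simp_all add: SL2_7_carrier)

interpretation SL: group SL2_7 by (rule group_SL2_7)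

text \<open>
  Row operations: a matrix with nonzero lower left entry has a decomposition \<open>T\<^sup>i W T\<^sup>j W T\<^sup>k\<close> up
  to the sign of the exponents of \<open>W\<close>, and multiplication by \<open>W\<close> reduces the other matrices to
  this case.
\<close>

lemma SL2_7_induct:
  assumes A: "A \<in> carrier SL2_7" and one: "P (mat 1)"
    and T: "\<And>B. B \<in> carrier SL2_7 \<Longrightarrow> P B \<Longrightarrow> P (T7 ** B)"
    and W: "\<And>B. B \<in> carrier SL2_7 \<Longrightarrow> P B \<Longrightarrow> P (W7 ** B)"
  shows "P A"
proof -
  have cl: "C ** B \<in> carrier SL2_7" if "B \<in> carrier SL2_7" "C \<in> carrier SL2_7" for B C
    using SL.m_closed[OF that(2,1)] by (simp add: SL2_7_mult)
  have shear: "P (M22 1 m 0 1 ** B)" if B: "B \<in> carrier SL2_7" "P B" for m B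
  proof -
    have "P (M22 1 (of_nat n) 0 1 ** B)" for n
    proof (induction n)
      case 0
      then show ?case using B by (simp add: M22_one[symmetric])
    next
      case (Suc n)
      have "M22 1 (of_nat (Suc n)) 0 1 = T7 ** M22 1 (of_nat n) 0 1"
        by (simp add: M22_mult add.commute)
      moreover have "M22 1 (of_nat n) 0 1 ** B \<in> carrier SL2_7"
        using B by (intro cl) (simp_all add: SL2_7_carrier)
      ultimately show ?case using T Suc by (simp add: matrix_mul_assoc[symmetric])
    qed
    then show ?thesis using of_nat_surj_7[of m] by metis
  qed
  have W': "P (M22 0 1 (-1) 0 ** B)" if B: "B \<in> carrier SL2_7" "P B" for B
  proof -
    have "P (W7 ** (W7 ** (W7 ** B)))"
      using B T7_W7_in_SL2_7 by (intro W cl) auto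
    moreover have "W7 ** (W7 ** (W7 ** B)) = M22 0 1 (-1) 0 ** B"
      by (simp add: matrix_mul_assoc M22_mult)
    ultimately show ?thesis by simp
  qed
  have gen: "P (M22 p q r s)" if "p * s - q * r = 1" "r \<noteq> 0" for p q r s
  proof -
    (* Adding m times the second row to the first makes the upper left entry 1. *)
    define m where "m = (1 - p) * r ^ 5"
    have m: "p + m * r = 1"
    proof -
      have "m * r = (1 - p) * (r * r ^ 5)" by (simp add: m_def mult_ac)
      also have "\<dots> = 1 - p" by (simp add: fermat_7[OF that(2)])
      finally show ?thesis by simp
    qed
    define q' where "q' = q + m * s"
    have "P (M22 1 q' 0 1)"
      using shear[of "mat 1" q'] one by (simp add: SL2_7_def M22_mult M22_one M22_det)
    then have "P (M22 1 (-m) 0 1 ** (M22 0 1 (-1) 0 ** (M22 1 (-r) 0 1 ** (W7 ** M22 1 q' 0 1))))"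
      by (intro shear W' W cl) (simp_all add: SL2_7_carrier)
    moreover have "M22 1 (-m) 0 1 ** (M22 0 1 (-1) 0 ** (M22 1 (-r) 0 1 ** (W7 ** M22 1 q' 0 1)))
        = M22 p q r s"
    proof -
      have p: "p = 1 - m * r" using m by (simp add: algebra_simps)
      have s: "s = 1 + r * q'"
      proof -
        have "s = p * s + m * r * s" using arg_cong[OF m, of "\<lambda>t. t * s"] by (simp add: algebra_simps)
        also have "p * s = 1 + q * r" using that(1) by (simp add: algebra_simps)
        finally show ?thesis by (simp add: q'_def algebra_simps)
      qed
      have "q = q' - m * s" by (simp add: q'_def)
      then show ?thesis
        by (simp add: M22_mult M22_eq_iff p) (simp add: s algebra_simps)
    qed
    ultimately show ?thesis by simp
  qed
  obtain p q r s where A': "A = M22 p q r s" by (rule M22_exhaust)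
  have det: "p * s - q * r = 1" using A by (simp add: A' SL2_7_carrier)
  show ?thesis
  proof (cases "r = 0")
    case False
    then show ?thesis using gen det by (simp add: A')
  next
    case True
    then have "p \<noteq> 0" using det by auto
    have det': "- r * q - - s * p = 1" using det by (simp add: algebra_simps)
    have "P (M22 0 1 (-1) 0 ** M22 (- r) (- s) p q)"
      using gen[OF det' \<open>p \<noteq> 0\<close>] det' by (intro W') (simp_all add: SL2_7_carrier)
    then show ?thesis by (simp add: A' M22_mult)
  qed
qed

section \<open>Simplicity and Hurwitz generators of PSL(2,7)\<close>

lemma SL2_7_inv:
  assumes "p * s - q * r = 1"
  shows "inv\<^bsub>SL2_7\<^esub> M22 p q r s = M22 s (- q) (- r) p"
  using assms
  by (intro SL.inv_equality)
    (simp_all add: SL2_7_carrier SL2_7_mult SL2_7_one M22_mult M22_one M22_eq_iff algebra_simps)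

text \<open>
  A noncentral matrix is conjugate to one with upper left entry zero. Its commutator with a
  diagonal matrix is triangular with distinct diagonal entries, and the commutator of that matrix
  with an elementary matrix is elementary. Elementary matrices and their conjugates generate.
\<close>

lemma SL2_7_normal_subgroup:
  assumes N: "N \<lhd> SL2_7" and A: "A \<in> N" "A \<noteq> mat 1" "A \<noteq> - mat 1"
  shows "N = carrier SL2_7"
proof -
  note sub = normal_imp_subgroup[OF N]
  have mult: "C ** D \<in> N" if "C \<in> N" "D \<in> N" for C D
    using subgroup.m_closed[OF sub that] by (simp add: SL2_7_mult)
  have conj: "M22 a b c d ** C ** M22 d (- b) (- c) a \<in> N" if "C \<in> N" "a * d - b * c = 1" for C a b c d
    using normal.inv_op_closed2[OF N, of "M22 a b c d" C] that
      by (simp add: SL2_7_carrier SL2_7_mult SL2_7_inv)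
  have inv: "M22 s (- q) (- r) p \<in> N" if "M22 p q r s \<in> N" for p q r s
    using subgroup.m_inv_closed[OF sub that] subgroup.subset[OF sub] that
      by (auto simp: SL2_7_inv SL2_7_carrier)
  have det: "p * s - q * r = 1" if "M22 p q r s \<in> N" for p q r s
    using that subgroup.subset[OF sub] SL2_7_carrier by blast
  obtain p q r s where pqrs: "M22 p q r s \<in> N" and r: "r \<noteq> 0"
  proof -
    obtain p q r s where A': "A = M22 p q r s" by (rule M22_exhaust)
    consider "r \<noteq> 0" | "r = 0" "q \<noteq> 0" | "r = 0" "q = 0" by blast
    then show ?thesis
    proof cases
      case 1
      then show ?thesis using that A A' by blast
    next
      case 2
      have "M22 s (- r) (- q) p \<in> N"
        using conj[OF A(1), of 0 0 "-1" 1] by (simp add: A' M22_mult)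
      then show ?thesis using that[of s "- r" "- q" p] 2 by auto
    next
      case 3
      have ps: "p * s = 1" using det[of p q r s] A A' 3 by simp
      have "p \<noteq> s"
      proof
        assume "p = s"
        moreover have "\<forall>x :: 7. x * x = 1 \<longrightarrow> x = 1 \<or> x = - 1" by (simp add: forall_7)
        ultimately have "p = s \<and> (p = 1 \<or> p = - 1)" using ps by blast
        then show False using A A' 3 by (auto simp: M22_one M22_uminus)
      qed
      moreover have "M22 p 0 (p - s) s \<in> N"
        using conj[OF A(1), of 1 1 0 1] by (simp add: A' 3 M22_mult)
      ultimately show ?thesis using that[of p 0 "p - s" s] by auto
    qed
  qed
  obtain k t where kt: "M22 0 (- k) r t \<in> N" and kr: "k * r = 1"
  proof -
    define m where "m = - p * r ^ 5"
    have "m * r = - p * (r * r ^ 5)" by (simp add: m_def mult_ac)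
    then have m: "p + m * r = 0" by (simp add: fermat_7[OF r])
    have "M22 1 m 0 1 ** M22 p q r s ** M22 1 (- m) 0 1 \<in> N"
      using conj[OF pqrs, of 1 1 m 0] by simp
    then have "M22 (p + m * r) (- (p + m * r) * m + q + m * s) r (s - r * m) \<in> N"
      by (simp add: M22_mult algebra_simps)
    then have *: "M22 0 (- (- (q + m * s))) r (s - r * m) \<in> N"
      by (simp add: m add.commute)
    show ?thesis
      by (rule that[OF *]) (use det[OF *] in \<open>simp add: algebra_simps\<close>)
  qed
  (* The diagonal entries 2 and 4 are inverse to each other modulo 7.  The choice 2 works because
     its fourth power is not 1, so that the commutator below is not scalar. *)
  have "M22 0 (- k) r t ** (M22 2 0 0 4 ** M22 t k (- r) 0 ** M22 4 0 0 2) \<in> N"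
    using conj[OF inv[OF kt], of 2 4 0 0] by (rule_tac mult[OF kt]) simp
  moreover have "M22 0 (- k) r t ** (M22 2 0 0 4 ** M22 t k (- r) 0 ** M22 4 0 0 2) = M22 2 0 (- (r * t)) 4"
  proof -
    have "k * (r * 16) = 2" "r * (k * 4) = 4"
      using kr by (simp_all add: mult.assoc[symmetric] mult.commute[of r k])
    moreover have "x * 7 = 0" for x :: 7
    proof -
      have "(7 :: 7) = 0" by simp
      then show ?thesis by (simp only: mult_zero_right)
    qed
    ultimately show ?thesis
      by (simp add: M22_mult M22_eq_iff mult_ac)
  qed
  ultimately have e: "M22 2 0 (- (r * t)) 4 \<in> N" by simp
  (* Conjugating the lower elementary matrix by M22 2 0 e 4 squares it, so the commutator is the
     elementary matrix itself. *)
  define e where "e = - (r * t)"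
  have e': "M22 2 0 e 4 \<in> N" "M22 4 0 (- e) 2 \<in> N"
    using e inv[OF e] by (simp_all add: e_def)
  have "M22 2 0 e 4 ** (M22 1 0 1 1 ** M22 4 0 (- e) 2 ** M22 1 0 (- 1) 1) \<in> N"
    using conj[OF e'(2), of 1 1 0 1] by (rule_tac mult[OF e'(1)]) simp
  moreover have "M22 2 0 e 4 ** (M22 1 0 1 1 ** M22 4 0 (- e) 2 ** M22 1 0 (- 1) 1) = M22 1 0 1 1"
    by (simp add: M22_mult M22_eq_iff algebra_simps)
  ultimately have L: "M22 1 0 1 1 \<in> N" by simp
  have T': "M22 1 (- 1) 0 1 \<in> N"
    using conj[OF L, of 0 0 "-1" 1] by (simp add: M22_mult)
  have T: "T7 \<in> N" using inv[OF T'] by simp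
  have W: "W7 \<in> N"
    using mult[OF mult[OF T' L] T'] by (simp add: M22_mult)
  have "C \<in> N" if "C \<in> carrier SL2_7" for C
    by (rule SL2_7_induct[OF
      that]) (use subgroup.one_closed[OF sub] mult[OF T] mult[OF W] in \<open>auto simp: SL2_7_one\<close>)
  then show ?thesis using subgroup.subset[OF sub] by blast
qed

definition psl :: "7 ^ 2 ^ 2 \<Rightarrow> (7 ^ 2 ^ 2) set" where
  "psl A = {mat 1, - mat 1} #>\<^bsub>SL2_7\<^esub> A"

lemma psl_eq: "psl A = {A, - A}"
proof -
  have "- mat 1 ** A = - A" by (simp add: vec_eq_iff matrix_matrix_mult_def sum_negf mat_def sum_2 forall_2)
  then show ?thesis by (auto simp: psl_def r_coset_def SL2_7_def)
qed

lemma psl_eq_iff: "psl A = psl B \<longleftrightarrow> A = B \<or> A = - B"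
  unfolding psl_eq by (metis doubleton_eq_iff minus_minus)

lemma carrier_PSL2_7: "carrier PSL2_7 = psl ` carrier SL2_7"
  by (auto simp: PSL2_7_def FactGroup_def RCOSETS_def psl_def)

interpretation psl: group_hom SL2_7 PSL2_7 psl
proof -
  have "psl \<in> hom SL2_7 PSL2_7"
    using normal.r_coset_hom_Mod[OF normal_center_SL2_7] by (simp add: PSL2_7_def psl_def[abs_def])
  then show "group_hom SL2_7 PSL2_7 psl"
    using group_SL2_7 group_PSL2_7 by (simp add: group_hom_def group_hom_axioms_def)
qed

lemma psl_eq_one_iff: "psl A = \<one>\<^bsub>PSL2_7\<^esub> \<longleftrightarrow> A = mat 1 \<or> A = - mat 1"
  using psl.hom_one psl_eq_iff[of A "mat 1"] by (simp add: SL2_7_one)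

lemma finite_PSL2_7: "finite (carrier PSL2_7)"
  unfolding carrier_PSL2_7 by simp

lemma psl_T7_neq_one: "psl T7 \<noteq> \<one>\<^bsub>PSL2_7\<^esub>"
  unfolding psl_eq_one_iff M22_one M22_uminus M22_eq_iff by simp

lemma simple_PSL2_7: "simple_group PSL2_7"
proof (rule simple_group.intro[OF group_PSL2_7], unfold_locales)
  have "{\<one>\<^bsub>PSL2_7\<^esub>, psl T7} \<subseteq> carrier PSL2_7"
    using T7_W7_in_SL2_7 psl.hom_closed by auto
  then have "card {\<one>\<^bsub>PSL2_7\<^esub>, psl T7} \<le> Coset.order PSL2_7"
    unfolding Coset.order_def by (rule card_mono[OF finite_PSL2_7])
  then show "1 < Coset.order PSL2_7"
    using psl_T7_neq_one by auto
next
  fix K assume K: "K \<lhd> PSL2_7"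
  note sub = normal_imp_subgroup[OF K]
  define N where "N = {A \<in> carrier SL2_7. psl A \<in> K}"
  have "subgroup N SL2_7"
    by (rule SL.subgroupI)
      (auto simp: N_def subgroup.m_closed[OF sub] subgroup.m_inv_closed[OF sub] subgroup.one_closed[OF sub]
        intro!: exI[of _ "\<one>\<^bsub>SL2_7\<^esub>"])
  moreover have "C \<otimes>\<^bsub>SL2_7\<^esub> A \<otimes>\<^bsub>SL2_7\<^esub> inv\<^bsub>SL2_7\<^esub> C \<in> N" if "C \<in> carrier SL2_7" "A \<in> N" for C A
    using that normal.inv_op_closed2[OF K, of "psl C" "psl A"] by (simp add: N_def)
  ultimately have N: "N \<lhd> SL2_7"
    by (simp add: SL.normal_inv_iff)
  have K_eq: "K = psl ` N"
    using subgroup.subset[OF sub] unfolding N_def carrier_PSL2_7 by blast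
  show "K = carrier PSL2_7 \<or> K = {\<one>\<^bsub>PSL2_7\<^esub>}"
  proof (cases "N \<subseteq> {mat 1, - mat 1}")
    case True
    then have "K \<subseteq> {\<one>\<^bsub>PSL2_7\<^esub>}" unfolding K_eq using psl_eq_one_iff by blast
    then show ?thesis using subgroup.one_closed[OF sub] by blast
  next
    case False
    then have "N = carrier SL2_7" using SL2_7_normal_subgroup[OF N] by blast
    then show ?thesis by (simp add: K_eq carrier_PSL2_7)
  qed
qed

lemma SL2_7_generate: "carrier SL2_7 = generate SL2_7 {T7, W7}"
proof
  show "generate SL2_7 {T7, W7} \<subseteq> carrier SL2_7"
    using T7_W7_in_SL2_7 by (intro SL.generate_incl) auto
  show "carrier SL2_7 \<subseteq> generate SL2_7 {T7, W7}"
  proof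
    fix A assume "A \<in> carrier SL2_7"
    then show "A \<in> generate SL2_7 {T7, W7}"
    proof (rule SL2_7_induct)
      show "mat 1 \<in> generate SL2_7 {T7, W7}"
        using generate.one[of SL2_7] by (simp add: SL2_7_one)
      show "T7 ** B \<in> generate SL2_7 {T7, W7}" if "B \<in> generate SL2_7 {T7, W7}" for B
        using generate.eng[OF generate.incl that, of T7] by (simp add: SL2_7_mult)
      show "W7 ** B \<in> generate SL2_7 {T7, W7}" if "B \<in> generate SL2_7 {T7, W7}" for B
        using generate.eng[OF generate.incl that, of W7] by (simp add: SL2_7_mult)
    qed
  qed
qed

primrec tri_matrix :: "tri_gen \<Rightarrow> 7 ^ 2 ^ 2" where
  "tri_matrix TX = W7"
| "tri_matrix TY = M22 0 1 (- 1) 1"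
| "tri_matrix TZ = T7"

definition tri_relators :: "tri_gen word set" where
  "tri_relators = {gen TX @ gen TX, gen TY @ gen TY @ gen TY,
      gen TZ @ gen TZ @ gen TZ @ gen TZ @ gen TZ @ gen TZ @ gen TZ, gen TX @ gen TY @ gen TZ}"

lemma triangle_group_eq: "triangle_group_237 = presented_group tri_relators"
  by (simp only: triangle_group_237_def tri_relators_def)

lemma hurwitz_PSL2_7: "hurwitz_group PSL2_7"
proof -
  let ?f = "\<lambda>g. psl (tri_matrix g)"
  have matrix: "tri_matrix g \<in> carrier SL2_7" for g
    by (cases g) (simp_all add: SL2_7_carrier)
  have rel: "word_eval PSL2_7 ?f r = \<one>\<^bsub>PSL2_7\<^esub>" if "r \<in> tri_relators" for r
  proof -
    have "word_eval SL2_7 tri_matrix r \<in> {mat 1, - mat 1}"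
      using that unfolding M22_one M22_uminus
      by (auto simp: tri_relators_def SL2_7_mult SL2_7_one M22_one M22_mult M22_eq_iff)
    then have "psl (word_eval SL2_7 tri_matrix r) = \<one>\<^bsub>PSL2_7\<^esub>"
      by (simp add: psl_eq_one_iff)
    then show ?thesis by (simp only: psl.hom_word_eval[OF matrix])
  qed
  have gen: "carrier PSL2_7 \<subseteq> generate PSL2_7 (range ?f)"
  proof -
    have "carrier PSL2_7 = generate PSL2_7 (psl ` {T7, W7})"
      unfolding carrier_PSL2_7 SL2_7_generate
      using T7_W7_in_SL2_7 by (intro psl.generate_img[symmetric]) auto
    also have "psl ` {T7, W7} \<subseteq> range ?f"
      by (auto intro: range_eqI[of _ _ TZ] range_eqI[of _ _ TX])
    finally show ?thesis using group.mono_generate[OF group_PSL2_7] by blast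
  qed
  have "?f g \<in> carrier PSL2_7" for g using matrix by simp
  then obtain h where "h \<in> epi (presented_group tri_relators) PSL2_7"
    using presented_group_epi[of PSL2_7 ?f tri_relators, OF group_PSL2_7 _ rel gen] by blast
  moreover have "\<not> trivial_group PSL2_7"
    using simple_group.simple_not_triv[OF simple_PSL2_7] by (simp add: trivial_group_def)
  ultimately show ?thesis
    unfolding hurwitz_group_def triangle_group_eq using group_PSL2_7 finite_PSL2_7 by blast
qed

section \<open>The projective line over seven elements as an affine space\<close>

text \<open>
  A nonzero vector \<open>(x, y)\<close> represents the point \<open>x / y\<close> of the projective line over the field
  with seven elements. The bit at \<open>k\<close> vanishes on the block consisting of infinity and of the
  points \<open>k + s\<close> with \<open>s\<close> a nonzero square, that is, \<open>s \<in> {1, 2, 4}\<close>; multiplying by \<open>y\<^sup>2\<close> avoids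
  division. The fourteen blocks, namely these seven and their complements, form the Steiner system
  \<open>S(3, 4, 8)\<close> of the extended quadratic residue code.
\<close>

definition residue_bit :: "7 \<Rightarrow> 7 ^ 2 \<Rightarrow> 2" where
  "residue_bit k p = (if p $ 2 = 0 \<or> (p $ 1 - k * p $ 2) * p $ 2 \<in> {1, 2, 4} then 0 else 1)"

text \<open>
  Three of the bits identify the eight points of the projective line with the affine space of
  dimension three over the field with two elements, in such a way that blocks become planes. This
  is the classical embedding of \<open>PSL\<^sub>2(7)\<close> into \<open>AGL\<^sub>3(2)\<close>.
\<close>

definition label :: "7 ^ 2 \<Rightarrow> 2 ^ 3" where
  "label p = vector [residue_bit 0 p, residue_bit 1 p, residue_bit 2 p]"

lemma forall_F2: "(\<forall>x :: 2. P x) \<longleftrightarrow> P 0 \<and> P 1"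
proof -
  have "x = 0 \<or> x = 1" for x :: 2
  proof (cases x rule: bit0_cases)
    case (of_int z)
    then have "z = 0 \<or> z = 1" by auto
    with of_int show ?thesis by auto
  qed
  then show ?thesis by metis
qed

lemma forall_vec2: "(\<forall>p :: ('a :: zero) ^ 2. P p) \<longleftrightarrow> (\<forall>x y. P (vector [x, y]))"
proof -
  have "p = vector [p $ 1, p $ 2]" for p :: "('a :: zero) ^ 2"
    by (simp add: vec_eq_iff forall_2)
  then show ?thesis by metis
qed

lemma forall_vec3: "(\<forall>p :: ('a :: zero) ^ 3. P p) \<longleftrightarrow> (\<forall>x y z. P (vector [x, y, z]))"
proof -
  have "p = vector [p $ 1, p $ 2, p $ 3]" for p :: "('a :: zero) ^ 3"
    by (simp add: vec_eq_iff forall_3)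
  then show ?thesis by metis
qed

text \<open>
  The labels of the points \<open>0, 1, 2, \<dots>\<close> are the windows of length three in a linear recurring
  sequence of period seven, and the shift of this sequence is linear.
\<close>

definition mat_T :: "2 ^ 3 \<Rightarrow> 2 ^ 3" where
  "mat_T v = vector [v $ 2 + v $ 3, v $ 1, v $ 2]"

definition mat_W :: "2 ^ 3 \<Rightarrow> 2 ^ 3" where
  "mat_W v = vector [v $ 1, v $ 1 + v $ 2 + v $ 3, v $ 3]"

lemma label_T7: "p \<noteq> 0 \<Longrightarrow> label (T7 *v p) = mat_T (label p)"
proof -
  have "\<forall>p. p \<noteq> 0 \<longrightarrow> label (T7 *v p) = mat_T (label p)"
    unfolding forall_vec2 M22_vec label_def residue_bit_def mat_T_def
    by (simp add: forall_7 vec_eq_iff forall_3 forall_2)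
  then show "p \<noteq> 0 \<Longrightarrow> label (T7 *v p) = mat_T (label p)" by blast
qed

lemma label_W7: "p \<noteq> 0 \<Longrightarrow> label (W7 *v p) = mat_W (label p) + vector [1, 1, 1]"
proof -
  have "\<forall>p. p \<noteq> 0 \<longrightarrow> label (W7 *v p) = mat_W (label p) + vector [1, 1, 1]"
    unfolding forall_vec2 M22_vec label_def residue_bit_def mat_W_def
    by (simp add: forall_7 vec_eq_iff forall_3 forall_2)
  then show "p \<noteq> 0 \<Longrightarrow> label (W7 *v p) = mat_W (label p) + vector [1, 1, 1]" by blast
qed

lemma label_uminus: "label (- p) = label p"
  by (simp add: label_def residue_bit_def algebra_simps)

lemma label_infinity: "label (vector [1, 0]) = 0"
  by (simp add: label_def residue_bit_def vec_eq_iff forall_3)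

lemma label_nonzero: "v \<noteq> 0 \<Longrightarrow> \<exists>i. v = label (vector [i, 1])"
proof -
  have "\<forall>v. v \<noteq> 0 \<longrightarrow> v \<in> (\<lambda>i. label (vector [i, 1])) ` {0, 1, 2, 3, 4, 5, 6}"
    unfolding forall_vec3 label_def residue_bit_def forall_F2
    by (simp add: vec_eq_iff forall_3)
  then show "v \<noteq> 0 \<Longrightarrow> \<exists>i. v = label (vector [i, 1])" by blast
qed

lemma label_affine_neq_zero: "label (vector [i, 1]) \<noteq> 0"
proof -
  have "\<forall>i. label (vector [i, 1]) \<noteq> 0"
    unfolding label_def residue_bit_def by (simp add: forall_7 vec_eq_iff forall_3)
  then show ?thesis by blast
qed

lemma label_affine_inj: "label (vector [i, 1]) = label (vector [j, 1]) \<longleftrightarrow> i = j"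
proof -
  have "\<forall>i j. label (vector [i, 1]) = label (vector [j, 1]) \<longrightarrow> i = j"
    unfolding label_def residue_bit_def by (simp add: forall_7 vec_eq_iff forall_3)
  then show ?thesis by blast
qed

section \<open>Three involutions on a vector space with eight elements\<close>

context
  assumes char_two: "\<And>x :: 'v :: {ab_group_add, finite}. x + x = 0"
begin

lemma char_two_eq: "x + y = 0 \<longleftrightarrow> x = (y :: 'v)"
  using char_two[of y] by (metis add_right_cancel)

lemma char_two_cancel: "x + (x + y) = (y :: 'v)"
  by (simp add: add.assoc[symmetric] char_two)

lemma singleton_neq_nonzero:
  assumes "CARD('v) = 8"
  shows "{v} \<noteq> - {0 :: 'v}"
proof
  assume "{v} = - {0}"
  then have "card {v} = card (- {0 :: 'v})" by simp
  then show False using assms by (simp add: Compl_eq_Diff_UNIV card_Diff_singleton)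
qed

lemma exists_nonzero:
  assumes "CARD('v) = 8"
  obtains v :: 'v where "v \<noteq> 0"
proof -
  have "card (- {0 :: 'v}) = 7" using assms by (simp add: Compl_eq_Diff_UNIV card_Diff_singleton)
  then have "- {0 :: 'v} \<noteq> {}" by auto
  then show ?thesis using that by blast
qed

text \<open>
  The displacements \<open>v + f v\<close> of an involution are fixed by it, so their number is at most the
  number of fixed vectors; the product of the two numbers is 8.
\<close>

lemma card_displacement_involution:
  fixes f :: "'v \<Rightarrow> 'v"
  assumes add: "\<And>x y. f (x + y) = f x + f y" and inv: "\<And>x. f (f x) = x" and card: "CARD('v) = 8"
  shows "card (range (\<lambda>v. v + f v)) \<le> 2"
proof -
  let ?E = "range (\<lambda>v. v + f v)" and ?K = "{v. f v = v}"
  have "?E \<subseteq> ?K" by (auto simp: add inv add.commute)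
  then have EK: "card ?E \<le> card ?K" by (rule card_mono[rotated]) simp
  (* A section of the displacement map; it splits the space into displacements and fixed vectors. *)
  define s where "s e = (SOME v. v + f v = e)" for e
  have s: "s e + f (s e) = e" if "e \<in> ?E" for e
    unfolding s_def by (rule someI_ex) (use that in auto)
  have "inj_on (\<lambda>(e, k). s e + k) (?E \<times> ?K)"
  proof (rule inj_onI, clarify)
    fix x y k l
    assume k: "f k = k" and l: "f l = l" and eq: "s (x + f x) + k = s (y + f y) + l"
    have disp: "s e + k' + f (s e + k') = e" if "e \<in> ?E" "f k' = k'" for e k'
    proof -
      have "s e + k' + f (s e + k') = (s e + f (s e)) + (k' + k')"
        using that(2) by (simp add: add ac_simps)
      then show ?thesis using s[OF that(1)] by (simp add: char_two)
    qed
    have "x + f x = y + f y"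
      using disp[of "x + f x" k] disp[of "y + f y" l] k l eq by simp
    with eq show "x + f x = y + f y \<and> k = l" by simp
  qed
  then have "card (?E \<times> ?K) \<le> CARD('v)"
    by (rule card_inj_on_le) simp_all
  then have "card ?E * card ?E \<le> 8"
    using card order.trans[OF mult_le_mono2[OF EK, of "card ?E"]] by (simp add: card_cartesian_product)
  moreover have "3 * 3 \<le> card ?E * card ?E" if "3 \<le> card ?E"
    using that by (intro mult_le_mono)
  ultimately show ?thesis by linarith
qed

text \<open>
  Without nonzero fixed vectors, \<open>1 + d + d\<^sup>2 = 0\<close>, and the space would be a vector space over the
  field with four elements, whose order cannot be 8. Concretely, an invariant plane \<open>L\<close> leaves a
  quotient of order 2, on which \<open>d\<close> acts trivially, and since \<open>1 + d\<close> is invertible on \<open>L\<close>, a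
  fixed vector can be found in the other coset.
\<close>

lemma order_three_fixed_vector:
  fixes d :: "'v \<Rightarrow> 'v"
  assumes add: "\<And>x y. d (x + y) = d x + d y" and ord: "\<And>x. d (d (d x)) = x" and card: "CARD('v) = 8"
  shows "\<exists>v. v \<noteq> 0 \<and> d v = v"
proof (rule ccontr)
  assume no: "\<nexists>v. v \<noteq> 0 \<and> d v = v"
  have d0: "d 0 = 0" using add[of 0 0] by simp
  have dd: "d (d x) = x + d x" for x
  proof -
    have "d (x + d x + d (d x)) = x + d x + d (d x)"
      by (simp add: add ord ac_simps)
    then have "d (d x) + (x + d x) = 0" using no by (metis add.commute)
    then show ?thesis by (simp only: char_two_eq)
  qed
  obtain v :: 'v where v: "v \<noteq> 0" using exists_nonzero[OF card] .
  define L where "L = {0, v, d v, v + d v}"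
  have L_add: "x + y \<in> L" if "x \<in> L" "y \<in> L" for x y
    using that unfolding L_def by (auto simp: char_two char_two_cancel ac_simps)
  have L_d: "d x \<in> L" if "x \<in> L" for x
    using that unfolding L_def by (auto simp: d0 dd add ac_simps char_two char_two_cancel)
  have v': "d v \<noteq> 0" "d v \<noteq> v" using v no d0 ord by metis+
  moreover have "v + d v \<noteq> 0" using v'(2) by (simp only: char_two_eq not_sym not_False_eq_True)
  ultimately have "card L = 4"
    using v not_sym[OF v] not_sym[OF v'(1)] not_sym[OF v'(2)] not_sym[OF \<open>v + d v \<noteq> 0\<close>]
    unfolding L_def by simp
  have "L \<noteq> UNIV" using \<open>card L = 4\<close> card by auto
  then obtain u where u: "u \<notin> L" by blast
  have coset: "x + u \<in> L" if x: "x \<notin> L" for x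
  proof -
    have disj: "L \<inter> (+) u ` L = {}"
      using u L_add by (metis (no_types, lifting) add.commute char_two_cancel disjoint_iff imageE)
    have "card (L \<union> (+) u ` L) = card L + card ((+) u ` L)"
      by (rule card_Un_disjoint) (use disj in auto)
    also have "card ((+) u ` L) = card L" by (rule card_image) simp
    finally have "L \<union> (+) u ` L = UNIV"
      using \<open>card L = 4\<close> card by (intro card_subset_eq) auto
    then obtain l where "l \<in> L" "x = u + l" using x by blast
    then show ?thesis by (simp only: add.commute[of "u + l"] char_two_cancel)
  qed
  have "d u \<notin> L"
    using L_d[of "d u"] L_d[of "d (d u)"] u ord by metis
  then have "d u + u \<in> L" by (rule coset)
  moreover have "(\<lambda>l. l + d l) ` L = L"
  proof (rule endo_inj_surj)
    show "finite L" by simp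
    show "(\<lambda>l. l + d l) ` L \<subseteq> L" using L_add L_d by blast
    show "inj_on (\<lambda>l. l + d l) L"
    proof (rule inj_onI)
      fix x y assume "x + d x = y + d y"
      then have "(x + y) + d (x + y) = 0"
        by (simp add: add char_two_eq ac_simps) (metis add.commute add.left_commute char_two_cancel)
      then have "x + y = d (x + y)" by (simp only: char_two_eq)
      then have "x + y = 0" using no by metis
      then show "x = y" by (simp only: char_two_eq)
    qed
  qed
  ultimately obtain l where l: "l \<in> L" "d u + u = l + d l" by blast
  then have "d (u + l) = u + l"
    by (simp add: add) (metis add.commute add.left_commute char_two_cancel)
  then have "u + l = 0" using no by metis
  then show False using u l(1) by (simp add: char_two_eq)
qed

text \<open>
  This is Scott's inequality in the smallest interesting case. The maps \<open>a\<close>, \<open>b\<close>, \<open>c\<close> are trivial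
  or transvections, so their fixed spaces have codimension at most 1, whereas \<open>a b c\<close> has a fixed
  vector. If the displacements of \<open>a\<close>, \<open>b\<close>, \<open>c\<close> do not span the space, their span is invariant.
  Otherwise they are independent, and a vector fixed by \<open>a b c\<close> is fixed by each factor.
\<close>

lemma three_involutions_intransitive:
  fixes a b c :: "'v \<Rightarrow> 'v"
  assumes card: "CARD('v) = 8"
    and add: "\<And>x y. a (x + y) = a x + a y" "\<And>x y. b (x + y) = b x + b y" "\<And>x y. c (x + y) = c x + c y"
    and inv: "\<And>x. a (a x) = x" "\<And>x. b (b x) = x" "\<And>x. c (c x) = x"
    and ord: "\<And>x. a (b (c (a (b (c (a (b (c x)))))))) = x"
  shows "\<exists>S. S \<noteq> {} \<and> 0 \<notin> S \<and> S \<noteq> - {0} \<and> a ` S \<subseteq> S \<and> b ` S \<subseteq> S \<and> c ` S \<subseteq> S"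
proof -
  define E where "E f = range (\<lambda>v. v + f v)" for f :: "'v \<Rightarrow> 'v"
  have E_I: "v + f v \<in> E f" for f v by (simp add: E_def)
  have zero: "a 0 = 0" "b 0 = 0" "c 0 = 0" using add[of 0 0] by simp_all
  have E0: "0 \<in> E a" "0 \<in> E b" "0 \<in> E c" using E_I[of 0 a] E_I[of 0 b] E_I[of 0 c] zero by simp_all
  have E_add: "x + y \<in> E f" if add: "\<And>x y. f (x + y) = f x + f y" and xy: "x \<in> E f" "y \<in> E f" for f x y
  proof -
    obtain v w where "x = v + f v" "y = w + f w" using xy unfolding E_def by blast
    then have "x + y = (v + w) + f (v + w)" by (simp add: add ac_simps)
    then show ?thesis using E_I by metis
  qed
  define W where "W = (\<lambda>(x, y, z). x + y + z) ` (E a \<times> E b \<times> E c)"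
  show ?thesis
  proof (cases "W = UNIV")
    case True
    (* By counting, the sum of the three spaces of displacements is direct. *)
    have le: "card (E a) \<le> 2" "card (E b) \<le> 2" "card (E c) \<le> 2"
      unfolding E_def by (intro card_displacement_involution add inv card)+
    have "card (E a \<times> E b \<times> E c) \<le> 2 * (2 * 2)"
      unfolding card_cartesian_product by (intro mult_le_mono le)
    moreover have "card (E a \<times> E b \<times> E c) \<ge> card W"
      unfolding W_def by (rule card_image_le) (simp add: E_def)
    ultimately have "card W = card (E a \<times> E b \<times> E c)" using True card by simp
    then have inj: "inj_on (\<lambda>(x, y, z). x + y + z) (E a \<times> E b \<times> E c)"
      unfolding W_def by (intro eq_card_imp_inj_on) (simp_all add: E_def)
    have triv: "x = 0 \<and> y = 0 \<and> z = 0" if "x \<in> E a" "y \<in> E b" "z \<in> E c" "x + y + z = 0" for x y z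
      using inj_onD[OF inj, of "(x, y, z)" "(0, 0, 0)"] that E0 by simp
    obtain v where v: "v \<noteq> 0" "a (b (c v)) = v"
      using order_three_fixed_vector[of "\<lambda>x. a (b (c x))"] add ord card by auto
    (* The displacements along v, c v, b (c v), a (b (c v)) = v add up to zero. *)
    have "b (c v) + a (b (c v)) + (c v + b (c v)) + (v + c v) = 0"
      using v(2) by (simp add: ac_simps char_two char_two_cancel)
    then have "b (c v) + a (b (c v)) = 0 \<and> c v + b (c v) = 0 \<and> v + c v = 0"
      by (intro triv E_I)
    then have "c v = v" "b v = v" "a v = v"
      by (metis char_two_eq)+
    moreover have "{v} \<noteq> - {0}" by (rule singleton_neq_nonzero[OF card])
    ultimately show ?thesis using v(1) by (intro exI[of _ "{v}"]) auto
  next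
    case False
    have W_I: "x + y + z \<in> W" if "x \<in> E a" "y \<in> E b" "z \<in> E c" for x y z
      unfolding W_def using that by (intro image_eqI[of _ _ "(x, y, z)"]) auto
    have E_W: "E a \<subseteq> W" "E b \<subseteq> W" "E c \<subseteq> W"
      using W_I E0 by (metis add_0 add_0_right subsetI)+
    have W_add: "x + y \<in> W" if xy: "x \<in> W" "y \<in> W" for x y
    proof -
      obtain x1 x2 x3 where x: "x = x1 + x2 + x3" "x1 \<in> E a"
        "x2 \<in> E b" "x3 \<in> E c" using xy(1) unfolding W_def by auto
      obtain y1 y2 y3 where y: "y = y1 + y2 + y3" "y1 \<in> E a"
        "y2 \<in> E b" "y3 \<in> E c" using xy(2) unfolding W_def by auto
      have "x + y = (x1 + y1) + (x2 + y2) + (x3 + y3)" by (simp add: x y ac_simps)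
      then show ?thesis using
        W_I E_add[OF add(1) x(2) y(2)] E_add[OF add(2) x(3) y(3)] E_add[OF add(3) x(4) y(4)] by simp
    qed
    have W_inv: "f x \<in> W" if "E f \<subseteq> W" "x \<in> W" for f x
      using W_add[of x "x + f x"] E_I[of x f] that by (auto simp: char_two_cancel)
    have img: "f ` (W - {0}) \<subseteq> W - {0}" if "E f \<subseteq> W" and ff: "\<And>x. f (f x) = x" and f0: "f 0 = 0" for f
    proof
      fix y assume "y \<in> f ` (W - {0})"
      then obtain x where x: "x \<in> W" "x \<noteq> 0" "y = f x" by blast
      then have "y \<noteq> 0" using ff[of x] f0 by auto
      then show "y \<in> W - {0}" using W_inv[OF that(1) x(1)] x(3) by blast
    qed
    show ?thesis
    proof (cases "W \<subseteq> {0}")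
      case True
      have fix_all: "f x = x" if "E f \<subseteq> W" for f x
      proof -
        have "x + f x = 0" using that E_I[of x f] True by blast
        then have "x = f x" by (simp only: char_two_eq)
        then show ?thesis by simp
      qed
      obtain v :: 'v where v: "v \<noteq> 0" using exists_nonzero[OF card] .
      moreover have "{v} \<noteq> - {0}" by (rule singleton_neq_nonzero[OF card])
      ultimately show ?thesis using fix_all[OF E_W(1)] fix_all[OF E_W(2)] fix_all[OF E_W(3)]
        by (intro exI[of _ "{v}"]) auto
    next
      case nontriv: False
      have "W - {0} \<noteq> - {0}" using False E0 E_W by blast
      then show ?thesis
        using nontriv
          img[OF E_W(1) inv(1) zero(1)] img[OF E_W(2) inv(2) zero(2)] img[OF E_W(3) inv(3) zero(3)]
        by (intro exI[of _ "W - {0}"]) auto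
    qed
  qed
qed

end

section \<open>The homomorphism to GL(3,2)\<close>

text \<open>
  The action of \<open>A\<close> on the projective line, transported by the labelling, is \<open>v \<mapsto> L v + t\<close>.
\<close>

definition affine_action :: "7 ^ 2 ^ 2 \<Rightarrow> (2 ^ 3 \<Rightarrow> 2 ^ 3) \<Rightarrow> 2 ^ 3 \<Rightarrow> bool" where
  "affine_action A L t \<longleftrightarrow> (\<forall>x y. L (x + y) = L x + L y) \<and> (\<forall>p. p \<noteq> 0 \<longrightarrow> label (A *v p) = L (label p) + t)"

lemma label_surj: "\<exists>p. p \<noteq> 0 \<and> label p = v"
proof (cases "v = 0")
  case True
  have "vector [1, 0] \<noteq> (0 :: 7 ^ 2)" by (simp add: vec_eq_iff forall_2)
  then show ?thesis using True label_infinity by blast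
next
  case False
  then obtain i where "v = label (vector [i, 1])" using label_nonzero by blast
  moreover have "vector [i, 1] \<noteq> (0 :: 7 ^ 2)" by (simp add: vec_eq_iff forall_2)
  ultimately show ?thesis by blast
qed

lemma affine_action_unique:
  assumes "affine_action A L t" "affine_action A L' t'"
  shows "L = L' \<and> t = t'"
proof -
  have eq: "L v + t = L' v + t'" for v
    using assms label_surj[of v] unfolding affine_action_def by metis
  have "L 0 = 0" "L' 0 = 0"
    using assms unfolding affine_action_def by (metis add_cancel_right_right)+
  then have t: "t = t'" using eq[of 0] by simp
  then have "L v = L' v" for v using eq[of v] by simp
  with t show ?thesis by blast
qed

lemma SL2_7_vec_neq_zero:
  assumes "A \<in> carrier SL2_7" "p \<noteq> 0"
  shows "A *v p \<noteq> 0"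
proof
  assume "A *v p = 0"
  then have "(inv\<^bsub>SL2_7\<^esub> A ** A) *v p = 0"
    by (simp add: matrix_vector_mul_assoc[symmetric])
  then show False
    using SL.l_inv[OF assms(1)] assms(2) by (simp add: SL2_7_mult SL2_7_one)
qed

lemma affine_action_mult:
  assumes "B \<in> carrier SL2_7" "affine_action A L t" "affine_action B L' t'"
  shows "affine_action (A ** B) (L \<circ> L') (L t' + t)"
  using assms SL2_7_vec_neq_zero[OF assms(1)]
  by (simp add: affine_action_def matrix_vector_mul_assoc[symmetric] add.assoc)

lemma affine_action_T7: "affine_action T7 mat_T 0"
  unfolding affine_action_def using label_T7
  by (simp add: mat_T_def vec_eq_iff forall_3 add_ac)

lemma affine_action_W7: "affine_action W7 mat_W (vector [1, 1, 1])"
  unfolding affine_action_def using label_W7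
  by (simp add: mat_W_def vec_eq_iff forall_3 add_ac)

lemma affine_action_one: "affine_action (mat 1) id 0"
  by (simp add: affine_action_def)

lemma affine_action_exists: "A \<in> carrier SL2_7 \<Longrightarrow> \<exists>L t. affine_action A L t"
  by (erule SL2_7_induct)
    (use affine_action_one affine_action_mult affine_action_T7 affine_action_W7 in blast)+

text \<open>
  The resulting homomorphism from \<open>SL\<^sub>2(7)\<close> to \<open>GL\<^sub>3(2)\<close>; its image acts on the seven nonzero
  vectors.
\<close>

definition linear_part :: "7 ^ 2 ^ 2 \<Rightarrow> 2 ^ 3 \<Rightarrow> 2 ^ 3" where
  "linear_part A = (SOME L. \<exists>t. affine_action A L t)"

lemma linear_part_eqI: "affine_action A L t \<Longrightarrow> linear_part A = L"
  unfolding linear_part_def by (rule some_equality) (use affine_action_unique in blast)+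

lemma affine_action_linear_part: "A \<in> carrier SL2_7 \<Longrightarrow> \<exists>t. affine_action A (linear_part A) t"
  using affine_action_exists linear_part_eqI by metis

lemma linear_part_add: "A \<in> carrier SL2_7 \<Longrightarrow> linear_part A (x + y) = linear_part A x + linear_part A y"
  using affine_action_linear_part[of A] unfolding affine_action_def by blast

lemma linear_part_mult:
  assumes "A \<in> carrier SL2_7" "B \<in> carrier SL2_7"
  shows "linear_part (A ** B) = linear_part A \<circ> linear_part B"
  using affine_action_linear_part[OF assms(1)]
    affine_action_linear_part[OF assms(2)] affine_action_mult[OF assms(2)] linear_part_eqI by metis

lemma linear_part_one: "linear_part (mat 1) = id" and linear_part_T7: "linear_part T7 = mat_T"
  and linear_part_W7: "linear_part W7 = mat_W"
  using linear_part_eqI affine_action_one affine_action_T7 affine_action_W7 by blast+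

lemma uminus_in_SL2_7: "A \<in> carrier SL2_7 \<Longrightarrow> - A \<in> carrier SL2_7"
  by (simp add: SL2_7_def det_2)

lemma linear_part_uminus:
  assumes "A \<in> carrier SL2_7"
  shows "linear_part (- A) = linear_part A"
proof -
  obtain t where "affine_action A (linear_part A) t" using affine_action_linear_part[OF assms] by blast
  moreover have "(- A) *v p = - (A *v p)" for p
    by (simp add: vec_eq_iff matrix_vector_mult_def sum_negf)
  ultimately have "affine_action (- A) (linear_part A) t"
    by (simp add: affine_action_def label_uminus)
  then show ?thesis by (rule linear_part_eqI)
qed

lemma linear_part_psl: "A \<in> carrier SL2_7 \<Longrightarrow> psl A = psl B \<Longrightarrow> linear_part A = linear_part B"
  using linear_part_uminus[of A] by (auto simp: psl_eq_iff dest: uminus_in_SL2_7)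

lemma linear_part_inv:
  assumes "A \<in> carrier SL2_7"
  shows "linear_part (inv\<^bsub>SL2_7\<^esub> A) (linear_part A v) = v"
    "linear_part A (linear_part (inv\<^bsub>SL2_7\<^esub> A) v) = v"
proof -
  have "linear_part (inv\<^bsub>SL2_7\<^esub> A) \<circ> linear_part A = id" "linear_part A \<circ> linear_part (inv\<^bsub>SL2_7\<^esub> A) = id"
    using linear_part_mult[of "inv\<^bsub>SL2_7\<^esub> A" A] linear_part_mult[of
      A "inv\<^bsub>SL2_7\<^esub> A"] assms SL.l_inv[OF assms] SL.r_inv[OF assms] linear_part_one
    by (simp_all add: SL2_7_mult SL2_7_one)
  then show "linear_part (inv\<^bsub>SL2_7\<^esub> A) (linear_part A v) = v"
    "linear_part A (linear_part (inv\<^bsub>SL2_7\<^esub> A) v) = v"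
    by (simp_all add: fun_eq_iff)
qed

lemma linear_part_T7_label: "linear_part T7 (label (vector [i, 1])) = label (vector [i + 1, 1])"
proof -
  have "vector [i, 1] \<noteq> (0 :: 7 ^ 2)" by (simp add: vec_eq_iff forall_2)
  from label_T7[OF this] show ?thesis by (simp add: linear_part_T7 M22_vec)
qed

text \<open>
  The nonzero vectors are the labels of the seven finite points, and \<open>T7\<close> permutes these in one
  cycle.
\<close>

lemma linear_part_T7_invariant:
  assumes "S \<noteq> {}" "0 \<notin> S" "linear_part T7 ` S \<subseteq> S"
  shows "S = - {0}"
proof -
  obtain v where "v \<in> S" using assms(1) by blast
  then obtain i where i: "label (vector [i, 1]) \<in> S" using assms(2) label_nonzero by metis
  have "label (vector [i + of_nat n, 1]) \<in> S" for n
  proof (induction n)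
    case (Suc n)
    then have "linear_part T7 (label (vector [i + of_nat n, 1])) \<in> S" using assms(3) by blast
    then show ?case by (simp add: linear_part_T7_label add_ac)
  qed (use i in simp)
  then have "label (vector [i + (j - i), 1]) \<in> S" for j
    using of_nat_surj_7[of "j - i"] by metis
  then have "label (vector [j, 1]) \<in> S" for j by simp
  then have "- {0} \<subseteq> S" using label_nonzero by blast
  then show ?thesis using assms(2) by blast
qed

lemma linear_part_faithful:
  assumes "A \<in> carrier SL2_7" "linear_part A = id"
  shows "A = mat 1 \<or> A = - mat 1"
proof (rule ccontr)
  assume A: "\<not> (A = mat 1 \<or> A = - mat 1)"
  define N where "N = {B \<in> carrier SL2_7. linear_part B = id}"
  have "subgroup N SL2_7"
  proof (rule SL.subgroupI)
    show "inv\<^bsub>SL2_7\<^esub> B \<in> N" if "B \<in> N" for B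
      using that linear_part_inv(1)[of B] by (simp add: N_def fun_eq_iff)
    show "B \<otimes>\<^bsub>SL2_7\<^esub> C \<in> N" if "B \<in> N" "C \<in> N" for B C
      using that SL.m_closed[of B C] by (simp add: N_def SL2_7_mult linear_part_mult)
  qed (use assms in \<open>auto simp: N_def\<close>)
  moreover have "C \<otimes>\<^bsub>SL2_7\<^esub> B \<otimes>\<^bsub>SL2_7\<^esub> inv\<^bsub>SL2_7\<^esub> C \<in> N" if "C \<in> carrier SL2_7" "B \<in> N" for C B
  proof -
    have "linear_part (C \<otimes>\<^bsub>SL2_7\<^esub> B \<otimes>\<^bsub>SL2_7\<^esub> inv\<^bsub>SL2_7\<^esub> C) = linear_part C \<circ> linear_part B
        \<circ> linear_part (inv\<^bsub>SL2_7\<^esub> C)"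
      using that linear_part_mult[of C B] linear_part_mult[of "C ** B"
        "inv\<^bsub>SL2_7\<^esub> C"] SL.m_closed[of C B] by (simp add: N_def SL2_7_mult)
    also have "\<dots> = id" using that linear_part_inv(2)[of C] by (simp add: N_def fun_eq_iff)
    finally show ?thesis using that by (simp add: N_def)
  qed
  ultimately have "N \<lhd> SL2_7" by (simp add: SL.normal_inv_iff)
  then have "N = carrier SL2_7" using SL2_7_normal_subgroup[of N A] assms A by (simp add: N_def)
  then have "linear_part T7 = id" using T7_W7_in_SL2_7 by (auto simp: N_def)
  then have "{label (vector [0, 1])} = - {0 :: 2 ^ 3}"
    by (intro linear_part_T7_invariant) (use label_affine_neq_zero[of 0] in auto)
  moreover have "label (vector [1, 1]) \<in> - {0 :: 2 ^ 3}" using label_affine_neq_zero by auto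
  ultimately show False using label_affine_inj[of 1 0] by auto
qed

section \<open>PSL(2,7) is not a quotient of the quadrangle group\<close>

lemma linear_part_square_one:
  assumes A: "A \<in> carrier SL2_7" and sq: "psl A \<otimes>\<^bsub>PSL2_7\<^esub> psl A = \<one>\<^bsub>PSL2_7\<^esub>"
  shows "linear_part A (linear_part A v) = v"
proof -
  have "psl (A ** A) = psl (mat 1)"
    using sq psl.hom_mult[OF A A] psl.hom_one by (simp add: SL2_7_mult SL2_7_one)
  then have "linear_part (A ** A) = linear_part (mat 1)"
    using linear_part_psl SL.m_closed[OF A A] by (simp add: SL2_7_mult)
  then show ?thesis by (simp add: linear_part_mult[OF A A] linear_part_one fun_eq_iff)
qed

text \<open>
  The generators of a quotient of the quadrangle group would preserve a proper nonempty set of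
  nonzero vectors, but \<open>PSL\<^sub>2(7)\<close> contains a seven-cycle on these vectors.
\<close>

theorem no_epi_quadrangle_PSL2_7:
  "epi (presented_group quad_relators) PSL2_7 = {}"
proof (rule ccontr)
  let ?Q = "presented_group quad_relators" and ?P = "PSL2_7"
  assume "epi ?Q ?P \<noteq> {}"
  then obtain h where h: "h \<in> epi ?Q ?P" by blast
  then have hom: "h \<in> hom ?Q ?P" by (simp add: epi_def)
  interpret Q: group ?Q by (rule group_presented_group)
  interpret h: group_hom ?Q ?P h using hom by unfold_locales
  define g where "g q = h (quad_class (gen q))" for q
  have g_cl: "g q \<in> carrier ?P" for q
    unfolding g_def by (rule h.hom_closed[OF word_class_closed])
  have rel: "word_eval ?P g r = \<one>\<^bsub>?P\<^esub>" if "r \<in> quad_relators" for r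
    using hom_presented_group_relator[OF group_PSL2_7 hom that] by (simp add: g_def[abs_def])
  have sq: "g q \<otimes>\<^bsub>?P\<^esub> g q = \<one>\<^bsub>?P\<^esub>" if "q \<noteq> QX4" for q
    using rel[of "gen q @ gen q"] that g_cl by (cases q) (auto simp: quad_relators_def)
  have cube: "g QX4 \<otimes>\<^bsub>?P\<^esub> (g QX4 \<otimes>\<^bsub>?P\<^esub> g QX4) = \<one>\<^bsub>?P\<^esub>"
    using rel[of "gen QX4 @ gen QX4 @ gen QX4"] g_cl by (simp add: quad_relators_def)
  have prod: "g QX1 \<otimes>\<^bsub>?P\<^esub> (g QX2 \<otimes>\<^bsub>?P\<^esub> (g QX3 \<otimes>\<^bsub>?P\<^esub> g QX4)) = \<one>\<^bsub>?P\<^esub>"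
    using rel[of "gen QX1 @ gen QX2 @ gen QX3 @ gen QX4"] g_cl by (simp add: quad_relators_def)
  have "\<exists>m. \<forall>q. m q \<in> carrier SL2_7 \<and> psl (m q) = g q"
  proof (rule choice, rule allI)
    show "\<exists>A. A \<in> carrier SL2_7 \<and> psl A = g q" for q
      using g_cl[of q] unfolding carrier_PSL2_7 by auto
  qed
  then obtain m where m: "\<And>q. m q \<in> carrier SL2_7" "\<And>q. psl (m q) = g q" by blast
  define f where "f q = linear_part (m q)" for q
  have inv: "f q (f q v) = v" if "q \<noteq> QX4" for q v
    unfolding f_def using sq[OF that] by (intro linear_part_square_one m) (simp add: m)
  have f_add: "f q (x + y) = f q x + f q y" for q x y
    unfolding f_def by (rule linear_part_add[OF m(1)])
  have ord: "f QX1 (f QX2 (f QX3 (f QX1 (f QX2 (f QX3 (f QX1 (f QX2 (f QX3 v)))))))) = v" for v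
  proof -
    define M where "M = m QX1 ** (m QX2 ** m QX3)"
    have M: "M \<in> carrier SL2_7"
      unfolding M_def using SL.m_closed m(1) by (simp add: SL2_7_mult[symmetric])
    have psl_M: "psl M = g QX1 \<otimes>\<^bsub>?P\<^esub> (g QX2 \<otimes>\<^bsub>?P\<^esub> g QX3)"
      unfolding M_def using m by (simp add: SL2_7_mult[symmetric])
    have "psl M \<otimes>\<^bsub>?P\<^esub> g QX4 = \<one>\<^bsub>?P\<^esub>"
      using prod g_cl by (simp add: psl_M psl.H.m_assoc)
    then have eq: "psl M = inv\<^bsub>?P\<^esub> g QX4"
      using g_cl psl.hom_closed[OF M] by (simp add: psl.H.inv_equality)
    have "inv\<^bsub>?P\<^esub> g QX4 \<otimes>\<^bsub>?P\<^esub> (inv\<^bsub>?P\<^esub> g QX4 \<otimes>\<^bsub>?P\<^esub> inv\<^bsub>?P\<^esub> g QX4)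
        = inv\<^bsub>?P\<^esub> (g QX4 \<otimes>\<^bsub>?P\<^esub> (g QX4 \<otimes>\<^bsub>?P\<^esub> g QX4))"
      using g_cl by (simp add: psl.H.inv_mult_group psl.H.m_assoc)
    then have "psl (M ** (M ** M)) = psl (mat 1)"
      using cube M psl.hom_one by (simp add: eq[symmetric] SL2_7_mult[symmetric] SL2_7_one[symmetric])
    then have "linear_part (M ** (M ** M)) = linear_part (mat 1)"
      using M by (intro linear_part_psl) (simp_all add: SL2_7_mult[symmetric])
    moreover have MM: "M ** M \<in> carrier SL2_7" using SL.m_closed[OF M M] by (simp add: SL2_7_mult)
    ultimately have "linear_part M (linear_part M (linear_part M v)) = v"
      by (simp add: linear_part_mult[OF M MM] linear_part_mult[OF M M] linear_part_one fun_eq_iff)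
    moreover have "m QX2 ** m QX3 \<in> carrier SL2_7" using SL.m_closed[OF m(1) m(1), of QX2 QX3]
      by (simp add: SL2_7_mult)
    then have "linear_part M = f QX1 \<circ> (f QX2 \<circ> f QX3)"
      unfolding M_def f_def by (simp add: linear_part_mult m(1))
    ultimately show ?thesis by simp
  qed
  have "\<exists>S. S \<noteq> {} \<and> 0 \<notin> S \<and> S \<noteq> - {0} \<and> f QX1 ` S \<subseteq> S \<and> f QX2 ` S \<subseteq> S \<and> f QX3 ` S \<subseteq> S"
  proof (rule three_involutions_intransitive)
    have "\<forall>x :: 2. x + x = 0" by (simp add: forall_F2)
    then show "x + x = 0" for x :: "2 ^ 3" by (simp add: vec_eq_iff)
    show "CARD(2 ^ 3) = 8" by simp
  qed (use f_add inv ord in simp_all)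
  then obtain S where S: "S \<noteq> {}" "0 \<notin> S" "S \<noteq> - {0}" "f QX1 ` S \<subseteq> S" "f QX2 ` S \<subseteq> S" "f QX3 ` S \<subseteq> S"
    by blast
  define Stab where "Stab = {psl M | M. M \<in> carrier SL2_7 \<and> linear_part M ` S = S}"
  have "subgroup Stab ?P"
  proof (rule psl.H.subgroupI)
    show "Stab \<subseteq> carrier ?P" by (auto simp: Stab_def)
    show "Stab \<noteq> {}"
      unfolding Stab_def using SL.one_closed linear_part_one
        by (auto simp: SL2_7_one intro!: exI[of _ "mat 1"])
    show "inv\<^bsub>?P\<^esub> x \<in> Stab" if "x \<in> Stab" for x
    proof -
      obtain M where M: "x = psl M" "M \<in> carrier SL2_7" "linear_part M ` S = S"
        using \<open>x \<in> Stab\<close> unfolding Stab_def by blast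
      have "linear_part (inv\<^bsub>SL2_7\<^esub> M) ` (linear_part M ` S) = S"
        unfolding image_image using linear_part_inv(1)[OF M(2)] by simp
      then have "linear_part (inv\<^bsub>SL2_7\<^esub> M) ` S = S" by (simp only: M(3))
      moreover have "inv\<^bsub>?P\<^esub> x = psl (inv\<^bsub>SL2_7\<^esub> M)" using M by simp
      ultimately show ?thesis unfolding Stab_def using SL.inv_closed[OF M(2)] by blast
    qed
    show "x \<otimes>\<^bsub>?P\<^esub> y \<in> Stab" if "x \<in> Stab" "y \<in> Stab" for x y
    proof -
      obtain M M' where M: "x = psl M" "M \<in> carrier SL2_7" "linear_part M ` S = S"
        "y = psl M'" "M' \<in> carrier SL2_7" "linear_part M' ` S = S"
        using \<open>x \<in> Stab\<close> \<open>y \<in> Stab\<close> unfolding Stab_def by blast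
      have "linear_part (M ** M') ` S = S"
        unfolding linear_part_mult[OF M(2,5)] image_comp[symmetric] M(3,6) ..
      moreover have "x \<otimes>\<^bsub>?P\<^esub> y = psl (M ** M')" using M by (simp add: SL2_7_mult[symmetric])
      moreover have "M ** M' \<in> carrier SL2_7" using SL.m_closed[OF M(2,5)] by (simp add: SL2_7_mult)
      ultimately show ?thesis unfolding Stab_def by blast
    qed
  qed
  have invols: "g q \<in> Stab" if "q \<noteq> QX4" for q
  proof -
    have sub: "f q ` S \<subseteq> S" using S that by (cases q) auto
    have "S \<subseteq> f q ` S"
    proof
      fix v assume "v \<in> S"
      then show "v \<in> f q ` S" using sub inv[OF that, of v] by (metis image_eqI image_subset_iff)
    qed
    with sub have "linear_part (m q) ` S = S" by (simp add: f_def)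
    then show ?thesis unfolding Stab_def using m by blast
  qed
  have "g QX4 \<in> Stab"
  proof -
    have "(g QX1 \<otimes>\<^bsub>?P\<^esub> (g QX2 \<otimes>\<^bsub>?P\<^esub> g QX3)) \<otimes>\<^bsub>?P\<^esub> g QX4 = \<one>\<^bsub>?P\<^esub>"
      using prod g_cl by (simp add: psl.H.m_assoc)
    then have "g QX4 = inv\<^bsub>?P\<^esub> (g QX1 \<otimes>\<^bsub>?P\<^esub> (g QX2 \<otimes>\<^bsub>?P\<^esub> g QX3))"
      using g_cl by (metis psl.H.inv_equality psl.H.inv_inv psl.H.m_closed)
    then show ?thesis
      using \<open>subgroup Stab ?P\<close> invols by (simp add: subgroup.m_closed subgroup.m_inv_closed)
  qed
  then have "range g \<subseteq> Stab" using invols by (metis image_subsetI)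
  then have "carrier ?P \<subseteq> Stab"
    using epi_presented_group_generate[OF
      group_PSL2_7 h] psl.H.generate_subgroup_incl[OF _ \<open>subgroup Stab ?P\<close>]
    by (simp add: g_def[abs_def])
  then have "psl T7 \<in> Stab" using psl.hom_closed T7_W7_in_SL2_7 by blast
  then obtain M where "psl T7 = psl M" "linear_part M ` S = S" unfolding Stab_def by blast
  then have "linear_part T7 ` S \<subseteq> S" using linear_part_psl[OF T7_W7_in_SL2_7(1)] by simp
  then show False using linear_part_T7_invariant S by blast
qed

section \<open>The subgroup of index seven\<close>

text \<open>
  The generators \<open>x\<close> and \<open>z\<close> of the triangle group suffice, because \<open>y = (z x)\<^sup>-\<^sup>1\<close>.
\<close>

locale hurwitz_generators = group G for G (structure) +
  fixes x z :: 'a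
  assumes x_closed [simp]: "x \<in> carrier G" and z_closed [simp]: "z \<in> carrier G"
    and x_sq: "x \<otimes> x = \<one>"
    and zx_cube: "z \<otimes> (x \<otimes> (z \<otimes> (x \<otimes> (z \<otimes> x)))) = \<one>"
    and z_seven: "z [^] (7::nat) = \<one>"
    and gen: "carrier G = generate G {x, z}"
begin

lemma x_cancel: "u \<in> carrier G \<Longrightarrow> x \<otimes> (x \<otimes> u) = u"
  by (simp add: m_assoc[symmetric] x_sq)

lemma inv_x: "inv x = x"
  by (rule inv_equality) (simp_all add: x_sq)

lemma z_seven_cancel: "u \<in> carrier G \<Longrightarrow> z \<otimes> (z \<otimes> (z \<otimes> (z \<otimes> (z \<otimes> (z \<otimes> (z \<otimes> u)))))) = u"
  using z_seven by (simp add: numeral_eq_Suc m_assoc[symmetric])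

text \<open>
  The relation \<open>(z x)\<^sup>3 = 1\<close> as a rewrite rule that decreases the number of occurrences of \<open>x\<close>.
\<close>

lemma braid: "x \<otimes> (z \<otimes> x) = inv z \<otimes> (x \<otimes> inv z)"
proof -
  have "(z \<otimes> (x \<otimes> (z \<otimes> x))) \<otimes> (z \<otimes> x) = \<one>"
    using zx_cube by (simp add: m_assoc)
  then have "inv (z \<otimes> x) = z \<otimes> (x \<otimes> (z \<otimes> x))"
    by (intro inv_equality) auto
  then have "inv z \<otimes> (z \<otimes> (x \<otimes> (z \<otimes> x))) = inv z \<otimes> (x \<otimes> inv z)"
    by (simp add: inv_mult_group inv_x)
  then show ?thesis by simp
qed

lemma braid_inv: "x \<otimes> (inv z \<otimes> x) = z \<otimes> (x \<otimes> z)"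
proof -
  have "inv (x \<otimes> (z \<otimes> x)) = inv (inv z \<otimes> (x \<otimes> inv z))"
    by (simp only: braid)
  then show ?thesis by (simp add: inv_mult_group inv_x m_assoc)
qed

lemma braid_left: "u \<in> carrier G \<Longrightarrow> x \<otimes> (z \<otimes> (x \<otimes> u)) = inv z \<otimes> (x \<otimes> (inv z \<otimes> u))"
  using arg_cong[OF braid, of "\<lambda>t. t \<otimes> u"] by (simp add: m_assoc)

lemma braid_inv_left: "u \<in> carrier G \<Longrightarrow> x \<otimes> (inv z \<otimes> (x \<otimes> u)) = z \<otimes> (x \<otimes> (z \<otimes> u))"
  using arg_cong[OF braid_inv, of "\<lambda>t. t \<otimes> u"] by (simp add: m_assoc)

lemmas generator_rewrites =
  numeral_eq_Suc m_assoc inv_mult_group inv_x x_sq x_cancel braid braid_inv braid_left braid_inv_left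

text \<open>
  In the action on seven points where \<open>z\<close> adds one modulo 7 and \<open>x\<close> acts by the permutation \<open>\<sigma>\<close>
  below, \<open>x\<close> fixes the points 4, 5 and 0, which yields three involutions in the stabiliser of 0,
  and \<open>z x\<close> fixes the point 2, which yields an element of order three.
\<close>

primrec quad_image :: "quad_gen \<Rightarrow> 'a" where
  "quad_image QX1 = inv (z [^] (4::nat)) \<otimes> x \<otimes> z [^] (4::nat)"
| "quad_image QX2 = inv (z [^] (5::nat)) \<otimes> x \<otimes> z [^] (5::nat)"
| "quad_image QX3 = x"
| "quad_image QX4 = inv z \<otimes> x \<otimes> z [^] (2::nat)"

lemma quad_image_closed: "quad_image q \<in> carrier G"
  by (cases q) simp_all

lemma quad_image_relators:
  assumes "r \<in> quad_relators"
  shows "word_eval G quad_image r = \<one>"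
  using assms z_seven_cancel by (auto simp: quad_relators_def generator_rewrites)

abbreviation H :: "'a set" where "H \<equiv> generate G (range quad_image)"

lemma H_subgroup: "subgroup H G"
  using quad_image_closed by (intro generate_is_subgroup) auto

lemma H_all_if: "z \<in> H \<Longrightarrow> carrier G \<subseteq> H"
  using generate_subgroup_incl[OF _ H_subgroup, of "{x, z}"] generate.incl[of x "range quad_image" G]
  unfolding gen by (metis empty_subsetI insert_subset quad_image.simps(3) rangeI)

text \<open>
  The permutation induced by the involution \<open>W7\<close> on the seven nonzero vectors, which are numbered
  such that \<open>T7\<close> adds one modulo 7.
\<close>

definition \<sigma> :: "nat \<Rightarrow> nat" where
  "\<sigma> i = [0, 2, 1, 6, 4, 5, 3] ! i"

text \<open>
  These are the Schreier generators of \<open>H\<close> for the transversal consisting of the powers of \<open>z\<close>;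
  the inclusions say that \<open>x z\<^sup>i H = z\<^sup>j H\<close> for \<open>j = \<sigma> i\<close>. The relations of the triangle group
  express all of them by the four generators of \<open>H\<close>.
\<close>

lemma schreier_generator_in_H:
  assumes "i < 7"
  shows "inv (z [^] \<sigma> i) \<otimes> x \<otimes> z [^] i \<in> H"
proof -
  have q: "quad_image q \<in> H" for q by (rule generate.incl) simp
  note mult = subgroup.m_closed[OF H_subgroup] and inv = subgroup.m_inv_closed[OF H_subgroup]
  have s6: "inv (z [^] (3::nat)) \<otimes> x \<otimes> z [^] (6::nat) \<in> H"
  proof -
    have "quad_image QX1 \<otimes> quad_image QX2 = inv (z [^] (3::nat)) \<otimes> x \<otimes> z [^] (6::nat)"
      by (simp add: generator_rewrites)
    then show ?thesis using mult[OF q q, of QX1 QX2] by simp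
  qed
  have s3: "inv (z [^] (6::nat)) \<otimes> x \<otimes> z [^] (3::nat) \<in> H"
    using inv[OF s6] by (simp add: inv_mult_group inv_x m_assoc)
  have s1: "inv (z [^] (2::nat)) \<otimes> x \<otimes> z \<in> H"
    using inv[OF q[of QX4]] by (simp add: inv_mult_group inv_x m_assoc)
  from assms consider "i = 0" | "i = 1" | "i = 2" | "i = 3" | "i = 4" | "i = 5" | "i = 6" by linarith
  then show ?thesis
    using q[of QX1] q[of QX2] q[of QX3] q[of QX4] s1 s3 s6
    by cases (simp_all add: \<sigma>_def)
qed

end

section \<open>The action on the seven cosets\<close>

lemma of_nat_7_eq_iff: "(of_nat i :: 7) = of_nat j \<longleftrightarrow> i mod 7 = j mod 7"
proof -
  have red: "(of_nat n :: 7) = of_nat (n mod 7)" for n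
  proof -
    have "(of_nat n :: 7) = of_nat (7 * (n div 7) + n mod 7)" by simp
    also have "\<dots> = 7 * of_nat (n div 7) + of_nat (n mod 7)"
      by (simp only: of_nat_add of_nat_mult of_nat_numeral)
    also have "(7 :: 7) = 0" by simp
    finally show ?thesis by simp
  qed
  have "i' = j'" if "(of_nat i' :: 7) = of_nat j'" "i' < 7" "j' < 7" for i' j'
  proof -
    have "i' \<in> {0, 1, 2, 3, 4, 5, 6}" "j' \<in> {0, 1, 2, 3, 4, 5, 6}" using that(2,3) by auto
    with that(1) show ?thesis by auto
  qed
  then show ?thesis using red[of i] red[of j] by (metis mod_less_divisor zero_less_numeral)
qed

definition point :: "nat \<Rightarrow> 2 ^ 3" where
  "point i = label (vector [of_nat i, 1])"

lemma point_eq_iff: "point i = point j \<longleftrightarrow> i mod 7 = j mod 7"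
  by (simp add: point_def label_affine_inj of_nat_7_eq_iff)

lemma nonzero_point: "v \<noteq> 0 \<Longrightarrow> \<exists>i. v = point i"
  using label_nonzero of_nat_surj_7 unfolding point_def by metis

lemma point_nonzero: "point i \<noteq> 0"
  by (simp add: point_def label_affine_neq_zero)

lemma linear_part_zero: "A \<in> carrier SL2_7 \<Longrightarrow> linear_part A 0 = 0"
  using linear_part_add[of A 0 0] by simp

context hurwitz_generators
begin

lemma linear_part_W7_point: "i < 7 \<Longrightarrow> linear_part W7 (point i) = point (\<sigma> i)"
proof -
  assume "i < 7"
  then consider "i = 0" | "i = 1" | "i = 2" | "i = 3" | "i = 4" | "i = 5" | "i = 6" by linarith
  then show ?thesis
    by cases (simp_all
      add: \<sigma>_def linear_part_W7 mat_W_def point_def label_def residue_bit_def vec_eq_iff forall_3)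
qed

lemma z_pow_mod: "z [^] i = z [^] (i mod 7 :: nat)"
proof -
  have "z [^] i = z [^] (7 * (i div 7) + i mod 7)" by simp
  also have "\<dots> = (z [^] (7::nat)) [^] (i div 7) \<otimes> z [^] (i mod 7)"
    by (simp only: nat_pow_mult nat_pow_pow z_closed nat_pow_closed)
  finally show ?thesis by (simp add: z_seven)
qed

text \<open>
  The element \<open>g\<close> moves the cosets \<open>z\<^sup>i H\<close> in the same way as \<open>A\<close> moves the nonzero vectors.
\<close>

definition compatible :: "'a \<Rightarrow> 7 ^ 2 ^ 2 \<Rightarrow> bool" where
  "compatible g A \<longleftrightarrow> (\<forall>i::nat. \<exists>j::nat. inv (z [^] j) \<otimes> g \<otimes> z [^] i \<in> H \<and> linear_part A (point i) = point j)"

lemma compatible_one: "compatible \<one> (mat 1)"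
  unfolding compatible_def
  by (rule allI,
    rule_tac x = i in exI) (use subgroup.one_closed[OF H_subgroup] in \<open>simp add: linear_part_one\<close>)

lemma compatible_z: "compatible z T7"
  unfolding compatible_def
proof
  fix i :: nat
  have "inv (z [^] Suc i) \<otimes> z \<otimes> z [^] i = \<one>"
    using nat_pow_Suc2[of z i] by (simp add: m_assoc)
  then have "inv (z [^] Suc i) \<otimes> z \<otimes> z [^] i \<in> H"
    using subgroup.one_closed[OF H_subgroup] by simp
  moreover have "linear_part T7 (point i) = point (Suc i)"
    by (simp add: point_def linear_part_T7_label add.commute)
  ultimately show "\<exists>j::nat. inv (z [^] j) \<otimes> z \<otimes> z [^] i \<in> H \<and> linear_part T7 (point i) = point j" by blast
qed

lemma compatible_x: "compatible x W7"
  unfolding compatible_def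
proof
  fix i :: nat
  have "inv (z [^] \<sigma> (i mod 7)) \<otimes> x \<otimes> z [^] (i mod 7) \<in> H"
    by (rule schreier_generator_in_H) simp
  moreover have "point i = point (i mod 7)" by (simp add: point_eq_iff)
  then have "linear_part W7 (point i) = point (\<sigma> (i mod 7))" by (simp add: linear_part_W7_point)
  ultimately show "\<exists>j::nat. inv (z [^] j) \<otimes> x \<otimes> z [^] i \<in> H \<and> linear_part W7 (point i) = point j"
    using z_pow_mod by metis
qed

lemma compatible_mult:
  assumes "g \<in> carrier G" "h \<in> carrier G" "A \<in> carrier SL2_7" "B \<in> carrier SL2_7"
    and "compatible g A" "compatible h B"
  shows "compatible (g \<otimes> h) (A ** B)"
  unfolding compatible_def
proof
  fix i :: nat
  obtain j :: nat where j: "inv (z [^] j) \<otimes> h \<otimes> z [^] i \<in> H" "linear_part B (point i) = point j"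
    using assms(6) unfolding compatible_def by blast
  obtain k :: nat where k: "inv (z [^] k) \<otimes> g \<otimes> z [^] j \<in> H" "linear_part A (point j) = point k"
    using assms(5) unfolding compatible_def by blast
  have "(inv (z [^] k) \<otimes> g \<otimes> z [^] j) \<otimes> (inv (z [^] j) \<otimes> h \<otimes> z [^] i) = inv (z [^] k) \<otimes> (g \<otimes> h) \<otimes> z [^] i"
    using assms by (simp add: m_assoc)
  then have "inv (z [^] k) \<otimes> (g \<otimes> h) \<otimes> z [^] i \<in> H"
    using subgroup.m_closed[OF H_subgroup k(1) j(1)] by simp
  moreover have "linear_part (A ** B) (point i) = point k"
    using assms j k by (simp add: linear_part_mult)
  ultimately show "\<exists>j::nat. inv (z [^] j) \<otimes> (g \<otimes> h) \<otimes> z [^] i \<in> H \<and> linear_part (A ** B) (point i)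
      = point j" by blast
qed

lemma compatible_inv:
  assumes "g \<in> carrier G" "A \<in> carrier SL2_7" "compatible g A"
  shows "compatible (inv g) (inv\<^bsub>SL2_7\<^esub> A)"
  unfolding compatible_def
proof
  fix j :: nat
  have "linear_part (inv\<^bsub>SL2_7\<^esub> A) (point j) \<noteq> 0"
    using linear_part_inv(2)[OF assms(2), of "point j"] linear_part_zero[OF assms(2)] point_nonzero by metis
  then obtain i where i: "linear_part (inv\<^bsub>SL2_7\<^esub> A) (point j) = point i" using nonzero_point by blast
  obtain k :: nat where k: "inv (z [^] k) \<otimes> g \<otimes> z [^] i \<in> H" "linear_part A (point i) = point k"
    using assms(3) unfolding compatible_def by blast
  have "point k = point j" using linear_part_inv(2)[OF assms(2), of "point j"] i k(2) by simp
  then have "z [^] k = z [^] j" using z_pow_mod point_eq_iff by metis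
  then have "inv (inv (z [^] j) \<otimes> g \<otimes> z [^] i) \<in> H"
    using subgroup.m_inv_closed[OF H_subgroup k(1)] by simp
  then have "inv (z [^] i) \<otimes> inv g \<otimes> z [^] j \<in> H"
    using assms(1) by (simp add: inv_mult_group m_assoc)
  then show "\<exists>i::nat. inv (z [^] i) \<otimes> inv g \<otimes> z [^] j \<in> H \<and> linear_part (inv\<^bsub>SL2_7\<^esub> A) (point j) = point i"
    using i by blast
qed

lemma compatible_exists:
  assumes "g \<in> carrier G"
  shows "\<exists>A\<in>carrier SL2_7. compatible g A"
proof -
  let ?S = "{g \<in> carrier G. \<exists>A\<in>carrier SL2_7. compatible g A}"
  have mult: "g \<otimes> h \<in> ?S" if "g \<in> ?S" "h \<in> carrier G" "A \<in> carrier SL2_7" "compatible h A" for g h A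
  proof -
    obtain B where B: "g \<in> carrier G" "B \<in> carrier SL2_7" "compatible g B" using \<open>g \<in> ?S\<close> by blast
    have "compatible (g \<otimes> h) (B ** A)" using B that(2-4) by (intro compatible_mult)
    moreover have "B ** A \<in> carrier SL2_7" using SL.m_closed[OF B(2) that(3)] by (simp add: SL2_7_mult)
    ultimately show ?thesis using B(1) that(2) by blast
  qed
  have "generate G {x, z} \<subseteq> ?S"
  proof (rule generate_subset_rightI)
    show "\<one> \<in> ?S" using compatible_one SL.one_closed by (auto simp: SL2_7_one)
    show "g \<otimes> h \<in> ?S" if "g \<in> ?S" "h \<in> {x, z}" for g h
      using mult[OF that(1)] that(2) compatible_x compatible_z T7_W7_in_SL2_7
        by (elim insertE) (simp_all only: x_closed z_closed empty_iff)
    show "g \<otimes> inv h \<in> ?S" if "g \<in> ?S" "h \<in> {x, z}" for g h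
    proof -
      obtain A where "A \<in> carrier SL2_7" "compatible h A" "h \<in> carrier G"
        using \<open>h \<in> {x, z}\<close> compatible_x compatible_z T7_W7_in_SL2_7 by auto
      then show ?thesis
        using mult[OF that(1), of "inv h" "inv\<^bsub>SL2_7\<^esub> A"] compatible_inv by simp
    qed
  qed auto
  then show ?thesis using assms gen by blast
qed

text \<open>
  A power of \<open>z\<close> with exponent prime to 7 has \<open>z\<close> itself as a power.
\<close>

lemma z_pow_in_H:
  assumes "z \<notin> H" "inv (z [^] i) \<otimes> z [^] j \<in> H"
  shows "i mod 7 = (j::nat) mod 7"
proof -
  have "z [^] (6 * i) \<otimes> z [^] i = \<one>"
    using z_pow_mod[of "7 * i"] by (simp add: nat_pow_mult)
  then have "inv (z [^] i) = z [^] (6 * i)" by (intro inv_equality) auto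
  then have m: "z [^] (6 * i + j) \<in> H" using assms(2) by (simp add: nat_pow_mult)
  have "(6 * i + j) mod 7 = 0"
  proof (rule ccontr)
    assume "(6 * i + j) mod 7 \<noteq> 0"
    then have "(6 * i + j) mod 7 \<in> {1, 2, 3, 4, 5, 6}" by auto
    then have "\<exists>t\<in>{1, 4, 5, 2, 3, 6}. (6 * i + j) mod 7 * t mod 7 = 1" by auto
    then obtain t where "(6 * i + j) * t mod 7 = 1" unfolding mod_mult_left_eq by blast
    then have "z [^] ((6 * i + j) * t) = z [^] (1::nat)"
      using z_pow_mod[of "(6 * i + j) * t"] by simp
    then have "z = (z [^] (6 * i + j)) [^] t" by (simp add: nat_pow_pow)
    then have "z \<in> H"
      using subgroup_int_pow_closed[OF H_subgroup m, of "int t"] by (simp add: int_pow_int)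
    then show False using assms(1) by blast
  qed
  then show ?thesis by presburger
qed

text \<open>
  If \<open>z \<notin> H\<close>, the seven cosets are distinct, so \<open>g\<close> determines the permutation, and the
  permutation determines \<open>A\<close> up to sign.
\<close>

lemma compatible_unique:
  assumes "z \<notin> H" "g \<in> carrier G" "A \<in> carrier SL2_7" "B \<in> carrier SL2_7" "compatible g A" "compatible g B"
  shows "psl A = psl B"
proof -
  have "linear_part A (point i) = linear_part B (point i)" for i
  proof -
    obtain j :: nat where j: "inv (z [^] j) \<otimes> g \<otimes> z [^] i \<in> H" "linear_part A (point i) = point j"
      using assms(5) unfolding compatible_def by blast
    obtain k :: nat where k: "inv (z [^] k) \<otimes> g \<otimes> z [^] i \<in> H" "linear_part B (point i) = point k"
      using assms(6) unfolding compatible_def by blast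
    have "(inv (z [^] j) \<otimes> g \<otimes> z [^] i) \<otimes> inv (inv (z [^] k) \<otimes> g \<otimes> z [^] i) = inv (z [^] j) \<otimes> z [^] k"
      using assms(2) by (simp add: inv_mult_group m_assoc)
    then have "inv (z [^] j) \<otimes> z [^] k \<in> H"
      using subgroup.m_closed[OF H_subgroup j(1) subgroup.m_inv_closed[OF H_subgroup k(1)]] by simp
    then show ?thesis using z_pow_in_H[OF assms(1)] j(2) k(2) point_eq_iff by metis
  qed
  then have eq: "linear_part A = linear_part B"
    using nonzero_point linear_part_zero assms(3,4) by (metis ext)
  have "linear_part (inv\<^bsub>SL2_7\<^esub> B ** A) = id"
    using assms(3,4) linear_part_inv(1)[OF assms(4)] by (simp add: linear_part_mult eq fun_eq_iff)
  then have *: "inv\<^bsub>SL2_7\<^esub> B ** A = mat 1 \<or> inv\<^bsub>SL2_7\<^esub> B ** A = - mat 1"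
    using SL.m_closed[of "inv\<^bsub>SL2_7\<^esub> B" A] assms(3,4)
      by (intro linear_part_faithful) (simp_all add: SL2_7_mult)
  then have "psl (inv\<^bsub>SL2_7\<^esub> B ** A) = \<one>\<^bsub>PSL2_7\<^esub>" by (simp only: psl_eq_one_iff)
  then have "inv\<^bsub>PSL2_7\<^esub> psl B \<otimes>\<^bsub>PSL2_7\<^esub> psl A = \<one>\<^bsub>PSL2_7\<^esub>"
    using assms(3,4) by (simp add: SL2_7_mult[symmetric])
  then show ?thesis
    using assms(3,4) by (metis psl.H.inv_closed psl.H.inv_equality psl.H.inv_inv psl.hom_closed)
qed

text \<open>
  Compatibility is a subgroup of the product of \<open>G\<close> and \<open>SL\<^sub>2(7)\<close> that projects onto both factors.
  If \<open>z \<notin> H\<close>, it determines the second component up to sign and thus defines a homomorphism from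
  \<open>G\<close> onto \<open>PSL\<^sub>2(7)\<close>.
\<close>

theorem generates_or_surjects_PSL2_7: "carrier G \<subseteq> H \<or> surjects_onto G PSL2_7"
proof (cases "z \<in> H")
  case True
  then show ?thesis using H_all_if by blast
next
  case False
  define m where "m g = (SOME A. A \<in> carrier SL2_7 \<and> compatible g A)" for g
  have m: "m g \<in> carrier SL2_7" "compatible g (m g)" if "g \<in> carrier G" for g
    using someI_ex[of "\<lambda>A. A \<in> carrier SL2_7 \<and> compatible g A"] compatible_exists[OF that]
      unfolding m_def by blast+
  have hom: "psl (m (g \<otimes> h)) = psl (m g) \<otimes>\<^bsub>PSL2_7\<^esub> psl (m h)" if gh: "g \<in> carrier G" "h \<in> carrier G" for g h
  proof -
    have "m g ** m h \<in> carrier SL2_7"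
      using SL.m_closed[OF m(1) m(1)] gh by (simp add: SL2_7_mult)
    then have "psl (m (g \<otimes> h)) = psl (m g ** m h)"
      using gh m by (intro compatible_unique[OF False, of "g \<otimes> h"] compatible_mult) auto
    then show ?thesis using gh m by (simp add: SL2_7_mult[symmetric])
  qed
  have onto: "\<exists>g\<in>carrier G. compatible g A" if "A \<in> carrier SL2_7" for A
    using that
  proof (rule SL2_7_induct)
    show "\<exists>g\<in>carrier G. compatible g (mat 1)" using compatible_one by blast
    show "\<exists>g\<in>carrier G. compatible g (T7 ** B)" if B: "B \<in> carrier SL2_7"
      "\<exists>g\<in>carrier G. compatible g B" for B
      using B compatible_mult[OF z_closed _ T7_W7_in_SL2_7(1) B(1) compatible_z] z_closed m_closed by blast
    show "\<exists>g\<in>carrier G. compatible g (W7 ** B)" if B: "B \<in> carrier SL2_7"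
      "\<exists>g\<in>carrier G. compatible g B" for B
      using B compatible_mult[OF x_closed _ T7_W7_in_SL2_7(2) B(1) compatible_x] x_closed m_closed by blast
  qed
  have "(\<lambda>g. psl (m g)) ` carrier G = carrier PSL2_7"
  proof
    show "(\<lambda>g. psl (m g)) ` carrier G \<subseteq> carrier PSL2_7" using m by auto
    show "carrier PSL2_7 \<subseteq> (\<lambda>g. psl (m g)) ` carrier G"
    proof
      fix P assume "P \<in> carrier PSL2_7"
      then obtain A where A: "P = psl A" "A \<in> carrier SL2_7" unfolding carrier_PSL2_7 by blast
      then obtain g where g: "g \<in> carrier G" "compatible g A" using onto by blast
      have "P = psl (m g)"
        unfolding A by (rule compatible_unique[OF False g(1) A(2) m(1)[OF g(1)] g(2) m(2)[OF g(1)]])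
      then show "P \<in> (\<lambda>g. psl (m g)) ` carrier G" using g(1) by blast
    qed
  qed
  then have "(\<lambda>g. psl (m g)) \<in> epi G PSL2_7"
    using hom m by (auto simp: epi_def hom_def)
  then show ?thesis unfolding surjects_onto_def by blast
qed

end

text \<open>
  The orders 2, 3 and 7 are pairwise coprime, so the triviality of one generator would make all of
  them trivial.
\<close>

lemma hurwitz_group_generators:
  assumes "hurwitz_group G"
  obtains x z where "hurwitz_generators G x z" "x \<noteq> \<one>\<^bsub>G\<^esub>" "x \<otimes>\<^bsub>G\<^esub> z \<noteq> \<one>\<^bsub>G\<^esub>"
proof -
  interpret group G using assms by (simp add: hurwitz_group_def)
  obtain h where h: "h \<in> epi (presented_group tri_relators) G"
    using assms by (auto simp: hurwitz_group_def triangle_group_eq)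
  then have hom: "h \<in> hom (presented_group tri_relators) G" by (simp add: epi_def)
  define g where "g t = h (word_class tri_relators (gen t))" for t
  have g_cl [simp]: "g t \<in> carrier G" for t
    unfolding g_def using hom word_class_closed by (auto simp: hom_def)
  have rel: "word_eval G g r = \<one>\<^bsub>G\<^esub>" if "r \<in> tri_relators" for r
    using hom_presented_group_relator[OF group_axioms hom that] by (simp add: g_def[abs_def])
  define x y z where "x = g TX" and "y = g TY" and "z = g TZ"
  have cl [simp]: "x \<in> carrier G" "y \<in> carrier G" "z \<in> carrier G" by (simp_all add: x_def y_def z_def)
  have xx: "x \<otimes>\<^bsub>G\<^esub> x = \<one>\<^bsub>G\<^esub>" and yyy: "y \<otimes>\<^bsub>G\<^esub> (y \<otimes>\<^bsub>G\<^esub> y) = \<one>\<^bsub>G\<^esub>"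
    and z7: "z [^]\<^bsub>G\<^esub> (7::nat) = \<one>\<^bsub>G\<^esub>" and xyz: "x \<otimes>\<^bsub>G\<^esub> (y \<otimes>\<^bsub>G\<^esub> z) = \<one>\<^bsub>G\<^esub>"
    using rel[of "gen TX @ gen TX"] rel[of "gen TY @ gen TY @ gen TY"]
      rel[of "gen TZ @ gen TZ @ gen TZ @ gen TZ @ gen TZ @ gen TZ @ gen TZ"]
        rel[of "gen TX @ gen TY @ gen TZ"]
    by (simp_all add: tri_relators_def x_def y_def z_def numeral_eq_Suc m_assoc)
  have y: "y = inv\<^bsub>G\<^esub> (z \<otimes>\<^bsub>G\<^esub> x)"
  proof -
    have "inv\<^bsub>G\<^esub> x = y \<otimes>\<^bsub>G\<^esub> z" using xyz by (metis cl inv_equality inv_inv m_closed)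
    moreover have "inv\<^bsub>G\<^esub> x = x" using xx by (simp add: inv_equality)
    ultimately have "y \<otimes>\<^bsub>G\<^esub> (z \<otimes>\<^bsub>G\<^esub> x) = \<one>\<^bsub>G\<^esub>" using xx by (simp add: m_assoc[symmetric])
    then show ?thesis by (simp add: inv_equality)
  qed
  have cube: "z \<otimes>\<^bsub>G\<^esub> (x \<otimes>\<^bsub>G\<^esub> (z \<otimes>\<^bsub>G\<^esub> (x \<otimes>\<^bsub>G\<^esub> (z \<otimes>\<^bsub>G\<^esub> x)))) = \<one>\<^bsub>G\<^esub>"
  proof -
    have "inv\<^bsub>G\<^esub> y = z \<otimes>\<^bsub>G\<^esub> x" by (simp add: y)
    moreover have "inv\<^bsub>G\<^esub> (y \<otimes>\<^bsub>G\<^esub> (y \<otimes>\<^bsub>G\<^esub> y)) = \<one>\<^bsub>G\<^esub>" by (simp add: yyy)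
    ultimately show ?thesis by (simp add: inv_mult_group m_assoc)
  qed
  have gen: "carrier G = generate G {x, z}"
  proof
    have "range g \<subseteq> generate G {x, z}"
    proof -
      have "x \<in> generate G {x, z}" "z \<in> generate G {x, z}" by (auto intro: generate.incl)
      moreover from this have "y \<in> generate G {x, z}"
        unfolding y by (intro subgroup.m_inv_closed[OF generate_is_subgroup] generate.eng) auto
      ultimately have "g t \<in> generate G {x, z}" for t
        by (cases t) (simp_all add: x_def y_def z_def)
      then show ?thesis by blast
    qed
    then have "generate G (range g) \<subseteq> generate G {x, z}"
      by (intro generate_subgroup_incl generate_is_subgroup) auto
    then show "carrier G \<subseteq> generate G {x, z}"
      using epi_presented_group_generate[OF group_axioms h] by (simp add: g_def[abs_def])
  qed (simp add: generate_incl)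
  have gens: "hurwitz_generators G x z"
    by (intro hurwitz_generators.intro group_axioms hurwitz_generators_axioms.intro cl xx cube z7 gen)
  have nontriv: "z \<noteq> \<one>\<^bsub>G\<^esub> \<or> x \<noteq> \<one>\<^bsub>G\<^esub>"
  proof (rule ccontr)
    assume "\<not> (z \<noteq> \<one>\<^bsub>G\<^esub> \<or> x \<noteq> \<one>\<^bsub>G\<^esub>)"
    then have "carrier G = generate G {\<one>\<^bsub>G\<^esub>}" using gen by simp
    then have "carrier G = {\<one>\<^bsub>G\<^esub>}" using generate_one by simp
    then show False using assms by (simp add: hurwitz_group_def trivial_group_def)
  qed
  have "x \<noteq> \<one>\<^bsub>G\<^esub>"
  proof
    assume x1: "x = \<one>\<^bsub>G\<^esub>"
    then have z3: "z \<otimes>\<^bsub>G\<^esub> (z \<otimes>\<^bsub>G\<^esub> z) = \<one>\<^bsub>G\<^esub>" using cube by simp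
    have "z [^]\<^bsub>G\<^esub> (7::nat) = (z \<otimes>\<^bsub>G\<^esub> (z \<otimes>\<^bsub>G\<^esub> z)) \<otimes>\<^bsub>G\<^esub> (z \<otimes>\<^bsub>G\<^esub> (z \<otimes>\<^bsub>G\<^esub> z)) \<otimes>\<^bsub>G\<^esub> z"
      by (simp add: numeral_eq_Suc m_assoc)
    then have "z = \<one>\<^bsub>G\<^esub>" using z3 z7 by simp
    then show False using nontriv x1 by blast
  qed
  moreover have "x \<otimes>\<^bsub>G\<^esub> z \<noteq> \<one>\<^bsub>G\<^esub>"
  proof
    assume xz: "x \<otimes>\<^bsub>G\<^esub> z = \<one>\<^bsub>G\<^esub>"
    then have "x \<otimes>\<^bsub>G\<^esub> z = x \<otimes>\<^bsub>G\<^esub> x" using xx by simp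
    then have zx: "z = x" by simp
    have "x [^]\<^bsub>G\<^esub> (7::nat) = (x \<otimes>\<^bsub>G\<^esub> x) \<otimes>\<^bsub>G\<^esub> (x \<otimes>\<^bsub>G\<^esub> x) \<otimes>\<^bsub>G\<^esub> (x \<otimes>\<^bsub>G\<^esub> x) \<otimes>\<^bsub>G\<^esub> x"
      by (simp add: numeral_eq_Suc m_assoc)
    then have "x = \<one>\<^bsub>G\<^esub>" using xx z7 zx by simp
    then show False using \<open>x \<noteq> \<one>\<^bsub>G\<^esub>\<close> by blast
  qed
  ultimately show ?thesis using that gens by blast
qed

lemma quadrangle_group_eq: "quadrangle_group_2223 = presented_group quad_relators"
  by (simp only: quadrangle_group_2223_def quad_relators_def)

text \<open>
  The four generators of \<open>H\<close> are conjugates of \<open>x\<close> and \<open>x z\<close>, hence nontrivial.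
\<close>

theorem hurwitz_maximal_reducible:
  assumes "hurwitz_group G" "\<not> surjects_onto G PSL2_7"
  shows "maximal_reducible_group G"
proof -
  obtain x z where xz: "hurwitz_generators G x z" "x \<noteq> \<one>\<^bsub>G\<^esub>" "x \<otimes>\<^bsub>G\<^esub> z \<noteq> \<one>\<^bsub>G\<^esub>"
    using hurwitz_group_generators[OF assms(1)] .
  interpret hurwitz_generators G x z by (rule xz)
  have gen: "carrier G \<subseteq> H" using generates_or_surjects_PSL2_7 assms(2) by blast
  obtain h where h: "h \<in> epi (presented_group quad_relators) G"
    "\<forall>w. h (word_class quad_relators w) = word_eval G quad_image w"
    using presented_group_epi[of
      G quad_image quad_relators, OF group_axioms quad_image_closed quad_image_relators gen] by blast
  have conj: "inv\<^bsub>G\<^esub> u \<otimes>\<^bsub>G\<^esub> v \<otimes>\<^bsub>G\<^esub> u \<noteq> \<one>\<^bsub>G\<^esub>" if "v \<noteq> \<one>\<^bsub>G\<^esub>" "u \<in> carrier G" "v \<in> carrier G" for u v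
  proof
    assume "inv\<^bsub>G\<^esub> u \<otimes>\<^bsub>G\<^esub> v \<otimes>\<^bsub>G\<^esub> u = \<one>\<^bsub>G\<^esub>"
    then have "u \<otimes>\<^bsub>G\<^esub> (inv\<^bsub>G\<^esub> u \<otimes>\<^bsub>G\<^esub> v \<otimes>\<^bsub>G\<^esub> u) \<otimes>\<^bsub>G\<^esub> inv\<^bsub>G\<^esub> u = \<one>\<^bsub>G\<^esub>" using that by simp
    then show False using that by (simp add: m_assoc)
  qed
  have "quad_image q \<noteq> \<one>\<^bsub>G\<^esub>" for q
  proof (cases q)
    case QX4
    have "quad_image QX4 = inv\<^bsub>G\<^esub> z \<otimes>\<^bsub>G\<^esub> (x \<otimes>\<^bsub>G\<^esub> z) \<otimes>\<^bsub>G\<^esub> z"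
      by (simp add: numeral_eq_Suc m_assoc)
    then show ?thesis using conj[OF xz(3)] QX4 by simp
  qed (use xz(2) conj[OF xz(2)] in simp_all)
  then have
    "torsionfree_subset (presented_group quad_relators) (kernel (presented_group quad_relators) G h)"
    using h by (intro quadrangle_kernel_torsionfree[OF group_axioms]) (auto simp: epi_def quad_image_closed)
  then show ?thesis
    using h(1) assms(1) unfolding maximal_reducible_group_def quadrangle_group_eq hurwitz_group_def by blast
qed

lemma epi_simple_group_is_iso:
  assumes "simple_group G" "group K" "h \<in> epi G K" "\<not> trivial_group K"
  shows "G \<cong> K"
proof -
  interpret simple_group G by fact
  interpret K: group K by fact
  have h: "h \<in> hom G K" "h ` carrier G = carrier K" using assms(3) by (auto simp: epi_def)
  interpret group_hom G K h using h(1) by unfold_locales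
  have "kernel G K h \<noteq> carrier G"
  proof
    assume "kernel G K h = carrier G"
    then have "carrier K \<subseteq> {\<one>\<^bsub>K\<^esub>}" unfolding h(2)[symmetric] kernel_def by blast
    then show False using assms(4) K.trivial_group_subset by (auto simp: trivial_group_def)
  qed
  then have "kernel G K h = {\<one>\<^bsub>G\<^esub>}"
    using no_real_normal_subgroup[OF normal_kernel] by blast
  then have "inj_on h (carrier G)" by (simp add: inj_iff_trivial_ker)
  then have "h \<in> iso G K" using h by (simp add: iso_def bij_betw_def)
  then show ?thesis unfolding is_iso_def by blast
qed

theorem theorem2:
  fixes G :: "('a, 'b) monoid_scheme"
  shows "(hurwitz_group G \<and> \<not> surjects_onto G PSL2_7 \<longrightarrow> maximal_reducible_group G) \<and>
    (simple_group PSL2_7 \<and> hurwitz_group PSL2_7 \<and> \<not> maximal_reducible_group PSL2_7) \<and>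
    (simple_group G \<and> hurwitz_group G \<and> \<not> maximal_reducible_group G \<longrightarrow> G \<cong> PSL2_7)"
proof (intro conjI impI)
  show "maximal_reducible_group G" if "hurwitz_group G \<and> \<not> surjects_onto G PSL2_7"
    using that hurwitz_maximal_reducible by blast
  show "simple_group PSL2_7" by (rule simple_PSL2_7)
  show "hurwitz_group PSL2_7" by (rule hurwitz_PSL2_7)
  show "\<not> maximal_reducible_group PSL2_7"
    using no_epi_quadrangle_PSL2_7 unfolding maximal_reducible_group_def quadrangle_group_eq by blast
  show "G \<cong> PSL2_7" if G: "simple_group G \<and> hurwitz_group G \<and> \<not> maximal_reducible_group G"
  proof -
    obtain h where "h \<in> epi G PSL2_7"
      using G hurwitz_maximal_reducible unfolding surjects_onto_def by blast
    then show ?thesis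
      using G hurwitz_PSL2_7 group_PSL2_7 epi_simple_group_is_iso unfolding hurwitz_group_def by blast
  qed
qed

end
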